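(* Let $\Omega\subset\mathbb{R}$ be a bounded open set and $F:=\partial\Omega$. Assume $\dim_M F=D\in(0,1)$ (Minkowski dimension relative to $\Omega$) and denote by $\mathcal{L}=(l_j)_{j\in\mathbb{N}}$ the associated fractal string. Let $h\in\mathcal{SR}_{1-D}$, and let $f(x)=x\,h(1/x)$ and $g(x)=H^{-1}(1/x)$ for all sufficiently large $x$, where $H(y)=y/h(y)$ and $H^{-1}$ is the inverse of $H$. I. (Two-sided bounds.) The following assertions are equivalent: (i) $0<\underline{\mathcal{M}}(h;F)\le\overline{\mathcal{M}}(h;F)<\infty$; (ii) $0<\underline{\mathcal{S}}(h';F)\le\overline{\mathcal{S}}(h';F)<\infty$; (iii) $l_j\asymp g(j)$, as $j\to\infty$; (iv) $\sum_{j=1}^\infty\{l_jx\}\asymp f(x)$, as $x\to\infty$; (v) $\varphi(\lambda)-N(\lambda)\asymp f(\sqrt\lambda)$, as $\lambda\to\infty$. II. (Minkowski measurability.) The following assertions are equivalent: (vi) $F$ is $h$-Minkowski measurable; (vii) $F$ is $h'$-S measurable; (viii) $l_j\sim L\,g(j)$, as $j\to\infty$, for some $L>0$. Under the assertions (vi)-(viii), the $h$-Minkowski content of $F$, the $h'$-S-content of $F$ and the constant $L$ are connected by the relation $$\mathcal{M}(h;F)=\mathcal{S}(h';F)=\frac{2^{1-D}L^D}{1-D}.$$ Moreover, the assertions (vi)-(viii) imply $$N(\lambda)=\varphi(\lambda)-c_{1,D}\,\mathcal{M}(h;F)\,f(\sqrt\lambda)+o(f(\sqrt\lambda)),\quad\text{as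 }\lambda\to\infty,$$ where $c_{1,D}=2^{D-1}\pi^{-D}(1-D)(-\zeta(D))$ with $\zeta$ being the Riemann zeta function.
   Context: Asymptotics: for positive functions (or sequences) $h_1,h_2$ defined near $a\in[0,\infty]$, $h_1(y)\asymp h_2(y)$ as $y\to a$ means there are constants $\underline c,\overline c>0$ with $\underline c\,h_1(y)\le h_2(y)\le\overline c\,h_1(y)$ for all $y$ close enough to $a$; $h_1(y)\sim h_2(y)$ as $y\to a$ means $h_1(y)/h_2(y)\to1$. $\{y\}=y-[y]$ denotes the fractional part of $y\in\mathbb{R}$, $[y]$ being the integer part. Fractal string: $(l_j)_{j\in\mathbb{N}}$ are the lengths of the connected components of $\Omega$, listed in non-increasing order $l_1\ge l_2\ge\dots$ and according to multiplicity. Gauge functions: $\mathcal{SR}_\varrho$ ($\varrho\in\mathbb{R}$) is the class of measurable $h:(0,y_0)\to(0,\infty)$ (some $y_0>0$, possibly $\infty$) with $\lim_{y\searrow0}h(ty)/h(y)=t^\varrho$ for all $t>0$ which are $C^1$-smooth in a neighborhood of $0$, i.e. $h\in C^1(0,y_1]$ for some $y_1>0$. For $h\in\mathcal{SR}_{1-D}$, the inverse $H^{-1}$ of $H(y)=y/h(y)$ is taken on a right neighborhood of $0$ on which $H$ is strictly increasing, so that $f$ and $g$ are defined on some interval $[x_0,\infty)$. Contents (all relative to $\Omega$): let $F_r=\{x\in\mathbb{R}:d(x,F)\le r\}$, let $|\cdot|_1$ be Lebesgue measure on $\mathbb{R}$ and $\mathcal{H}^0$ counting measure. $\underline{\mathcal{M}}(h;F)$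 and $\overline{\mathcal{M}}(h;F)$ are the $\liminf$ and $\limsup$ as $r\searrow0$ of $|F_r\cap\Omega|_1/h(r)$; if they coincide the common value is $\mathcal{M}(h;F)$, and $F$ is $h$-Minkowski measurable if $\mathcal{M}(h;F)$ exists and $0<\mathcal{M}(h;F)<\infty$. $\underline{\mathcal{S}}(h';F)$ and $\overline{\mathcal{S}}(h';F)$ are the $\liminf$ and $\limsup$ as $r\searrow0$ of $\mathcal{H}^0(\partial F_r\cap\Omega)/h'(r)$; if they coincide the common value is $\mathcal{S}(h';F)$, and $F$ is $h'$-S measurable if $\mathcal{S}(h';F)$ exists and $0<\mathcal{S}(h';F)<\infty$. Minkowski dimension: for $s\ge0$ let $\underline{\mathcal{M}}^s(F)$, $\overline{\mathcal{M}}^s(F)$ be the $\liminf$ and $\limsup$ as $r\searrow0$ of $|F_r\cap\Omega|_1/r^{1-s}$. The upper (lower) Minkowski dimension is $\inf\{s\ge0:\overline{\mathcal{M}}^s(F)=0\}$ (resp. $\inf\{s\ge0:\underline{\mathcal{M}}^s(F)=0\}$); if they coincide, the common value is $\dim_MF$. Spectrum: $N(\lambda)=\#\{i\in\mathbb{N}:\lambda_i\le\lambda\}$, $\lambda>0$, where $(\lambda_i)$ is the increasing sequence of eigenvalues (with multiplicity) of the Dirichlet problem $-u''=\lambda u$ in $\Omega$, $u=0$ on $F$, where an eigenvalue is a $\lambda$ for which there is $u\ne0$ in $H_0^1(\Omega)$ satisfying $-u''=\lambda u$ in the distributional sense. $\varphi(\lambda)=\pi^{-1}|\Omega|_1\lambda^{1/2}$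 is the Weyl term in dimension $1$.
   Formalization: The claims involving h' ((ii), (vii) and the value of S(h';F)) are proved under the extra condition y h'(y)/h(y) → 1−D as y→0; for h merely C¹ and regularly varying they can fail. All other claims hold for every h in SR_{1−D}. *)

theory Defs
  imports "HOL-Complex_Analysis.Complex_Analysis" "HOL-Library.Landau_Symbols"
begin

definition tfae :: "bool list \<Rightarrow> bool" where
  "tfae Ps \<longleftrightarrow> (\<forall>P\<in>set Ps. \<forall>Q\<in>set Ps. P \<longleftrightarrow> Q)"

definition asymp_bounds :: "'a filter \<Rightarrow> ('a \<Rightarrow> real) \<Rightarrow> ('a \<Rightarrow> real) \<Rightarrow> bool" where
  "asymp_bounds A h1 h2 \<longleftrightarrow>
     (\<exists>c C. 0 < c \<and> 0 < C \<and> (\<forall>\<^sub>F y in A. c * h1 y \<le> h2 y \<and> h2 y \<le> C * h1 y))"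


section \<open>Fractal strings\<close>

text \<open>Sequences are indexed by the positive integers; the value at 0 is irrelevant.\<close>

definition fractal_string :: "real set \<Rightarrow> (nat \<Rightarrow> real) \<Rightarrow> bool" where
  "fractal_string \<Omega> l \<longleftrightarrow>
     (\<exists>I. bij_betw I {1..} (components \<Omega>) \<and> (\<forall>j\<ge>1. l j = measure lebesgue (I j))) \<and>
     (\<forall>i j. 1 \<le> i \<and> i \<le> j \<longrightarrow> l j \<le> l i)"


section \<open>Contents relative to an open set\<close>

definition parallel_set :: "real set \<Rightarrow> real \<Rightarrow> real set" where
  "parallel_set F r = {x. infdist x F \<le> r}"

definition M_ratio :: "real set \<Rightarrow> (real \<Rightarrow> real) \<Rightarrow> real set \<Rightarrow> real \<Rightarrow> ereal" where
  "M_ratio \<Omega> h F r = ereal (measure lebesgue (parallel_set F r \<inter> \<Omega>)) / ereal (h r)"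

definition lower_M :: "real set \<Rightarrow> (real \<Rightarrow> real) \<Rightarrow> real set \<Rightarrow> ereal" where
  "lower_M \<Omega> h F = Liminf (at_right 0) (M_ratio \<Omega> h F)"

definition upper_M :: "real set \<Rightarrow> (real \<Rightarrow> real) \<Rightarrow> real set \<Rightarrow> ereal" where
  "upper_M \<Omega> h F = Limsup (at_right 0) (M_ratio \<Omega> h F)"

definition M_content :: "real set \<Rightarrow> (real \<Rightarrow> real) \<Rightarrow> real set \<Rightarrow> ereal" where
  "M_content \<Omega> h F = (THE m. lower_M \<Omega> h F = m \<and> upper_M \<Omega> h F = m)"

definition minkowski_measurable :: "real set \<Rightarrow> (real \<Rightarrow> real) \<Rightarrow> real set \<Rightarrow> bool" where
  "minkowski_measurable \<Omega> h F \<longleftrightarrow>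
     lower_M \<Omega> h F = upper_M \<Omega> h F \<and> 0 < M_content \<Omega> h F \<and> M_content \<Omega> h F < \<infinity>"

definition S_ratio :: "real set \<Rightarrow> (real \<Rightarrow> real) \<Rightarrow> real set \<Rightarrow> real \<Rightarrow> ereal" where
  "S_ratio \<Omega> k F r =
     enn2ereal (emeasure (count_space UNIV) (frontier (parallel_set F r) \<inter> \<Omega>)) / ereal (k r)"

definition lower_S :: "real set \<Rightarrow> (real \<Rightarrow> real) \<Rightarrow> real set \<Rightarrow> ereal" where
  "lower_S \<Omega> k F = Liminf (at_right 0) (S_ratio \<Omega> k F)"

definition upper_S :: "real set \<Rightarrow> (real \<Rightarrow> real) \<Rightarrow> real set \<Rightarrow> ereal" where
  "upper_S \<Omega> k F = Limsup (at_right 0) (S_ratio \<Omega> k F)"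

definition S_content :: "real set \<Rightarrow> (real \<Rightarrow> real) \<Rightarrow> real set \<Rightarrow> ereal" where
  "S_content \<Omega> k F = (THE m. lower_S \<Omega> k F = m \<and> upper_S \<Omega> k F = m)"

definition S_measurable :: "real set \<Rightarrow> (real \<Rightarrow> real) \<Rightarrow> real set \<Rightarrow> bool" where
  "S_measurable \<Omega> k F \<longleftrightarrow>
     lower_S \<Omega> k F = upper_S \<Omega> k F \<and> 0 < S_content \<Omega> k F \<and> S_content \<Omega> k F < \<infinity>"

definition upper_minkowski_dim :: "real set \<Rightarrow> real set \<Rightarrow> real" where
  "upper_minkowski_dim \<Omega> F = Inf {s. 0 \<le> s \<and> upper_M \<Omega> (\<lambda>r. r powr (1 - s)) F = 0}"

definition lower_minkowski_dim :: "real set \<Rightarrow> real set \<Rightarrow> real" where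
  "lower_minkowski_dim \<Omega> F = Inf {s. 0 \<le> s \<and> lower_M \<Omega> (\<lambda>r. r powr (1 - s)) F = 0}"

definition has_minkowski_dim :: "real set \<Rightarrow> real set \<Rightarrow> real \<Rightarrow> bool" where
  "has_minkowski_dim \<Omega> F D \<longleftrightarrow> upper_minkowski_dim \<Omega> F = D \<and> lower_minkowski_dim \<Omega> F = D"


section \<open>Gauge functions\<close>

definition SR :: "real \<Rightarrow> (real \<Rightarrow> real) set" where
  "SR \<rho> = {h.
     (\<exists>y0 :: ereal. 0 < y0 \<and>
        h \<in> borel_measurable (restrict_space lebesgue {y. 0 < y \<and> ereal y < y0}) \<and>
        (\<forall>y. 0 < y \<and> ereal y < y0 \<longrightarrow> 0 < h y) \<and>
        (\<exists>y1 h'. 0 < y1 \<and> ereal y1 < y0 \<and> continuous_on {0<..y1} h' \<and>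
           (\<forall>y\<in>{0<..y1}. (h has_real_derivative h' y) (at y within {0<..y1})))) \<and>
     (\<forall>t>0. ((\<lambda>y. h (t * y) / h y) \<longlongrightarrow> t powr \<rho>) (at_right 0))}"

text \<open>
  Membership in \<^term>\<open>SR \<rho>\<close> does not control the derivative: if
  \<open>log (h (exp t)) = \<rho> * t\<close> is modified so that its slope drops to a smaller value
  on intervals of vanishing length near \<open>t = -1, -2, -3, \<dots>\<close>, then \<open>h\<close> stays in
  \<^term>\<open>SR \<rho>\<close>, while \<open>h'(y)\<close> is not asymptotic to \<open>\<rho> * h(y) / y\<close>, nor comparable to it
  if the smaller values tend to 0. Contents
  with respect to \<open>h'\<close> are related to contents with respect to \<open>h\<close> only under the following
  first-order form of smooth variation (Bingham, Goldie, Teugels, Section 1.8).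
\<close>

definition smoothly_varying :: "real \<Rightarrow> (real \<Rightarrow> real) \<Rightarrow> bool" where
  "smoothly_varying \<rho> h \<longleftrightarrow> ((\<lambda>y. y * deriv h y / h y) \<longlongrightarrow> \<rho>) (at_right 0)"

definition gauge_H :: "(real \<Rightarrow> real) \<Rightarrow> real \<Rightarrow> real" where
  "gauge_H h y = y / h y"

definition gauge_f :: "(real \<Rightarrow> real) \<Rightarrow> real \<Rightarrow> real" where
  "gauge_f h x = x * h (1 / x)"

text \<open>
  The inverse of \<^term>\<open>gauge_H h\<close> is taken on \<open>(0,\<delta>)\<close>, on which \<^term>\<open>gauge_H h\<close> is supposed
  to be strictly increasing.
\<close>

definition gauge_g :: "(real \<Rightarrow> real) \<Rightarrow> real \<Rightarrow> real \<Rightarrow> real" where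
  "gauge_g h \<delta> x = the_inv_into {0<..<\<delta>} (gauge_H h) (1 / x)"


section \<open>The Dirichlet spectrum\<close>

definition test_function :: "real set \<Rightarrow> (real \<Rightarrow> real) \<Rightarrow> bool" where
  "test_function \<Omega> \<phi> \<longleftrightarrow>
     (\<forall>n x. ((deriv ^^ n) \<phi>) differentiable (at x)) \<and>
     (\<exists>K. compact K \<and> K \<subseteq> \<Omega> \<and> (\<forall>x. x \<notin> K \<longrightarrow> \<phi> x = 0))"

text \<open>
  Elements of the function spaces on \<open>\<Omega>\<close> are represented by functions on the line of which
  only the values on \<open>\<Omega>\<close> matter, up to null sets.
\<close>

definition L2_on :: "real set \<Rightarrow> (real \<Rightarrow> real) set" where
  "L2_on \<Omega> = {u. set_borel_measurable lebesgue \<Omega> u \<and> set_integrable lebesgue \<Omega> (\<lambda>x. (u x)\<^sup>2)}"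

definition weak_deriv :: "real set \<Rightarrow> (real \<Rightarrow> real) \<Rightarrow> (real \<Rightarrow> real) \<Rightarrow> bool" where
  "weak_deriv \<Omega> u v \<longleftrightarrow>
     (\<forall>\<phi>. test_function \<Omega> \<phi> \<longrightarrow>
        (LINT x:\<Omega>|lebesgue. u x * deriv \<phi> x) = - (LINT x:\<Omega>|lebesgue. v x * \<phi> x))"

text \<open>The closure of the test functions in \<open>H\<^sup>1(\<Omega>)\<close>.\<close>

definition H10 :: "real set \<Rightarrow> (real \<Rightarrow> real) set" where
  "H10 \<Omega> = {u \<in> L2_on \<Omega>. \<exists>v \<in> L2_on \<Omega>. weak_deriv \<Omega> u v \<and>
     (\<exists>\<phi>. (\<forall>n. test_function \<Omega> (\<phi> n)) \<and>
        (\<lambda>n. (LINT x:\<Omega>|lebesgue. (\<phi> n x - u x)\<^sup>2) + (LINT x:\<Omega>|lebesgue. (deriv (\<phi> n) x - v x)\<^sup>2))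
          \<longlonglongrightarrow> (0::real))}"

definition eigenspace :: "real set \<Rightarrow> real \<Rightarrow> (real \<Rightarrow> real) set" where
  "eigenspace \<Omega> \<mu> = {u \<in> H10 \<Omega>. \<forall>\<phi>. test_function \<Omega> \<phi> \<longrightarrow>
     - (LINT x:\<Omega>|lebesgue. u x * deriv (deriv \<phi>) x) = \<mu> * (LINT x:\<Omega>|lebesgue. u x * \<phi> x)}"

definition dirichlet_eigenvalue :: "real set \<Rightarrow> real \<Rightarrow> bool" where
  "dirichlet_eigenvalue \<Omega> \<mu> \<longleftrightarrow> (\<exists>u \<in> eigenspace \<Omega> \<mu>. \<not> (AE x\<in>\<Omega> in lebesgue. u x = 0))"

text \<open>The dimension of a space of functions on \<open>\<Omega>\<close> modulo equality almost everywhere.\<close>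

definition has_dim_AE :: "real set \<Rightarrow> (real \<Rightarrow> real) set \<Rightarrow> nat \<Rightarrow> bool" where
  "has_dim_AE \<Omega> E m \<longleftrightarrow>
     (\<exists>b :: nat \<Rightarrow> real \<Rightarrow> real. (\<forall>i<m. b i \<in> E) \<and>
        (\<forall>c :: nat \<Rightarrow> real. (AE x\<in>\<Omega> in lebesgue. (\<Sum>i<m. c i * b i x) = 0) \<longrightarrow> (\<forall>i<m. c i = 0)) \<and>
        (\<forall>u\<in>E. \<exists>c :: nat \<Rightarrow> real. AE x\<in>\<Omega> in lebesgue. u x = (\<Sum>i<m. c i * b i x)))"

definition dirichlet_spectrum :: "real set \<Rightarrow> (nat \<Rightarrow> real) \<Rightarrow> bool" where
  "dirichlet_spectrum \<Omega> ev \<longleftrightarrow>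
     (\<forall>i j. 1 \<le> i \<and> i \<le> j \<longrightarrow> ev i \<le> ev j) \<and>
     (\<forall>i\<ge>1. dirichlet_eigenvalue \<Omega> (ev i)) \<and>
     (\<forall>\<mu>. dirichlet_eigenvalue \<Omega> \<mu> \<longrightarrow>
        finite {i. 1 \<le> i \<and> ev i = \<mu>} \<and> has_dim_AE \<Omega> (eigenspace \<Omega> \<mu>) (card {i. 1 \<le> i \<and> ev i = \<mu>}))"

text \<open>
  If \<^term>\<open>dirichlet_spectrum \<Omega> ev\<close> and \<open>\<Omega>\<close> is bounded, the set below is finite, so \<^const>\<open>card\<close>
  is the number of its elements.
\<close>

definition counting_function :: "(nat \<Rightarrow> real) \<Rightarrow> real \<Rightarrow> real" where
  "counting_function ev x = real (card {i. 1 \<le> i \<and> ev i \<le> x})"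

definition weyl_term :: "real set \<Rightarrow> real \<Rightarrow> real" where
  "weyl_term \<Omega> x = measure lebesgue \<Omega> * sqrt x / pi"


section \<open>The Riemann zeta function\<close>

text \<open>
  The analytic continuation of the Dirichlet series, restricted to the half-plane \<open>Re s > 0\<close>;
  values outside of \<open>{s. Re s > 0} - {1}\<close> are unspecified. It is unique by the identity theorem.
\<close>

definition riemann_zeta :: "complex \<Rightarrow> complex" where
  "riemann_zeta = (SOME Z. Z holomorphic_on ({s. 0 < Re s} - {1}) \<and>
     (\<forall>s. 1 < Re s \<longrightarrow> (\<lambda>n. of_nat (Suc n) powr (- s)) sums Z s))"

definition c1 :: "real \<Rightarrow> real" where
  "c1 D = 2 powr (D - 1) * pi powr (- D) * (1 - D) * (- Re (riemann_zeta (complex_of_real D)))"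

end

theory Submission
  imports Defs
begin

text \<open>
  Write \<open>n(t)\<close> for the number of lengths exceeding \<open>t\<close>, \<open>W(t) = \<Sum> min l\<^sub>j t\<close>,
  \<open>K(t) = h(t) / t = 1 / H(t)\<close> and \<open>G(x) = \<Sum> {l\<^sub>j x}\<close>. Elementary geometry gives
  \<open>|F\<^sub>r \<inter> \<Omega>| = W(2 r)\<close> and \<open>#(\<partial>F\<^sub>r \<inter> \<Omega>) = 2 n(2 r)\<close>, and the Dirichlet spectrum, being the union of
  the spectra of the components, gives \<open>\<phi>(\<lambda>) - N(\<lambda>) = G(\<surd>\<lambda> / \<pi>)\<close>. Every assertion of the theorem is
  therefore equivalent to one on \<open>n / K\<close>, either bounds or a limit. The lengths are governed by
  \<open>l\<^sub>j > t \<longleftrightarrow> j \<le> n(t)\<close>; since \<open>n\<close> is the slope of the concave function \<open>W\<close>, the passage between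
  \<open>n\<close> and \<open>W\<close> compares \<open>W(t) - W(q t)\<close> with \<open>(1 - q) t n(t)\<close> and sums a geometric series, where
  \<open>q \<rightarrow> 1\<close> gives the sharp constant. The constant \<open>-\<zeta>(D)\<close> arises from truncating
  \<open>G(x) \<approx> x W(A/x) - \<Sum>\<^bsub>k\<le>A\<^esub> #{j. l\<^sub>j \<ge> k/x}\<close> at large \<open>A\<close>.

  For the spectrum, an eigenfunction for \<open>\<mu>\<close> satisfies \<open>(\<mu> - (k \<pi> / l\<^sub>j)\<^sup>2) \<langle>u, sin(k \<pi> (x - \<alpha>\<^sub>j) / l\<^sub>j)\<rangle> = 0\<close>
  on every component by testing with smooth truncations of the sine, so completeness of the
  sines determines it without any regularity theory.
\<close>

section \<open>Regularly varying gauge functions\<close>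

text \<open>Regular variation is available only as a limit for each fixed factor:
  \<open>h (t * y) / h y\<close> tends to \<open>t powr (1 - D)\<close>. In place of uniform
  convergence theorems, each comparison uses a single ratio \<open>q\<close>, is iterated along
  \<open>q ^ k * y\<close> where a sum is needed, and loses a factor that can be brought as close to
  1 as desired; bounds and sharp limits come out of the same one-sided lemmas. Differentiating the
  asymptotics of \<open>W\<close> would fail for a general function; the monotonicity of
  \<open>n\<close> permits it.

  Lengths equal to the threshold count for some quantities and not for others, so strict and weak
  counts \<open>n\<close> and \<open>m\<close> are carried side by side.

  The constants have separate sources: \<open>1 / (1 - D)\<close> is the limit of
  \<open>(1 - q) / (1 - q powr (1 - D))\<close> as \<open>q\<close> tends to 1,
  \<open>2 powr (1 - D)\<close> stems from tubes of radius \<open>r\<close> filling all lengths up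
  to \<open>2 * r\<close>, and the power of \<open>pi\<close> from evaluating \<open>G\<close> at
  \<open>sqrt \<lambda> / pi\<close> but the gauge at \<open>sqrt \<lambda>\<close>.\<close>

lemma telescope_upper:
  fixes V h :: "real \<Rightarrow> real"
  assumes q: "0 < q" "q < 1" and \<rho>: "0 \<le> \<rho>" "\<rho> < 1" and b: "0 \<le> b"
    and V0: "(V \<longlongrightarrow> 0) (at_right 0)"
    and hpos: "\<And>y. 0 < y \<Longrightarrow> y < y0 \<Longrightarrow> 0 \<le> h y"
    and V: "\<And>y. 0 < y \<Longrightarrow> y < y0 \<Longrightarrow> V y - V (q * y) \<le> b * h y"
    and h: "\<And>y. 0 < y \<Longrightarrow> y < y0 \<Longrightarrow> h (q * y) \<le> \<rho> * h y"
    and y: "0 < y" "y < y0"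
  shows "V y \<le> b / (1 - \<rho>) * h y"
proof -
  have small: "0 < q ^ k * y \<and> q ^ k * y < y0" for k
  proof -
    have "q ^ k \<le> 1" using q by (simp add: power_le_one)
    then have "q ^ k * y \<le> y" using y by simp
    with y(2) have "q ^ k * y < y0" by linarith
    then show ?thesis using y q by (intro conjI mult_pos_pos) auto
  qed
  have hk: "h (q ^ k * y) \<le> \<rho> ^ k * h y" for k
  proof (induction k)
    case (Suc k)
    have "h (q ^ Suc k * y) \<le> \<rho> * h (q ^ k * y)"
      using h[of "q ^ k * y"] small[of k] by (simp add: mult.assoc)
    also have "\<dots> \<le> \<rho> * (\<rho> ^ k * h y)" using Suc \<rho> by (intro mult_left_mono) auto
    finally show ?case by (simp add: mult.assoc)
  qed simp
  \<comment> \<open>The increments add up to a partial geometric series; the remainder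
    \<open>V (q ^ k * y)\<close> disappears afterwards as \<open>k\<close> tends to
    infinity.\<close>
  have Vk: "V y \<le> V (q ^ k * y) + b * h y * (\<Sum>i<k. \<rho> ^ i)" for k
  proof (induction k)
    case (Suc k)
    have "V (q ^ k * y) - V (q ^ Suc k * y) \<le> b * h (q ^ k * y)"
      using V[of "q ^ k * y"] small[of k] by (simp add: mult.assoc)
    also have "\<dots> \<le> b * (\<rho> ^ k * h y)" using hk b by (intro mult_left_mono) auto
    finally show ?case using Suc by (simp add: algebra_simps)
  qed simp
  have "filterlim (\<lambda>k. q ^ k * y) (at_right 0) sequentially"
    unfolding filterlim_at
    using q y by (auto intro!: tendsto_mult_left_zero LIMSEQ_power_zero always_eventually)
  then have lim1: "(\<lambda>k. V (q ^ k * y)) \<longlonglongrightarrow> 0"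
    using V0 by (rule filterlim_compose[rotated])
  have "(\<lambda>k. \<Sum>i<k. \<rho> ^ i) \<longlonglongrightarrow> 1 / (1 - \<rho>)"
    using geometric_sums[of \<rho>] \<rho> by (simp add: sums_def)
  then have "(\<lambda>k. V (q ^ k * y) + b * h y * (\<Sum>i<k. \<rho> ^ i)) \<longlonglongrightarrow> 0 + b * h y * (1 / (1 - \<rho>))"
    by (intro tendsto_intros lim1)
  from LIMSEQ_le_const[OF this] Vk show ?thesis by (auto simp: field_simps)
qed

text \<open>Here the remainder \<open>V (q ^ k * y)\<close> is simply discarded, so nonnegativity of
  \<open>V\<close> takes the place of its limit at 0.\<close>

lemma telescope_lower:
  fixes V h :: "real \<Rightarrow> real"
  assumes q: "0 < q" "q < 1" and \<rho>: "0 \<le> \<rho>" "\<rho> < 1" and b: "0 \<le> b"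
    and Vpos: "\<And>y. 0 < y \<Longrightarrow> 0 \<le> V y"
    and V: "\<And>y. 0 < y \<Longrightarrow> y < y0 \<Longrightarrow> b * h y \<le> V y - V (q * y)"
    and h: "\<And>y. 0 < y \<Longrightarrow> y < y0 \<Longrightarrow> \<rho> * h y \<le> h (q * y)"
    and y: "0 < y" "y < y0"
  shows "b / (1 - \<rho>) * h y \<le> V y"
proof -
  have small: "0 < q ^ k * y \<and> q ^ k * y < y0" for k
  proof -
    have "q ^ k \<le> 1" using q by (simp add: power_le_one)
    then have "q ^ k * y \<le> y" using y by simp
    with y(2) have "q ^ k * y < y0" by linarith
    then show ?thesis using y q by (intro conjI mult_pos_pos) auto
  qed
  have hk: "\<rho> ^ k * h y \<le> h (q ^ k * y)" for k
  proof (induction k)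
    case (Suc k)
    have "\<rho> * (\<rho> ^ k * h y) \<le> \<rho> * h (q ^ k * y)" using Suc \<rho> by (intro mult_left_mono) auto
    also have "\<dots> \<le> h (q ^ Suc k * y)"
      using h[of "q ^ k * y"] small[of k] by (simp add: mult.assoc)
    finally show ?case by (simp add: mult.assoc)
  qed simp
  have Vk: "V (q ^ k * y) + b * h y * (\<Sum>i<k. \<rho> ^ i) \<le> V y" for k
  proof (induction k)
    case (Suc k)
    have "b * (\<rho> ^ k * h y) \<le> b * h (q ^ k * y)" using hk b by (intro mult_left_mono) auto
    also have "\<dots> \<le> V (q ^ k * y) - V (q ^ Suc k * y)"
      using V[of "q ^ k * y"] small[of k] by (simp add: mult.assoc)
    finally show ?case using Suc by (simp add: algebra_simps)
  qed simp
  have "(\<lambda>k. \<Sum>i<k. \<rho> ^ i) \<longlonglongrightarrow> 1 / (1 - \<rho>)"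
    using geometric_sums[of \<rho>] \<rho> by (simp add: sums_def)
  then have lim: "(\<lambda>k. b * h y * (\<Sum>i<k. \<rho> ^ i)) \<longlonglongrightarrow> b * h y * (1 / (1 - \<rho>))"
    by (intro tendsto_intros)
  have "b * h y * (\<Sum>i<k. \<rho> ^ i) \<le> V y" for k
    using Vk[of k] Vpos[of "q ^ k * y"] small[of k] by linarith
  with LIMSEQ_le_const2[OF lim] show ?thesis by (auto simp: field_simps)
qed

section \<open>Scaling near 0, the gauge and its asymptotic inverse\<close>

lemma filterlim_times_at_right_0:
  fixes c :: real
  assumes "0 < c"
  shows "filterlim (\<lambda>y. c * y) (at_right 0) (at_right 0)"
proof -
  have "((\<lambda>y. c * y) \<longlongrightarrow> c * 0) (at_right 0)" by (intro tendsto_intros)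
  moreover have "\<forall>\<^sub>F y in at_right 0. 0 < c * y"
    using eventually_at_right_less[of 0] by eventually_elim (use assms in auto)
  ultimately show ?thesis unfolding filterlim_at by (auto elim: eventually_mono)
qed

lemmas eventually_scale = eventually_compose_filterlim[OF _ filterlim_times_at_right_0]

text \<open>\<open>K_anti\<close> is the strict increase of \<open>y / h y\<close>, stated for the
  reciprocal that is compared with counting functions throughout. The differentiability of
  \<open>h\<close> stays outside: continuity is spent once, on the existence of \<open>g\<close>,
  and the derivative itself only on the surface content.\<close>

locale gauge_function =
  fixes D \<delta> :: real and h :: "real \<Rightarrow> real"
  assumes D: "0 < D" "D < 1" and \<delta>: "0 < \<delta>"
    and h_pos: "\<And>y. 0 < y \<Longrightarrow> y < \<delta> \<Longrightarrow> 0 < h y"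
    and h_ratio: "\<And>t. 0 < t \<Longrightarrow> ((\<lambda>y. h (t * y) / h y) \<longlongrightarrow> t powr (1 - D)) (at_right 0)"
    and K_anti: "\<And>x y. 0 < x \<Longrightarrow> x < y \<Longrightarrow> y < \<delta> \<Longrightarrow> h y / y < h x / x"
begin

definition K :: "real \<Rightarrow> real" where "K y = h y / y"

lemma ev_small: "\<forall>\<^sub>F y in at_right 0. 0 < y \<and> y < \<delta>"
  using eventually_at_right_real[OF \<delta>] by eventually_elim auto

lemma ev_h_pos: "\<forall>\<^sub>F y in at_right 0. 0 < h y"
  using ev_small by eventually_elim (use h_pos in auto)

lemma K_pos: "0 < y \<Longrightarrow> y < \<delta> \<Longrightarrow> 0 < K y"
  by (simp add: K_def h_pos)

lemma ev_K_pos: "\<forall>\<^sub>F y in at_right 0. 0 < K y"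
  using ev_small by eventually_elim (use K_pos in auto)

lemma K_less_iff: "0 < x \<Longrightarrow> x < \<delta> \<Longrightarrow> 0 < y \<Longrightarrow> y < \<delta> \<Longrightarrow> K x < K y \<longleftrightarrow> y < x"
  using K_anti[of x y] K_anti[of y x] unfolding K_def by (cases x y rule: linorder_cases) auto

lemma K_ratio:
  assumes "0 < t"
  shows "((\<lambda>y. K (t * y) / K y) \<longlongrightarrow> t powr (- D)) (at_right 0)"
proof -
  have "((\<lambda>y. h (t * y) / h y / t) \<longlongrightarrow> t powr (1 - D) / t) (at_right 0)"
    using h_ratio[OF assms] assms by (intro tendsto_intros) auto
  moreover have "t powr (1 - D) / t = t powr (- D)"
    using assms by (simp add: powr_diff powr_minus field_simps)
  moreover have "\<forall>\<^sub>F y in at_right 0. h (t * y) / h y / t = K (t * y) / K y"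
    using eventually_at_right_less[of 0] unfolding K_def by eventually_elim (use assms in \<open>auto simp: field_simps\<close>)
  ultimately show ?thesis by (simp add: tendsto_cong)
qed

lemma h_scale_le:
  assumes "0 < t" "t powr (1 - D) < \<rho>"
  shows "\<forall>\<^sub>F y in at_right 0. h (t * y) \<le> \<rho> * h y"
  using order_tendstoD(2)[OF h_ratio[OF assms(1)] assms(2)] ev_h_pos
  by eventually_elim (simp add: field_simps)

lemma h_scale_ge:
  assumes "0 < t" "\<rho> < t powr (1 - D)"
  shows "\<forall>\<^sub>F y in at_right 0. \<rho> * h y \<le> h (t * y)"
  using order_tendstoD(1)[OF h_ratio[OF assms(1)] assms(2)] ev_h_pos
  by eventually_elim (simp add: field_simps)

lemma K_scale_le:
  assumes "0 < t" "t powr (- D) < \<rho>"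
  shows "\<forall>\<^sub>F y in at_right 0. K (t * y) \<le> \<rho> * K y"
  using order_tendstoD(2)[OF K_ratio[OF assms(1)] assms(2)] ev_K_pos
  by eventually_elim (simp add: field_simps)

lemma K_scale_ge:
  assumes "0 < t" "\<rho> < t powr (- D)"
  shows "\<forall>\<^sub>F y in at_right 0. \<rho> * K y \<le> K (t * y)"
  using order_tendstoD(1)[OF K_ratio[OF assms(1)] assms(2)] ev_K_pos
  by eventually_elim (simp add: field_simps)

text \<open>Halving a small argument multiplies \<open>K\<close> by at least
  \<open>\<rho> > 1\<close>, so \<open>K\<close> is unbounded along a dyadic sequence; strict
  decrease extends the bound from one point of it to everything on its left.\<close>

lemma K_at_top: "filterlim K at_top (at_right 0)"
  unfolding filterlim_at_top
proof
  fix B :: real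
  \<comment> \<open>The square root of the limit ratio \<open>(1/2) powr (- D)\<close>, hence
    strictly between 1 and that ratio.\<close>
  define \<rho> where "\<rho> = (1/2) powr (- D / 2)"
  have \<rho>1: "1 < \<rho>" "\<rho> < (1/2) powr (- D)"
    unfolding \<rho>_def using D by (simp_all add: powr_divide powr_minus)
  then have "\<forall>\<^sub>F y in at_right 0. \<rho> * K y \<le> K (1/2 * y)" by (intro K_scale_ge) auto
  with ev_small have "\<forall>\<^sub>F y in at_right 0. \<rho> * K y \<le> K (1/2 * y) \<and> 0 < y \<and> y < \<delta>"
    by eventually_elim auto
  then obtain b where b: "b > 0" "\<And>y. 0 < y \<Longrightarrow> y < b \<Longrightarrow> \<rho> * K y \<le> K (1/2 * y) \<and> 0 < y \<and> y < \<delta>"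
    unfolding eventually_at_right_field by auto
  define y where "y = b / 2"
  have y: "0 < y" "y < b" "y < \<delta>" using b(1) b(2)[of "b/2"] by (auto simp: y_def)
  have small: "0 < (1/2) ^ k * y \<and> (1/2) ^ k * y < b \<and> (1/2) ^ k * y < \<delta>" for k :: nat
  proof -
    have "(1/2 :: real) ^ k \<le> 1" by (simp add: power_le_one)
    then have "(1/2) ^ k * y \<le> y" using y by simp
    with y have "(1/2) ^ k * y < b" "(1/2) ^ k * y < \<delta>" by linarith+
    then show ?thesis using y by (intro conjI mult_pos_pos) auto
  qed
  have step: "\<rho> ^ k * K y \<le> K ((1/2) ^ k * y)" for k :: nat
  proof (induction k)
    case (Suc k)
    have "\<rho> * (\<rho> ^ k * K y) \<le> \<rho> * K ((1/2) ^ k * y)" using Suc \<rho>1 by (intro mult_left_mono) auto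
    also have "\<dots> \<le> K ((1/2) ^ Suc k * y)" using b(2)[of "(1/2) ^ k * y"] small[of k] by (simp add: mult.assoc)
    finally show ?case by (simp add: mult.assoc)
  qed simp
  have Ky: "0 < K y" using K_pos y by auto
  obtain k where k: "B / K y < \<rho> ^ k" using real_arch_pow[OF \<rho>1(1)] by blast
  then have "B < \<rho> ^ k * K y" using Ky by (simp add: field_simps)
  then have B: "B < K ((1/2) ^ k * y)" using step[of k] by linarith
  have "\<forall>\<^sub>F z in at_right 0. 0 < z \<and> z < (1/2) ^ k * y"
    using eventually_at_right_real[of 0 "(1/2) ^ k * y"] small[of k] by (auto elim: eventually_mono)
  then show "\<forall>\<^sub>F z in at_right 0. B \<le> K z"
  proof eventually_elim
    case (elim z)
    then have "K ((1/2) ^ k * y) < K z" using small[of k] by (subst K_less_iff) auto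
    then show ?case using B by simp
  qed
qed

end

text \<open>The condition on \<open>g x\<close> reads \<open>K (g x) = x\<close>. It is required for
  large \<open>x\<close> only, since \<open>1 / x\<close> has to lie in the range of
  \<open>y / h y\<close> near 0.\<close>

locale gauge = gauge_function D \<delta> h for D \<delta> :: real and h :: "real \<Rightarrow> real" +
  fixes g :: "real \<Rightarrow> real"
  assumes g: "\<forall>\<^sub>F x in at_top. 0 < g x \<and> g x < \<delta> \<and> h (g x) / g x = x"
begin

lemma g_at_right_0: "filterlim g (at_right 0) at_top"
proof -
  have "\<forall>\<^sub>F x in at_top. g x < e" if "0 < e" for e
  proof -
    define e' where "e' = min e (\<delta> / 2)"
    have e': "0 < e'" "e' \<le> e" "e' < \<delta>" using that \<delta> by (auto simp: e'_def)
    show ?thesis using g eventually_gt_at_top[of "K e'"]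
    proof eventually_elim
      case (elim x)
      then have "K e' < K (g x)" by (simp add: K_def)
      then have "g x < e'" using elim e' by (subst (asm) K_less_iff) auto
      then show ?case using e' by simp
    qed
  qed
  moreover have "\<forall>\<^sub>F x in at_top. 0 < g x" using g by eventually_elim auto
  ultimately show ?thesis unfolding filterlim_at
    by (auto intro!: order_tendstoI elim: eventually_mono order.strict_trans)
qed

lemma g_seq: "\<forall>\<^sub>F j in sequentially. 0 < g (real j) \<and> g (real j) < \<delta> \<and> K (g (real j)) = real j"
  using eventually_compose_filterlim[OF g filterlim_real_sequentially] by (simp add: K_def)

lemma g_seq_at_right_0: "filterlim (\<lambda>j. g (real j)) (at_right 0) sequentially"
  using g_at_right_0 filterlim_real_sequentially by (rule filterlim_compose)

end

section \<open>Non-increasing summable length sequences\<close>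

lemma asymp_bounds_sym:
  assumes "asymp_bounds A u v"
  shows "asymp_bounds A v u"
proof -
  from assms obtain c C where c: "0 < c" "0 < C" and
    ev: "\<forall>\<^sub>F y in A. c * u y \<le> v y \<and> v y \<le> C * u y"
    unfolding asymp_bounds_def by blast
  from ev have "\<forall>\<^sub>F y in A. 1 / C * v y \<le> u y \<and> u y \<le> 1 / c * v y"
    by eventually_elim (use c in \<open>auto simp: field_simps\<close>)
  then show ?thesis unfolding asymp_bounds_def using c
    by (intro exI[of _ "1 / C"] exI[of _ "1 / c"]) auto
qed

lemma asymp_bounds_commute: "asymp_bounds A u v \<longleftrightarrow> asymp_bounds A v u"
  using asymp_bounds_sym by blast

text \<open>Applied to superlevel sets of a non-increasing sequence, whose cardinality thereby
  becomes the last index in them.\<close>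

lemma downset_eq_atLeastAtMost_card:
  fixes S :: "nat set"
  assumes "finite S" and "\<And>j. j \<in> S \<Longrightarrow> 1 \<le> j" and "\<And>i j. j \<in> S \<Longrightarrow> 1 \<le> i \<Longrightarrow> i \<le> j \<Longrightarrow> i \<in> S"
  shows "S = {1..card S}"
proof (cases "S = {}")
  case False
  have "S = {1..Max S}"
  proof
    show "S \<subseteq> {1..Max S}" using assms(1,2) by (auto intro: Suc_leI simp: Suc_le_eq)
    show "{1..Max S} \<subseteq> S" using assms(3)[of "Max S"] Max_in[OF assms(1) False] by auto
  qed
  then show ?thesis by (metis card_atLeastAtMost diff_Suc_1)
qed auto

locale length_sequence =
  fixes l :: "nat \<Rightarrow> real"
  assumes l_pos: "\<And>j. 1 \<le> j \<Longrightarrow> 0 < l j"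
    and l_anti: "\<And>i j. 1 \<le> i \<Longrightarrow> i \<le> j \<Longrightarrow> l j \<le> l i"
    and l_summable: "summable (\<lambda>j. l (Suc j))"
begin

text \<open>Strict and weak counts are both kept because the frontier of a parallel set sees
  \<open>t < l j\<close>, while integer parts see \<open>t \<le> l j\<close>. Relative to
  \<open>K\<close> they have the same limit, see \<open>tendsto_m_of_n\<close>.\<close>

definition n :: "real \<Rightarrow> nat" where "n t = card {j. 1 \<le> j \<and> t < l j}"
definition m :: "real \<Rightarrow> nat" where "m t = card {j. 1 \<le> j \<and> t \<le> l j}"
definition W :: "real \<Rightarrow> real" where "W t = (\<Sum>j. min (l (Suc j)) t)"
definition G :: "real \<Rightarrow> real" where "G x = (\<Sum>j. frac (l (Suc j) * x))"

lemma l_tendsto_0: "l \<longlonglongrightarrow> 0"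
  using summable_LIMSEQ_zero[OF l_summable] by (simp add: filterlim_sequentially_Suc)

lemma fin_ge: "0 < t \<Longrightarrow> finite {j. 1 \<le> j \<and> t \<le> l j}"
proof -
  assume "0 < t"
  with l_tendsto_0 have "\<forall>\<^sub>F j in sequentially. l j < t" by (rule order_tendstoD)
  then obtain N where "\<And>j. N \<le> j \<Longrightarrow> l j < t" unfolding eventually_sequentially by blast
  then have "{j. 1 \<le> j \<and> t \<le> l j} \<subseteq> {..N}" by (force simp: not_less[symmetric])
  then show ?thesis by (rule finite_subset) auto
qed

lemma fin_gt: "0 < t \<Longrightarrow> finite {j. 1 \<le> j \<and> t < l j}"
  by (rule finite_subset[OF _ fin_ge]) auto

lemma n_iff:
  assumes "0 < t" "1 \<le> j"
  shows "t < l j \<longleftrightarrow> j \<le> n t"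
proof -
  have "{j. 1 \<le> j \<and> t < l j} = {1..n t}" unfolding n_def
    by (rule downset_eq_atLeastAtMost_card)
      (use fin_gt[OF assms(1)] in \<open>auto intro: less_le_trans[OF _ l_anti]\<close>)
  from arg_cong[OF this, of "\<lambda>S. j \<in> S"] show ?thesis using assms(2) by simp
qed

lemma m_iff:
  assumes "0 < t" "1 \<le> j"
  shows "t \<le> l j \<longleftrightarrow> j \<le> m t"
proof -
  have "{j. 1 \<le> j \<and> t \<le> l j} = {1..m t}" unfolding m_def
    by (rule downset_eq_atLeastAtMost_card)
      (use fin_ge[OF assms(1)] in \<open>auto intro: order.trans[OF _ l_anti]\<close>)
  from arg_cong[OF this, of "\<lambda>S. j \<in> S"] show ?thesis using assms(2) by simp
qed

lemma n_le_m: "0 < t \<Longrightarrow> n t \<le> m t"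
  unfolding n_def m_def by (rule card_mono[OF fin_ge]) auto

lemma m_le_n: "0 < s \<Longrightarrow> s < t \<Longrightarrow> m t \<le> n s"
  unfolding n_def m_def by (rule card_mono[OF fin_gt]) auto

lemma m_mono: "0 < s \<Longrightarrow> s \<le> t \<Longrightarrow> m t \<le> m s"
  unfolding m_def by (rule card_mono[OF fin_ge]) auto

lemma n_at_top: "filterlim n at_top (at_right 0)"
  unfolding filterlim_at_top
proof
  fix N :: nat
  define k where "k = Suc N"
  have k: "1 \<le> k" by (simp add: k_def)
  show "\<forall>\<^sub>F t in at_right 0. N \<le> n t"
    using eventually_at_right_real[OF l_pos[OF k]]
  proof eventually_elim
    case (elim t)
    then have "k \<le> n t" using n_iff[OF _ k, of t] by simp
    then show ?case by (simp add: k_def)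
  qed
qed

lemma n_sums:
  assumes "0 < t"
  shows "(\<lambda>j. of_bool (t < l (Suc j)) :: real) sums n t"
proof -
  have "(\<lambda>j. of_bool (j \<in> {..<n t}) :: real) sums (\<Sum>j<n t. 1)"
    using sums_If_finite_set[of "{..<n t}" "\<lambda>_. 1 :: real"] by (simp add: of_bool_def)
  moreover have "t < l (Suc j) \<longleftrightarrow> j \<in> {..<n t}" for j
    using n_iff[OF assms, of "Suc j"] by (simp add: Suc_le_eq)
  ultimately show ?thesis by simp
qed

lemma m_sums:
  assumes "0 < t"
  shows "(\<lambda>j. of_bool (t \<le> l (Suc j)) :: real) sums m t"
proof -
  have "(\<lambda>j. of_bool (j \<in> {..<m t}) :: real) sums (\<Sum>j<m t. 1)"
    using sums_If_finite_set[of "{..<m t}" "\<lambda>_. 1 :: real"] by (simp add: of_bool_def)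
  moreover have "t \<le> l (Suc j) \<longleftrightarrow> j \<in> {..<m t}" for j
    using m_iff[OF assms, of "Suc j"] by (simp add: Suc_le_eq)
  ultimately show ?thesis by simp
qed

lemma l_Suc_pos: "0 < l (Suc j)"
  by (simp add: l_pos)

lemma W_summable: "0 \<le> t \<Longrightarrow> summable (\<lambda>j. min (l (Suc j)) t)"
  by (rule summable_comparison_test'[OF l_summable, of 0]) (use l_Suc_pos in \<open>auto simp: less_imp_le\<close>)

lemma W_sums: "0 \<le> t \<Longrightarrow> (\<lambda>j. min (l (Suc j)) t) sums W t"
  unfolding W_def by (rule summable_sums[OF W_summable])

lemma frac_le_self: "0 \<le> x \<Longrightarrow> frac x \<le> (x::real)"
  by (simp add: frac_def)

lemma G_summable: "0 < x \<Longrightarrow> summable (\<lambda>j. frac (l (Suc j) * x))"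
  by (rule summable_comparison_test'[OF summable_mult2[OF l_summable, of x], of 0])
    (use l_Suc_pos in \<open>auto intro!: frac_le_self simp: less_imp_le\<close>)

lemma G_sums: "0 < x \<Longrightarrow> (\<lambda>j. frac (l (Suc j) * x)) sums G x"
  unfolding G_def by (rule summable_sums[OF G_summable])

lemma W_nonneg: "0 \<le> t \<Longrightarrow> 0 \<le> W t"
  unfolding W_def by (rule suminf_nonneg[OF W_summable]) (use l_Suc_pos in \<open>auto simp: less_imp_le\<close>)

text \<open>Only lengths above \<open>s\<close> contribute to the increment, each at most
  \<open>t - s\<close>. Together with \<open>W_diff_ge\<close> this places the secant slope of
  \<open>W\<close> over \<open>[s, t]\<close> between \<open>n t\<close> and
  \<open>n s\<close>.\<close>

lemma W_diff_le:
  assumes "0 < s" "s \<le> t"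
  shows "W t - W s \<le> real (n s) * (t - s)"
proof (rule sums_le)
  show "(\<lambda>j. min (l (Suc j)) t - min (l (Suc j)) s) sums (W t - W s)"
    using assms by (intro sums_diff W_sums) auto
  show "(\<lambda>j. of_bool (s < l (Suc j)) * (t - s)) sums (real (n s) * (t - s))"
    using assms by (intro sums_mult2 n_sums)
  show "min (l (Suc j)) t - min (l (Suc j)) s \<le> of_bool (s < l (Suc j)) * (t - s)" for j
    using assms by auto
qed

lemma W_diff_ge:
  assumes "0 < s" "s \<le> t"
  shows "real (n t) * (t - s) \<le> W t - W s"
proof (rule sums_le)
  show "(\<lambda>j. min (l (Suc j)) t - min (l (Suc j)) s) sums (W t - W s)"
    using assms by (intro sums_diff W_sums) auto
  show "(\<lambda>j. of_bool (t < l (Suc j)) * (t - s)) sums (real (n t) * (t - s))"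
    using assms by (intro sums_mult2 n_sums) auto
  show "of_bool (t < l (Suc j)) * (t - s) \<le> min (l (Suc j)) t - min (l (Suc j)) s" for j
    using assms by auto
qed

lemma n_le_W: "0 < t \<Longrightarrow> real (n t) * t \<le> W t"
proof (rule sums_le)
  assume t: "0 < t"
  show "(\<lambda>j. min (l (Suc j)) t) sums W t"
    using t by (intro W_sums) auto
  show "(\<lambda>j. of_bool (t < l (Suc j)) * t) sums (real (n t) * t)"
    using t by (intro sums_mult2 n_sums) auto
  show "of_bool (t < l (Suc j)) * t \<le> min (l (Suc j)) t" for j
    using t l_Suc_pos[of j] by auto
qed

lemma W_tendsto_0: "(W \<longlongrightarrow> 0) (at_right 0)"
proof (rule order_tendstoI)
  fix e :: real assume e: "e < 0"
  show "\<forall>\<^sub>F t in at_right 0. e < W t"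
    using eventually_at_right_less[of "0 :: real"]
    by eventually_elim (use W_nonneg e in \<open>auto intro: less_le_trans\<close>)
next
  fix e :: real assume e: "0 < e"
  obtain N where N: "norm (\<Sum>i. l (Suc (i + N))) < e / 2"
    using suminf_exist_split[OF _ l_summable, of "e / 2"] e by auto
  \<comment> \<open>The \<open>N\<close> initial terms contribute at most \<open>N * t\<close>;
    \<open>N + 1\<close> in the denominator covers \<open>N = 0\<close>.\<close>
  have "\<forall>\<^sub>F t in at_right 0. 0 < t \<and> t < e / (2 * (N + 1))"
    using eventually_at_right_real[of 0 "e / (2 * (N + 1))"] e by (simp add: greaterThanLessThan_iff)
  then show "\<forall>\<^sub>F t in at_right 0. W t < e"
  proof eventually_elim
    case (elim t)
    have "W t = (\<Sum>i. min (l (Suc (i + N))) t) + (\<Sum>i<N. min (l (Suc i)) t)"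
      unfolding W_def using elim by (intro suminf_split_initial_segment W_summable) auto
    moreover have "(\<Sum>i<N. min (l (Suc i)) t) \<le> (\<Sum>i<N. t)" by (intro sum_mono) auto
    moreover have "(\<Sum>i. min (l (Suc (i + N))) t) \<le> (\<Sum>i. l (Suc (i + N)))"
    proof (rule suminf_le)
      show "summable (\<lambda>i. min (l (Suc (i + N))) t)"
        using summable_ignore_initial_segment[OF W_summable[of t], of N] elim by auto
      show "summable (\<lambda>i. l (Suc (i + N)))"
        using summable_ignore_initial_segment[OF l_summable, of N] by auto
    qed auto
    moreover have "N * t \<le> (N + 1) * t" using elim by (simp add: algebra_simps)
    moreover have "(N + 1) * t < e / 2" using elim by (simp add: field_simps)
    ultimately show ?case using N by simp
  qed
qed

text \<open>Termwise this is \<open>frac y \<le> min y 1\<close> at \<open>y = l j / t\<close>,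
  multiplied by \<open>t\<close>.\<close>

lemma G_le_W: "0 < t \<Longrightarrow> t * G (1 / t) \<le> W t"
proof (rule sums_le)
  assume t: "0 < t"
  show "(\<lambda>j. min (l (Suc j)) t) sums W t" using t by (intro W_sums) auto
  show "(\<lambda>j. t * frac (l (Suc j) * (1 / t))) sums (t * G (1 / t))"
    using t by (intro sums_mult G_sums) auto
  show "t * frac (l (Suc j) * (1 / t)) \<le> min (l (Suc j)) t" for j
  proof -
    have "frac (l (Suc j) * (1 / t)) \<le> l (Suc j) * (1 / t)"
      using t l_Suc_pos[of j] by (intro frac_le_self) auto
    moreover have "frac (l (Suc j) * (1 / t)) \<le> 1" by (simp add: frac_lt_1 less_imp_le)
    ultimately show ?thesis using t by (simp add: field_simps)
  qed
qed

text \<open>A length in \<open>[b * t, t)\<close> makes \<open>l j / t\<close> a number in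
  \<open>[b, 1)\<close>, which is its own fractional part and so contributes at least
  \<open>b\<close>; all other terms are dropped.\<close>

lemma G_ge_count:
  assumes t: "0 < t" and b: "0 < b" "b < 1"
  shows "b * (real (m (b * t)) - real (m t)) \<le> G (1 / t)"
proof (rule sums_le)
  show "(\<lambda>j. frac (l (Suc j) * (1 / t))) sums G (1 / t)" using t by (intro G_sums) auto
  show "(\<lambda>j. b * (of_bool (b * t \<le> l (Suc j)) - of_bool (t \<le> l (Suc j)))) sums
      (b * (real (m (b * t)) - real (m t)))"
    using t b by (intro sums_mult sums_diff m_sums) auto
  show "b * (of_bool (b * t \<le> l (Suc j)) - of_bool (t \<le> l (Suc j))) \<le> frac (l (Suc j) * (1 / t))" for j
  proof (cases "b * t \<le> l (Suc j) \<and> l (Suc j) < t")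
    case True
    then have "frac (l (Suc j) * (1 / t)) = l (Suc j) * (1 / t)"
      using t l_Suc_pos[of j] by (simp add: frac_eq)
    moreover have "b \<le> l (Suc j) * (1 / t)" using True t by (simp add: field_simps)
    ultimately show ?thesis using True by simp
  next
    case False
    then have "b * (of_bool (b * t \<le> l (Suc j)) - of_bool (t \<le> l (Suc j))) \<le> 0"
      using b by (auto simp: mult_le_0_iff)
    then show ?thesis using frac_ge_0[of "l (Suc j) * (1 / t)"] by linarith
  qed
qed

text \<open>For \<open>0 \<le> y < A\<close> the fractional part of \<open>y\<close> is \<open>y\<close> minus the number of integers in \<open>{1..A}\<close>
  that are at most \<open>y\<close>; truncating at \<open>A\<close> turns \<open>G\<close> into \<open>W\<close> and finitely many counting functions.\<close>

lemma frac_truncate: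
  fixes y :: real and A :: nat
  assumes "0 \<le> y"
  defines "\<Phi> \<equiv> min y A - (\<Sum>k=1..A. of_bool (real k \<le> y))"
  shows "\<Phi> \<le> frac y" "frac y \<le> \<Phi> + of_bool (A \<le> y)"
proof -
  have "(\<Sum>k=1..A. of_bool (real k \<le> y)) = real (card ({1..A} \<inter> {k. real k \<le> y}))"
    by (simp add: sum.If_cases of_bool_def)
  also have "{1..A} \<inter> {k. real k \<le> y} = {1..min A (nat \<lfloor>y\<rfloor>)}"
    using assms by (auto simp: le_nat_iff le_floor_iff)
  finally have S: "(\<Sum>k=1..A. of_bool (real k \<le> y)) = real (min A (nat \<lfloor>y\<rfloor>))" by simp
  have "\<Phi> \<le> frac y \<and> frac y \<le> \<Phi> + of_bool (A \<le> y)"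
  proof (cases "A \<le> y")
    case True
    then have "int A \<le> \<lfloor>y\<rfloor>" by (simp add: le_floor_iff)
    then have "min A (nat \<lfloor>y\<rfloor>) = A" using assms by auto
    then show ?thesis using True frac_ge_0[of y] frac_lt_1[of y] unfolding \<Phi>_def S by simp
  next
    case False
    then have "\<lfloor>y\<rfloor> < int A" by (simp add: floor_less_iff)
    then have "min A (nat \<lfloor>y\<rfloor>) = nat \<lfloor>y\<rfloor>" using assms by auto
    then show ?thesis using False assms unfolding \<Phi>_def S by (simp add: frac_def)
  qed
  then show "\<Phi> \<le> frac y" "frac y \<le> \<Phi> + of_bool (A \<le> y)" by auto
qed

text \<open>The truncation errs by at most 1 for each length with \<open>A * t \<le> l j\<close> and
  not at all for the others; this is the extra \<open>m (A * t)\<close>.\<close>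

lemma G_truncate:
  fixes A :: nat and t :: real
  assumes t: "0 < t" and A: "1 \<le> A"
  defines "\<Phi> \<equiv> W (A * t) / t - (\<Sum>k=1..A. real (m (k * t)))"
  shows "\<Phi> \<le> G (1 / t)" "G (1 / t) \<le> \<Phi> + real (m (A * t))"
proof -
  have W: "(\<lambda>j. min (l (Suc j) * (1 / t)) A) sums (W (A * t) / t)"
  proof -
    have "(\<lambda>j. min (l (Suc j)) (A * t) / t) sums (W (A * t) / t)"
      using t by (intro sums_divide W_sums) auto
    moreover have "min (l (Suc j)) (A * t) / t = min (l (Suc j) * (1 / t)) A" for j
      using t by (auto simp: min_def field_simps)
    ultimately show ?thesis by simp
  qed
  have m: "(\<lambda>j. of_bool (real k \<le> l (Suc j) * (1 / t)) :: real) sums m (k * t)" if "1 \<le> k" for k :: nat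
    using m_sums[of "k * t"] t that by (simp add: field_simps)
  have \<Phi>: "(\<lambda>j. min (l (Suc j) * (1 / t)) A - (\<Sum>k=1..A. of_bool (real k \<le> l (Suc j) * (1 / t)))) sums \<Phi>"
    unfolding \<Phi>_def by (intro sums_diff sums_sum W m) auto
  have G: "(\<lambda>j. frac (l (Suc j) * (1 / t))) sums G (1 / t)" using t by (intro G_sums) auto
  have nonneg: "0 \<le> l (Suc j) * (1 / t)" for j using t l_Suc_pos[of j] by simp
  show "\<Phi> \<le> G (1 / t)" by (rule sums_le[OF _ \<Phi> G]) (rule frac_truncate[OF nonneg])
  show "G (1 / t) \<le> \<Phi> + real (m (A * t))"
    by (rule sums_le[OF _ G sums_add[OF \<Phi> m[OF A]]]) (rule frac_truncate[OF nonneg])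
qed

end

section \<open>Lengths, counting function and tube volume\<close>

text \<open>A difference quotient at 1; with \<open>p = 1 - D\<close> it produces the factor
  \<open>1 - D\<close> of the sharp constants.\<close>

lemma powr_slope: "((\<lambda>q. (1 - q powr p) / (1 - q)) \<longlongrightarrow> p) (at (1::real))"
proof -
  have "((\<lambda>q. q powr p) has_real_derivative p) (at 1)"
    using has_real_derivative_powr[of 1 p] by simp
  then have "((\<lambda>q. (q powr p - 1) / (q - 1)) \<longlongrightarrow> p) (at 1)"
    by (simp add: has_field_derivative_iff)
  moreover have "(q powr p - 1) / (q - 1) = (1 - q powr p) / (1 - q)" for q
    using minus_divide_divide[of "1 - q powr p" "1 - q"] by simp
  ultimately show ?thesis by simp
qed

locale gauged_string = gauge D \<delta> h g + length_sequence l
  for D \<delta> :: real and h g :: "real \<Rightarrow> real" and l :: "nat \<Rightarrow> real"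
begin

text \<open>The last length above \<open>t\<close> has index \<open>n t\<close>, so
  \<open>t < l (n t) \<le> C * g (n t)\<close>. Applying the decreasing \<open>K\<close> gives
  \<open>n t < K (t / C)\<close>, which is about \<open>C powr D * K t\<close>; the slack in
  \<open>C'\<close> absorbs the error.\<close>

lemma n_le_of_l_le:
  assumes l: "\<forall>\<^sub>F j in sequentially. l j \<le> C * g (real j)" and C: "0 < C" "C powr D < C'"
  shows "\<forall>\<^sub>F t in at_right 0. n t \<le> C' * K t"
proof -
  have "\<forall>\<^sub>F j in sequentially. 1 \<le> j \<and> l j \<le> C * g (real j) \<and> 0 < g (real j) \<and> g (real j) < \<delta> \<and> K (g (real j)) = real j"
    using l g_seq eventually_ge_at_top[of "1::nat"] by eventually_elim auto
  from eventually_compose_filterlim[OF this n_at_top]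
  have 1: "\<forall>\<^sub>F t in at_right 0. 1 \<le> n t \<and> l (n t) \<le> C * g (real (n t)) \<and> 0 < g (real (n t))
      \<and> g (real (n t)) < \<delta> \<and> K (g (real (n t))) = real (n t)" .
  have 2: "\<forall>\<^sub>F t in at_right 0. K (1 / C * t) \<le> C' * K t"
    using C by (intro K_scale_le) (auto simp: powr_minus powr_divide)
  have 3: "\<forall>\<^sub>F t in at_right 0. 0 < t / C \<and> t / C < \<delta>"
    using eventually_scale[OF ev_small, of "1 / C"] C by simp
  show ?thesis using 1 2 3 eventually_at_right_less[of "0::real"]
  proof eventually_elim
    case (elim t)
    have "t < l (n t)" using n_iff[of t "n t"] elim by auto
    then have "t / C < g (n t)" using elim C by (simp add: field_simps)
    then have "K (g (n t)) < K (t / C)" using elim by (subst K_less_iff) auto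
    then show ?case using elim by simp
  qed
qed

text \<open>The first length not above \<open>t\<close> has index \<open>n t + 1\<close>. The
  additive 1 is absorbed between \<open>C'\<close> and an intermediate \<open>C''\<close>, because
  \<open>K\<close> tends to infinity.\<close>

lemma n_ge_of_l_ge:
  assumes l: "\<forall>\<^sub>F j in sequentially. C * g (real j) \<le> l j" and C: "0 < C" "C' < C powr D"
  shows "\<forall>\<^sub>F t in at_right 0. C' * K t \<le> n t"
proof -
  obtain C'' where C'': "C' < C''" "C'' < C powr D" using dense C(2) by blast
  have "\<forall>\<^sub>F j in sequentially. 1 \<le> j \<and> C * g (real j) \<le> l j \<and> 0 < g (real j) \<and> g (real j) < \<delta> \<and> K (g (real j)) = real j"
    using l g_seq eventually_ge_at_top[of "1::nat"] by eventually_elim auto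
  moreover have "filterlim (\<lambda>t. n t + 1) at_top (at_right 0)"
    by (rule filterlim_at_top_mono[OF n_at_top]) simp
  ultimately
  have 1: "\<forall>\<^sub>F t in at_right 0. C * g (real (n t + 1)) \<le> l (n t + 1) \<and> 0 < g (real (n t + 1))
      \<and> g (real (n t + 1)) < \<delta> \<and> K (g (real (n t + 1))) = real (n t + 1)"
    by (auto dest: eventually_compose_filterlim elim: eventually_mono)
  have 2: "\<forall>\<^sub>F t in at_right 0. C'' * K t \<le> K (1 / C * t)"
    using C C'' by (intro K_scale_ge) (auto simp: powr_minus powr_divide)
  have 3: "\<forall>\<^sub>F t in at_right 0. 0 < t / C \<and> t / C < \<delta>"
    using eventually_scale[OF ev_small, of "1 / C"] C by simp
  have 4: "\<forall>\<^sub>F t in at_right 0. 1 / (C'' - C') \<le> K t"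
    using K_at_top by (simp add: filterlim_at_top)
  show ?thesis using 1 2 3 4 eventually_at_right_less[of "0::real"]
  proof eventually_elim
    case (elim t)
    have "l (n t + 1) \<le> t" using n_iff[of t "n t + 1"] elim by (auto simp: not_less[symmetric])
    then have "g (real (n t + 1)) \<le> t / C" using elim C by (simp add: field_simps)
    then have "K (t / C) \<le> K (g (real (n t + 1)))" using elim
      by (subst not_less[symmetric], subst K_less_iff) auto
    then have "C'' * K t \<le> n t + 1" using elim by simp
    moreover have "1 \<le> (C'' - C') * K t" using elim C'' by (simp add: field_simps)
    ultimately show ?case by (simp add: algebra_simps)
  qed
qed

text \<open>At the threshold \<open>C' * g j\<close> the count falls below
  \<open>K (g j) = j\<close>, so the length with index \<open>j\<close> cannot exceed that
  threshold.\<close>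

lemma l_le_of_n_le:
  assumes n: "\<forall>\<^sub>F t in at_right 0. n t \<le> C * K t" and C: "0 < C'" "C < C' powr D"
  shows "\<forall>\<^sub>F j in sequentially. l j \<le> C' * g (real j)"
proof -
  \<comment> \<open>\<open>\<rho>\<close> will bound \<open>K (C' * t) / K t\<close>, so
    \<open>C * \<rho> < 1\<close> is what pushes the count below \<open>j\<close>. For
    \<open>C \<le> 0\<close> any \<open>\<rho>\<close> above the limit ratio serves.\<close>
  have "\<exists>\<rho>>C' powr (- D). C * \<rho> < 1"
  proof (cases "C \<le> 0")
    case True
    then have "C * (C' powr (- D) + 1) \<le> 0" by (intro mult_nonpos_nonneg) auto
    then show ?thesis by (intro exI[of _ "C' powr (- D) + 1"]) auto
  next
    case False
    then have "C' powr (- D) < 1 / C" using C by (simp add: powr_minus field_simps)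
    then obtain \<rho> where "C' powr (- D) < \<rho>" "\<rho> < 1 / C" using dense by blast
    then show ?thesis using False by (intro exI[of _ \<rho>]) (auto simp: field_simps)
  qed
  then obtain \<rho> where \<rho>: "C' powr (- D) < \<rho>" "C * \<rho> < 1" by blast
  have 1: "\<forall>\<^sub>F t in at_right 0. n (C' * t) \<le> C * K (C' * t)"
    using eventually_scale[OF n] C by auto
  have 2: "\<forall>\<^sub>F t in at_right 0. K (C' * t) \<le> \<rho> * K t"
    using C \<rho> by (intro K_scale_le) auto
  have 3: "\<forall>\<^sub>F t in at_right 0. 0 < C' * t \<and> C' * t < \<delta>"
    using eventually_scale[OF ev_small] C by auto
  have "\<forall>\<^sub>F t in at_right 0. n (C' * t) < K t"
    using 1 2 3 ev_K_pos
  proof eventually_elim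
    case (elim t)
    then have "0 < K (C' * t)" by (intro K_pos) auto
    show ?case
    proof (cases "C \<le> 0")
      case True
      then have "C * K (C' * t) \<le> 0" using \<open>0 < K (C' * t)\<close> by (intro mult_nonpos_nonneg) auto
      then show ?thesis using elim by linarith
    next
      case False
      then have "C * K (C' * t) \<le> C * (\<rho> * K t)" using elim by (intro mult_left_mono) auto
      also have "\<dots> < K t" using elim \<rho> by (simp add: mult.assoc[symmetric])
      finally show ?thesis using elim by linarith
    qed
  qed
  from eventually_compose_filterlim[OF this g_seq_at_right_0]
  have "\<forall>\<^sub>F j in sequentially. n (C' * g (real j)) < K (g (real j))" .
  then show ?thesis using g_seq eventually_ge_at_top[of "1::nat"]
  proof eventually_elim
    case (elim j)
    then have "\<not> j \<le> n (C' * g (real j))" by simp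
    then show ?case using n_iff[of "C' * g (real j)" j] C elim by auto
  qed
qed

lemma l_ge_of_n_ge:
  assumes n: "\<forall>\<^sub>F t in at_right 0. C * K t \<le> n t" and C: "0 < C'" "C' powr D < C"
  shows "\<forall>\<^sub>F j in sequentially. C' * g (real j) \<le> l j"
proof -
  have "0 < C" using C by (meson le_less_trans powr_ge_zero)
  have "1 / C < C' powr (- D)" using C \<open>0 < C\<close> by (simp add: powr_minus field_simps)
  then have 2: "\<forall>\<^sub>F t in at_right 0. 1 / C * K t \<le> K (C' * t)"
    using C by (intro K_scale_ge) auto
  have 1: "\<forall>\<^sub>F t in at_right 0. C * K (C' * t) \<le> n (C' * t)"
    using eventually_scale[OF n] C by auto
  have "\<forall>\<^sub>F t in at_right 0. K t \<le> n (C' * t)"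
    using 1 2 by eventually_elim (use \<open>0 < C\<close> in \<open>simp add: field_simps\<close>)
  from eventually_compose_filterlim[OF this g_seq_at_right_0]
  have "\<forall>\<^sub>F j in sequentially. K (g (real j)) \<le> n (C' * g (real j))" .
  then show ?thesis using g_seq eventually_ge_at_top[of "1::nat"]
  proof eventually_elim
    case (elim j)
    then have "j \<le> n (C' * g (real j))" by simp
    then show ?case using n_iff[of "C' * g (real j)" j] C elim by auto
  qed
qed

text \<open>Over \<open>[q * t, t]\<close> the slope of \<open>W\<close> is at most
  \<open>n (q * t)\<close>. Telescoping these increments gives a constant that tends to
  \<open>C / (1 - D)\<close> as \<open>q\<close> tends to 1, so a suitable \<open>q < 1\<close>
  brings it below \<open>C'\<close>.\<close>

lemma W_le_of_n_le:
  assumes n: "\<forall>\<^sub>F t in at_right 0. n t \<le> C * K t" and C: "0 < C" "C / (1 - D) < C'"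
  shows "\<forall>\<^sub>F t in at_right 0. W t \<le> C' * h t"
proof -
  define p where "p = 1 - D"
  have p: "0 < p" using D by (simp add: p_def)
  \<comment> \<open>The function is the constant that telescoping with ratio \<open>q\<close> would
    yield if \<open>h (q * t)\<close> were exactly \<open>q powr p * h t\<close>.\<close>
  have "((\<lambda>q. C / q * q powr p / ((1 - q powr p) / (1 - q))) \<longlongrightarrow> C / 1 * 1 powr p / p) (at 1)"
    using p by (intro tendsto_intros powr_slope) auto
  then have "((\<lambda>q. C / q * q powr p / ((1 - q powr p) / (1 - q))) \<longlongrightarrow> C / p) (at_left 1)"
    by (simp add: filterlim_at_split)
  from order_tendstoD(2)[OF this, of C'] C have
    "\<forall>\<^sub>F q in at_left 1. C / q * q powr p / ((1 - q powr p) / (1 - q)) < C'" by (simp add: p_def)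
  moreover have "\<forall>\<^sub>F q in at_left (1::real). 0 < q \<and> q < 1"
    using eventually_at_left_real[of 0 "1::real"] by simp
  ultimately obtain q where q: "0 < q" "q < 1" and
    qC: "C / q * q powr p / ((1 - q powr p) / (1 - q)) < C'"
    using eventually_happens[OF eventually_conj] by (metis (no_types, lifting) trivial_limit_at_left_real)
  \<comment> \<open>Chosen so that
    \<open>C * K (q * t) * (t - q * t) = b * h (q * t)\<close>.\<close>
  define b where "b = C * (1 - q) / q"
  have qp: "0 < q powr p" "q powr p < 1" using q p powr_less_mono2[of p q 1] by auto
  have b: "0 < b" using q C by (simp add: b_def)
  have "b / (1 - q powr p) * q powr p = C / q * q powr p / ((1 - q powr p) / (1 - q))"
    using q qp by (simp add: b_def field_simps)
  also note qC
  finally have "b / (1 - q powr p) * q powr p < C'" .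
  \<comment> \<open>Regular variation guarantees \<open>h (q * t) \<le> \<rho> * h t\<close> near 0
    only for \<open>\<rho>\<close> above the limit ratio; continuity in \<open>\<rho>\<close> leaves
    room for one.\<close>
  moreover have "((\<lambda>\<rho>. b / (1 - \<rho>) * \<rho>) \<longlongrightarrow> b / (1 - q powr p) * q powr p) (at_right (q powr p))"
    using qp by (intro tendsto_intros) auto
  ultimately have "\<forall>\<^sub>F \<rho> in at_right (q powr p). b / (1 - \<rho>) * \<rho> < C'" using order_tendstoD(2) by blast
  moreover have "\<forall>\<^sub>F \<rho> in at_right (q powr p). q powr p < \<rho> \<and> \<rho> < 1"
    using eventually_at_right_real[OF qp(2)] by simp
  ultimately obtain \<rho> where \<rho>: "q powr p < \<rho>" "\<rho> < 1" "b / (1 - \<rho>) * \<rho> < C'"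
    using eventually_happens[OF eventually_conj] by (metis (no_types, lifting) trivial_limit_at_right_real)
  have 1: "\<forall>\<^sub>F t in at_right 0. n (q * t) \<le> C * K (q * t)"
    using eventually_scale[OF n] q by auto
  have 2: "\<forall>\<^sub>F t in at_right 0. h (q * t) \<le> \<rho> * h t"
    using q \<rho> by (intro h_scale_le) (auto simp: p_def)
  have "\<forall>\<^sub>F t in at_right 0. 0 < h t \<and> W t - W (q * t) \<le> (b * \<rho>) * h t \<and> h (q * t) \<le> \<rho> * h t"
    using 1 2 ev_h_pos eventually_at_right_less[of "0::real"]
  proof eventually_elim
    case (elim t)
    have "W t - W (q * t) \<le> n (q * t) * (t - q * t)"
      using elim q by (intro W_diff_le) auto
    also have "\<dots> \<le> (C * K (q * t)) * (t - q * t)"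
      using elim q by (intro mult_right_mono) auto
    also have "\<dots> = b * h (q * t)" using elim q unfolding b_def K_def by (simp add: field_simps)
    also have "\<dots> \<le> b * (\<rho> * h t)" using elim b by (intro mult_left_mono) auto
    finally show ?case using elim by simp
  qed
  then obtain t0 where t0: "0 < t0" and
    ev: "\<And>t. 0 < t \<Longrightarrow> t < t0 \<Longrightarrow> 0 < h t \<and> W t - W (q * t) \<le> (b * \<rho>) * h t \<and> h (q * t) \<le> \<rho> * h t"
    unfolding eventually_at_right_field by auto
  have "0 \<le> \<rho>" using qp \<rho> by linarith
  have "W t \<le> C' * h t" if t: "0 < t" "t < t0" for t
  proof -
    have "W t \<le> (b * \<rho>) / (1 - \<rho>) * h t"
      by (rule telescope_upper[OF q \<open>0 \<le> \<rho>\<close> \<rho>(2) _ W_tendsto_0, of _ t0])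
        (use ev t b \<open>0 \<le> \<rho>\<close> in \<open>auto intro: less_imp_le\<close>)
    also have "\<dots> \<le> C' * h t" using \<rho> ev[OF t] by (intro mult_right_mono) auto
    finally show ?thesis .
  qed
  then show ?thesis unfolding eventually_at_right_field using t0 by auto
qed

text \<open>Mirror image of \<open>W_le_of_n_le\<close>: the slope over \<open>[q * t, t]\<close> is
  at least \<open>n t\<close>, so the increment is bounded through \<open>h t\<close> itself,
  \<open>b\<close> carries no \<open>1 / q\<close>, and \<open>\<rho>\<close> approaches
  \<open>q powr p\<close> from below.\<close>

lemma W_ge_of_n_ge:
  assumes n: "\<forall>\<^sub>F t in at_right 0. C * K t \<le> n t" and C: "0 < C" "C' < C / (1 - D)"
  shows "\<forall>\<^sub>F t in at_right 0. C' * h t \<le> W t"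
proof -
  define p where "p = 1 - D"
  have p: "0 < p" using D by (simp add: p_def)
  have "((\<lambda>q. C / ((1 - q powr p) / (1 - q))) \<longlongrightarrow> C / p) (at 1)"
    using p by (intro tendsto_intros powr_slope) auto
  then have "((\<lambda>q. C / ((1 - q powr p) / (1 - q))) \<longlongrightarrow> C / p) (at_left 1)"
    by (simp add: filterlim_at_split)
  from order_tendstoD(1)[OF this, of C'] C have
    "\<forall>\<^sub>F q in at_left 1. C' < C / ((1 - q powr p) / (1 - q))" by (simp add: p_def)
  moreover have "\<forall>\<^sub>F q in at_left (1::real). 0 < q \<and> q < 1"
    using eventually_at_left_real[of 0 "1::real"] by simp
  ultimately obtain q where q: "0 < q" "q < 1" and
    qC: "C' < C / ((1 - q powr p) / (1 - q))"
    using eventually_happens[OF eventually_conj] by (metis (no_types, lifting) trivial_limit_at_left_real)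
  define b where "b = C * (1 - q)"
  have qp: "0 < q powr p" "q powr p < 1" using q p powr_less_mono2[of p q 1] by auto
  have b: "0 < b" using q C by (simp add: b_def)
  note qC
  also have "C / ((1 - q powr p) / (1 - q)) = b / (1 - q powr p)"
    using q qp by (simp add: b_def field_simps)
  finally have "C' < b / (1 - q powr p)" .
  moreover have "((\<lambda>\<rho>. b / (1 - \<rho>)) \<longlongrightarrow> b / (1 - q powr p)) (at_left (q powr p))"
    using qp by (intro tendsto_intros) auto
  ultimately have "\<forall>\<^sub>F \<rho> in at_left (q powr p). C' < b / (1 - \<rho>)" using order_tendstoD(1) by blast
  moreover have "\<forall>\<^sub>F \<rho> in at_left (q powr p). 0 < \<rho> \<and> \<rho> < q powr p"
    using eventually_at_left_real[OF qp(1)] by simp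
  ultimately obtain \<rho> where \<rho>: "0 < \<rho>" "\<rho> < q powr p" "C' < b / (1 - \<rho>)"
    using eventually_happens[OF eventually_conj] by (metis (no_types, lifting) trivial_limit_at_left_real)
  have 2: "\<forall>\<^sub>F t in at_right 0. \<rho> * h t \<le> h (q * t)"
    using q \<rho> by (intro h_scale_ge) (auto simp: p_def)
  have "\<forall>\<^sub>F t in at_right 0. 0 < h t \<and> b * h t \<le> W t - W (q * t) \<and> \<rho> * h t \<le> h (q * t)"
    using n 2 ev_h_pos eventually_at_right_less[of "0::real"]
  proof eventually_elim
    case (elim t)
    have "b * h t = (C * K t) * (t - q * t)" using elim q unfolding b_def K_def by (simp add: field_simps)
    also have "\<dots> \<le> n t * (t - q * t)"
      using elim q by (intro mult_right_mono) auto
    also have "\<dots> \<le> W t - W (q * t)"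
      using elim q by (intro W_diff_ge) auto
    finally show ?case using elim by simp
  qed
  then obtain t0 where t0: "0 < t0" and
    ev: "\<And>t. 0 < t \<Longrightarrow> t < t0 \<Longrightarrow> 0 < h t \<and> b * h t \<le> W t - W (q * t) \<and> \<rho> * h t \<le> h (q * t)"
    unfolding eventually_at_right_field by auto
  have "C' * h t \<le> W t" if t: "0 < t" "t < t0" for t
  proof -
    have "C' * h t \<le> b / (1 - \<rho>) * h t" using \<rho> ev[OF t] by (intro mult_right_mono) auto
    also have "\<dots> \<le> W t"
      by (rule telescope_lower[of q _ _ _ t0]) (use ev t b q \<rho> qp W_nonneg in auto)
    finally show ?thesis .
  qed
  then show ?thesis unfolding eventually_at_right_field using t0 by auto
qed

end

text \<open>Splits a limit into one-sided bounds, so that the transfer lemmas serve for limits and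
  for two-sided bounds alike. Lower constants are restricted to positive ones, as those lemmas
  require.\<close>

lemma tendsto_pos_iff_eventually:
  fixes u :: "'a \<Rightarrow> real"
  assumes "0 < L"
  shows "(u \<longlongrightarrow> L) A \<longleftrightarrow>
    (\<forall>C>L. \<forall>\<^sub>F x in A. u x \<le> C) \<and> (\<forall>C. 0 < C \<longrightarrow> C < L \<longrightarrow> (\<forall>\<^sub>F x in A. C \<le> u x))"
proof safe
  assume u: "(u \<longlongrightarrow> L) A"
  show "\<forall>\<^sub>F x in A. u x \<le> C" if "L < C" for C
    using order_tendstoD(2)[OF u that] by eventually_elim auto
  show "\<forall>\<^sub>F x in A. C \<le> u x" if "C < L" for C
    using order_tendstoD(1)[OF u that] by eventually_elim auto
next
  assume up: "\<forall>C>L. \<forall>\<^sub>F x in A. u x \<le> C"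
    and lo: "\<forall>C. 0 < C \<longrightarrow> C < L \<longrightarrow> (\<forall>\<^sub>F x in A. C \<le> u x)"
  show "(u \<longlongrightarrow> L) A"
  proof (rule order_tendstoI)
    fix a assume "L < a"
    then obtain C where "L < C" "C < a" using dense by blast
    with up have "\<forall>\<^sub>F x in A. u x \<le> C" by blast
    then show "\<forall>\<^sub>F x in A. u x < a" by eventually_elim (use \<open>C < a\<close> in auto)
  next
    fix a assume "a < L"
    then have "max a 0 < L" using assms by simp
    then obtain C where C: "max a 0 < C" "C < L" using dense by blast
    with lo have "\<forall>\<^sub>F x in A. C \<le> u x" by auto
    then show "\<forall>\<^sub>F x in A. a < u x" by eventually_elim (use C in auto)
  qed
qed

lemma dense_powr:
  fixes a b p :: real
  assumes "0 < p" "0 \<le> a" "a < b"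
  obtains x where "0 < x" "a < x powr p" "x powr p < b"
proof -
  obtain y where y: "a < y" "y < b" using dense assms by blast
  then have "(y powr (1 / p)) powr p = y" using assms by (simp add: powr_powr)
  with y assms show ?thesis by (intro that[of "y powr (1 / p)"]) auto
qed

section \<open>Limits and two-sided bounds carried between the lengths, \<open>n\<close>,
  \<open>W\<close> and \<open>G\<close>\<close>

context gauged_string
begin

lemma ratio_le_iff:
  "(\<forall>\<^sub>F t in at_right 0. u t / K t \<le> C) \<longleftrightarrow> (\<forall>\<^sub>F t in at_right 0. u t \<le> C * K t)"
  "(\<forall>\<^sub>F t in at_right 0. C \<le> u t / K t) \<longleftrightarrow> (\<forall>\<^sub>F t in at_right 0. C * K t \<le> u t)"
  "(\<forall>\<^sub>F t in at_right 0. u t / h t \<le> C) \<longleftrightarrow> (\<forall>\<^sub>F t in at_right 0. u t \<le> C * h t)"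
  "(\<forall>\<^sub>F t in at_right 0. C \<le> u t / h t) \<longleftrightarrow> (\<forall>\<^sub>F t in at_right 0. C * h t \<le> u t)"
  by (rule eventually_cong[OF ev_K_pos] eventually_cong[OF ev_h_pos]; simp add: field_simps)+

lemma ratio_l_iff:
  "(\<forall>\<^sub>F j in sequentially. l j / g (real j) \<le> C) \<longleftrightarrow> (\<forall>\<^sub>F j in sequentially. l j \<le> C * g (real j))"
  "(\<forall>\<^sub>F j in sequentially. C \<le> l j / g (real j)) \<longleftrightarrow> (\<forall>\<^sub>F j in sequentially. C * g (real j) \<le> l j)"
  by (rule eventually_cong[OF g_seq]; simp add: field_simps)+

text \<open>A constant \<open>C\<close> for the lengths corresponds to \<open>C powr D\<close> for
  the count. Each transfer loses an arbitrarily small factor, which is recovered by interpolating a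
  further constant.\<close>

lemma tendsto_l_iff_n:
  assumes L: "0 < L"
  shows "(\<lambda>j. l j / g (real j)) \<longlonglongrightarrow> L \<longleftrightarrow> ((\<lambda>t. n t / K t) \<longlongrightarrow> L powr D) (at_right 0)"
proof -
  have up1: "\<forall>\<^sub>F t in at_right 0. n t \<le> C * K t"
    if l: "\<And>C. L < C \<Longrightarrow> \<forall>\<^sub>F j in sequentially. l j \<le> C * g (real j)" and C: "L powr D < C" for C
  proof -
    obtain x where x: "0 < x" "L powr D < x powr D" "x powr D < C"
      using dense_powr[OF D(1) _ C] by auto
    then have "L < x" using powr_mono2[of D x L] D L by (auto simp: not_le[symmetric])
    with n_le_of_l_le[OF l] x show ?thesis by auto
  qed
  have lo1: "\<forall>\<^sub>F t in at_right 0. C * K t \<le> n t"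
    if l: "\<And>C. 0 < C \<Longrightarrow> C < L \<Longrightarrow> \<forall>\<^sub>F j in sequentially. C * g (real j) \<le> l j"
      and C: "0 < C" "C < L powr D" for C
  proof -
    obtain x where x: "0 < x" "C < x powr D" "x powr D < L powr D"
      using dense_powr[OF D(1) _ C(2)] C(1) by auto
    then have "x < L" using powr_mono2[of D L x] D L by (auto simp: not_le[symmetric])
    with n_ge_of_l_ge[OF l] x show ?thesis by auto
  qed
  have up2: "\<forall>\<^sub>F j in sequentially. l j \<le> C * g (real j)"
    if n: "\<And>C. L powr D < C \<Longrightarrow> \<forall>\<^sub>F t in at_right 0. n t \<le> C * K t" and C: "L < C" for C
  proof -
    have "L powr D < C powr D" using C L D by (intro powr_less_mono2) auto
    then obtain y where "L powr D < y" "y < C powr D" using dense by blast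
    with l_le_of_n_le[OF n] C L show ?thesis by auto
  qed
  have lo2: "\<forall>\<^sub>F j in sequentially. C * g (real j) \<le> l j"
    if n: "\<And>C. 0 < C \<Longrightarrow> C < L powr D \<Longrightarrow> \<forall>\<^sub>F t in at_right 0. C * K t \<le> n t" and C: "0 < C" "C < L" for C
  proof -
    have "C powr D < L powr D" using C L D by (intro powr_less_mono2) auto
    then obtain y where y: "C powr D < y" "y < L powr D" using dense by blast
    then have "0 < y" using powr_ge_zero[of C D] by linarith
    with l_ge_of_n_ge[OF n] C L y show ?thesis by auto
  qed
  have LD: "0 < L powr D" using L by simp
  show ?thesis
    unfolding tendsto_pos_iff_eventually[OF L] tendsto_pos_iff_eventually[OF LD] ratio_le_iff ratio_l_iff
    using up1 lo1 up2 lo2 by blast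
qed

lemma tendsto_W_of_n:
  assumes \<kappa>: "0 < \<kappa>" and n: "((\<lambda>t. n t / K t) \<longlongrightarrow> \<kappa>) (at_right 0)"
  shows "((\<lambda>t. W t / h t) \<longlongrightarrow> \<kappa> / (1 - D)) (at_right 0)"
proof -
  have 0: "0 < \<kappa> / (1 - D)" using \<kappa> D by simp
  note n' = n[unfolded tendsto_pos_iff_eventually[OF \<kappa>] ratio_le_iff]
  show ?thesis unfolding tendsto_pos_iff_eventually[OF 0] ratio_le_iff
  proof safe
    fix C assume C: "\<kappa> / (1 - D) < C"
    then have "\<kappa> < C * (1 - D)" using D by (simp add: field_simps)
    then obtain y where y: "\<kappa> < y" "y < C * (1 - D)" using dense by blast
    then show "\<forall>\<^sub>F x in at_right 0. W x \<le> C * h x"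
      using n' \<kappa> D by (intro W_le_of_n_le[of y]) (auto simp: field_simps)
  next
    fix C assume C: "0 < C" "C < \<kappa> / (1 - D)"
    then have "C * (1 - D) < \<kappa>" using D by (simp add: field_simps)
    then obtain y where y: "C * (1 - D) < y" "y < \<kappa>" using dense by blast
    moreover have "0 < C * (1 - D)" using C D by simp
    ultimately have "0 < y" by linarith
    then show "\<forall>\<^sub>F x in at_right 0. C * h x \<le> W x"
      using n' \<kappa> D y by (intro W_ge_of_n_ge[of y]) (auto simp: field_simps)
  qed
qed

lemma h_ratio_W:
  assumes W: "((\<lambda>t. W t / h t) \<longlongrightarrow> M) (at_right 0)" and A: "0 < A"
  shows "((\<lambda>t. W (A * t) / h t) \<longlongrightarrow> M * A powr (1 - D)) (at_right 0)"
proof -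
  have "((\<lambda>t. W (A * t) / h (A * t) * (h (A * t) / h t)) \<longlongrightarrow> M * A powr (1 - D)) (at_right 0)"
    using filterlim_compose[OF W filterlim_times_at_right_0[OF A]] h_ratio[OF A] by (rule tendsto_mult)
  moreover have "\<forall>\<^sub>F t in at_right 0. W (A * t) / h (A * t) * (h (A * t) / h t) = W (A * t) / h t"
    using eventually_scale[OF ev_h_pos A] by eventually_elim auto
  ultimately show ?thesis by (rule Lim_transform_eventually)
qed

text \<open>A monotone density argument: \<open>n t\<close> lies below the secant slope of
  \<open>W\<close> over \<open>[q * t, t]\<close> for \<open>q < 1\<close> and above the one over
  \<open>[t, q * t]\<close> for \<open>q > 1\<close>. Relative to \<open>K t\<close> both slopes
  tend to \<open>M * ((1 - q powr p) / (1 - q))\<close>, and \<open>q\<close> tends to 1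
  last.\<close>

lemma tendsto_n_of_W:
  assumes M: "0 < M" and W: "((\<lambda>t. W t / h t) \<longlongrightarrow> M) (at_right 0)"
  shows "((\<lambda>t. n t / K t) \<longlongrightarrow> M * (1 - D)) (at_right 0)"
proof -
  define p where "p = 1 - D"
  have p: "0 < p" using D by (simp add: p_def)
  have slope: "((\<lambda>q. M * ((1 - q powr p) / (1 - q))) \<longlongrightarrow> M * p) (at 1)"
    by (intro tendsto_intros powr_slope)
  \<comment> \<open>One formula serves both sides of \<open>t\<close>: for \<open>A > 1\<close> the
    numerator and \<open>1 - A\<close> are both nonpositive.\<close>
  have quot: "((\<lambda>t. (W t - W (A * t)) / (1 - A) / h t) \<longlongrightarrow> M * ((1 - A powr p) / (1 - A))) (at_right 0)"
    if "0 < A" "A \<noteq> 1" for A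
  proof -
    have "((\<lambda>t. (W t / h t - W (A * t) / h t) / (1 - A)) \<longlongrightarrow> (M - M * A powr p) / (1 - A)) (at_right 0)"
      unfolding p_def using that by (intro tendsto_intros W h_ratio_W) auto
    moreover have "(M - M * A powr p) / (1 - A) = M * ((1 - A powr p) / (1 - A))"
      by (simp add: right_diff_distrib)
    moreover have "(W t / h t - W (A * t) / h t) / (1 - A) = (W t - W (A * t)) / (1 - A) / h t" for t
      by (simp add: diff_divide_distrib mult.commute)
    ultimately show ?thesis by simp
  qed
  show ?thesis
  proof (rule order_tendstoI)
    fix a assume "M * (1 - D) < a"
    then have "\<forall>\<^sub>F q in at_left 1. M * ((1 - q powr p) / (1 - q)) < a"
      using order_tendstoD(2)[OF slope, of a] by (simp add: p_def eventually_at_split)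
    moreover have "\<forall>\<^sub>F q in at_left (1::real). 0 < q \<and> q < 1"
      using eventually_at_left_real[of 0 "1::real"] by simp
    ultimately obtain q where q: "0 < q" "q < 1" and qa: "M * ((1 - q powr p) / (1 - q)) < a"
      using eventually_happens[OF eventually_conj] by (metis (no_types, lifting) trivial_limit_at_left_real)
    have "\<forall>\<^sub>F t in at_right 0. (W t - W (q * t)) / (1 - q) / h t < a"
      using order_tendstoD(2)[OF quot qa] q by auto
    then show "\<forall>\<^sub>F t in at_right 0. n t / K t < a"
      using ev_h_pos eventually_at_right_less[of "0::real"]
    proof eventually_elim
      case (elim t)
      have "n t * (t - q * t) \<le> W t - W (q * t)" using elim q by (intro W_diff_ge) auto
      then have "n t * t / h t \<le> (W t - W (q * t)) / (1 - q) / h t"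
        using elim q by (intro divide_right_mono) (auto simp: field_simps)
      then show ?case using elim by (simp add: K_def)
    qed
  next
    fix a assume "a < M * (1 - D)"
    then have "\<forall>\<^sub>F q in at_right 1. a < M * ((1 - q powr p) / (1 - q))"
      using order_tendstoD(1)[OF slope, of a] by (simp add: p_def eventually_at_split)
    moreover have "\<forall>\<^sub>F q in at_right (1::real). 1 < q \<and> q < 2"
      using eventually_at_right_real[of "1::real" 2] by simp
    ultimately obtain q where q: "1 < q" and qa: "a < M * ((1 - q powr p) / (1 - q))"
      using eventually_happens[OF eventually_conj] by (metis (no_types, lifting) trivial_limit_at_right_real)
    have "\<forall>\<^sub>F t in at_right 0. a < (W t - W (q * t)) / (1 - q) / h t"
      using order_tendstoD(1)[OF quot qa] q by auto
    then show "\<forall>\<^sub>F t in at_right 0. a < n t / K t"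
      using ev_h_pos eventually_at_right_less[of "0::real"]
    proof eventually_elim
      case (elim t)
      have "W (q * t) - W t \<le> n t * (q * t - t)" using elim q by (intro W_diff_le) auto
      then have "(W t - W (q * t)) / (1 - q) / h t \<le> n t * t / h t"
        using elim q by (intro divide_right_mono) (auto simp: field_simps)
      then show ?case using elim by (simp add: K_def)
    qed
  qed
qed

text \<open>For \<open>q < 1\<close> the weak count satisfies
  \<open>n t \<le> m t \<le> n (q * t)\<close>, and the factor \<open>q powr (- D)\<close> tends to
  1 with \<open>q\<close>.\<close>

lemma tendsto_m_of_n:
  assumes n: "((\<lambda>t. n t / K t) \<longlongrightarrow> \<kappa>) (at_right 0)"
  shows "((\<lambda>t. m t / K t) \<longlongrightarrow> \<kappa>) (at_right 0)"
proof (rule order_tendstoI)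
  fix a assume "a < \<kappa>"
  from order_tendstoD(1)[OF n this] show "\<forall>\<^sub>F t in at_right 0. a < m t / K t"
    using ev_K_pos eventually_at_right_less[of "0::real"]
  proof eventually_elim
    case (elim t)
    then have "n t / K t \<le> m t / K t" using n_le_m[of t] by (intro divide_right_mono) auto
    then show ?case using elim by simp
  qed
next
  fix a assume a: "\<kappa> < a"
  have "((\<lambda>q. \<kappa> * q powr (- D)) \<longlongrightarrow> \<kappa> * 1 powr (- D)) (at_left 1)"
    by (intro tendsto_intros) auto
  from order_tendstoD(2)[OF this, of a] a have "\<forall>\<^sub>F q in at_left 1. \<kappa> * q powr (- D) < a" by simp
  moreover have "\<forall>\<^sub>F q in at_left (1::real). 0 < q \<and> q < 1"
    using eventually_at_left_real[of 0 "1::real"] by simp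
  ultimately obtain q where q: "0 < q" "q < 1" and qa: "\<kappa> * q powr (- D) < a"
    using eventually_happens[OF eventually_conj] by (metis (no_types, lifting) trivial_limit_at_left_real)
  have "((\<lambda>t. n (q * t) / K (q * t) * (K (q * t) / K t)) \<longlongrightarrow> \<kappa> * q powr (- D)) (at_right 0)"
    using filterlim_compose[OF n filterlim_times_at_right_0[OF q(1)]] K_ratio[OF q(1)] by (rule tendsto_mult)
  from order_tendstoD(2)[OF this qa]
  show "\<forall>\<^sub>F t in at_right 0. m t / K t < a"
    using ev_K_pos eventually_scale[OF ev_K_pos q(1)] eventually_at_right_less[of "0::real"]
  proof eventually_elim
    case (elim t)
    then have "m t / K t \<le> n (q * t) / K t" using m_le_n[of "q * t" t] q by (intro divide_right_mono) auto
    then show ?case using elim by simp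
  qed
qed

lemma asymp_bounds_n_iff_l:
  "asymp_bounds sequentially l (\<lambda>j. g (real j)) \<longleftrightarrow> asymp_bounds (at_right 0) K n"
  unfolding asymp_bounds_commute[of sequentially l]
proof
  assume "asymp_bounds sequentially (\<lambda>j. g (real j)) l"
  then obtain c C where c: "0 < c" "0 < C" and
    ev: "\<forall>\<^sub>F j in sequentially. c * g (real j) \<le> l j" "\<forall>\<^sub>F j in sequentially. l j \<le> C * g (real j)"
    unfolding asymp_bounds_def eventually_conj_iff by blast
  \<comment> \<open>The transfer lemmas demand strict slack; a factor 2 is enough where constants
    need not be sharp.\<close>
  have "c powr D / 2 < c powr D" "C powr D < 2 * C powr D" using c by auto
  from n_ge_of_l_ge[OF ev(1) c(1) this(1)] n_le_of_l_le[OF ev(2) c(2) this(2)]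
  show "asymp_bounds (at_right 0) K n" unfolding asymp_bounds_def eventually_conj_iff
    using c by (intro exI[of _ "c powr D / 2"] exI[of _ "2 * C powr D"]) auto
next
  assume "asymp_bounds (at_right 0) K n"
  then obtain c C where c: "0 < c" "0 < C" and
    ev: "\<forall>\<^sub>F t in at_right 0. c * K t \<le> n t" "\<forall>\<^sub>F t in at_right 0. n t \<le> C * K t"
    unfolding asymp_bounds_def eventually_conj_iff by blast
  obtain x where x: "0 < x" "x powr D < c" using dense_powr[OF D(1) _ c(1)] by auto
  obtain y where y: "0 < y" "C < y powr D" using dense_powr[OF D(1), of C "C + 1"] c by auto
  from l_ge_of_n_ge[OF ev(1) x] l_le_of_n_le[OF ev(2) y]
  show "asymp_bounds sequentially (\<lambda>j. g (real j)) l" unfolding asymp_bounds_def eventually_conj_iff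
    using x y by blast
qed

text \<open>For the lower bound on \<open>n\<close> from bounds on \<open>W\<close>: since
  \<open>A powr (1 - D)\<close> is unbounded, a large fixed \<open>A\<close> makes the lower bound
  for \<open>W (A * t)\<close> twice the upper bound for \<open>W t\<close>. The excess can only
  come from lengths above \<open>t\<close>, each contributing at most
  \<open>(A - 1) * t\<close>.\<close>

lemma asymp_bounds_W_iff_n: "asymp_bounds (at_right 0) h W \<longleftrightarrow> asymp_bounds (at_right 0) K n"
proof
  assume "asymp_bounds (at_right 0) K n"
  then obtain c C where c: "0 < c" "0 < C" and
    ev: "\<forall>\<^sub>F t in at_right 0. c * K t \<le> n t" "\<forall>\<^sub>F t in at_right 0. n t \<le> C * K t"
    unfolding asymp_bounds_def eventually_conj_iff by blast
  have "c / 2 / (1 - D) < c / (1 - D)" "C / (1 - D) < 2 * C / (1 - D)"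
    by (rule divide_strict_right_mono; use c D in simp)+
  from W_ge_of_n_ge[OF ev(1) c(1) this(1)] W_le_of_n_le[OF ev(2) c(2) this(2)]
  show "asymp_bounds (at_right 0) h W" unfolding asymp_bounds_def eventually_conj_iff
    using c D by (intro exI[of _ "c / 2 / (1 - D)"] exI[of _ "2 * C / (1 - D)"]) auto
next
  assume "asymp_bounds (at_right 0) h W"
  then obtain c C where c: "0 < c" "0 < C" and
    ev: "\<forall>\<^sub>F t in at_right 0. c * h t \<le> W t" "\<forall>\<^sub>F t in at_right 0. W t \<le> C * h t"
    unfolding asymp_bounds_def eventually_conj_iff by blast
  have "0 < 1 - D" using D by simp
  then obtain A0 where A0: "0 < A0" "2 * C / c < A0 powr (1 - D)"
    using dense_powr[of "1 - D" "2 * C / c" "2 * C / c + 1"] c by auto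
  \<comment> \<open>The shift ensures \<open>A > 1\<close>, so that dividing by \<open>A - 1\<close>
    is legitimate.\<close>
  define A where "A = A0 + 1"
  have "A0 powr (1 - D) \<le> A powr (1 - D)" using A0 D by (intro powr_mono2) (auto simp: A_def)
  then have A: "1 < A" "2 * C / c < A powr (1 - D)" using A0 by (auto simp: A_def)
  have hA: "\<forall>\<^sub>F t in at_right 0. 2 * C / c * h t \<le> h (A * t)"
    using A by (intro h_scale_ge) auto
  have cA: "\<forall>\<^sub>F t in at_right 0. c * h (A * t) \<le> W (A * t)"
    using eventually_scale[OF ev(1)] A by auto
  have "\<forall>\<^sub>F t in at_right 0. C / (A - 1) * K t \<le> n t"
    using hA cA ev(2) eventually_at_right_less[of "0::real"]
  proof eventually_elim
    case (elim t)
    have "2 * C * h t \<le> c * h (A * t)" using elim c by (simp add: field_simps)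
    then have "C * h t \<le> W (A * t) - W t" using elim by linarith
    also have "\<dots> \<le> n t * (A * t - t)" using elim A by (intro W_diff_le) auto
    finally show ?case using elim A by (simp add: K_def field_simps)
  qed
  moreover have "\<forall>\<^sub>F t in at_right 0. n t \<le> C * K t"
    using ev(2) eventually_at_right_less[of "0::real"]
  proof eventually_elim
    case (elim t)
    have "n t * t \<le> C * h t" using n_le_W[of t] elim by linarith
    then show ?case using elim by (simp add: K_def field_simps)
  qed
  ultimately show "asymp_bounds (at_right 0) K n" unfolding asymp_bounds_def eventually_conj_iff
    using c A by (intro exI[of _ "C / (A - 1)"] exI[of _ C]) auto
qed

text \<open>The bounds that \<open>G_le_W\<close> does not give come from \<open>G_ge_count\<close>.
  For \<open>G\<close> from below, a small \<open>b\<close> makes the count at \<open>b * t\<close>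
  dominate the one at \<open>t\<close>. For \<open>W\<close> from above, \<open>b = 1/2\<close>
  bounds the dyadic increments of \<open>m\<close>, and the geometric growth of \<open>K\<close>
  towards 0 lets their sum be of order \<open>K t\<close>.\<close>

lemma asymp_bounds_G_iff_W:
  "asymp_bounds (at_right 0) K (\<lambda>t. G (1 / t)) \<longleftrightarrow> asymp_bounds (at_right 0) h W"
proof
  assume W: "asymp_bounds (at_right 0) h W"
  then obtain C0 where C0: "0 < C0" "\<forall>\<^sub>F t in at_right 0. W t \<le> C0 * h t"
    unfolding asymp_bounds_def eventually_conj_iff by blast
  have up: "\<forall>\<^sub>F t in at_right 0. G (1 / t) \<le> C0 * K t"
    using C0(2) eventually_at_right_less[of "0::real"]
  proof eventually_elim
    case (elim t)
    have "t * G (1 / t) \<le> C0 * h t" using G_le_W[of t] elim by linarith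
    then show ?case using elim by (simp add: K_def field_simps)
  qed
  from W obtain c C where c: "0 < c" "0 < C" and
    ev: "\<forall>\<^sub>F t in at_right 0. c * K t \<le> n t" "\<forall>\<^sub>F t in at_right 0. n t \<le> C * K t"
    unfolding asymp_bounds_W_iff_n unfolding asymp_bounds_def eventually_conj_iff by blast
  \<comment> \<open>Arises from \<open>m t \<le> n (t / 2) \<le> C * K (t / 2)\<close>; the added 1
    is slack above the limit of \<open>K (t / 2) / K t\<close>.\<close>
  define C' where "C' = C * (1 + (1/2) powr (- D))"
  have C': "0 < C'" using c by (simp add: C'_def add_pos_pos)
  have half: "\<forall>\<^sub>F t in at_right 0. n (1/2 * t) \<le> C * K (1/2 * t)"
    by (rule eventually_scale[OF ev(2)]) auto
  have halfK: "\<forall>\<^sub>F t in at_right 0. K (1/2 * t) \<le> (1 + (1/2) powr (- D)) * K t"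
    by (intro K_scale_le) auto
  obtain B where B: "0 < B" "2 * C' / c < B powr D"
    using dense_powr[OF D(1), of "2 * C' / c" "2 * C' / c + 1"] c C' by auto
  \<comment> \<open>Now \<open>b powr (- D) = (B + 1) powr D\<close> exceeds
    \<open>2 * C' / c\<close>, so the count at \<open>b * t\<close> is at least
    \<open>2 * C' * K t\<close>, twice the bound for \<open>m t\<close>. Adding 1 to
    \<open>B\<close> makes \<open>b < 1\<close>.\<close>
  define b where "b = 1 / (B + 1)"
  have b: "0 < b" "b < 1" using B by (auto simp: b_def)
  have "B powr D \<le> (B + 1) powr D" using B D by (intro powr_mono2) auto
  also have "(B + 1) powr D = b powr (- D)" using B by (simp add: b_def powr_divide powr_minus)
  finally have "2 * C' / c < b powr (- D)" using B by linarith
  then have bK: "\<forall>\<^sub>F t in at_right 0. 2 * C' / c * K t \<le> K (b * t)" using b by (intro K_scale_ge) auto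
  have bn: "\<forall>\<^sub>F t in at_right 0. c * K (b * t) \<le> n (b * t)"
    using eventually_scale[OF ev(1)] b by auto
  have "\<forall>\<^sub>F t in at_right 0. b * C' * K t \<le> G (1 / t)"
    using half halfK bK bn eventually_at_right_less[of "0::real"]
  proof eventually_elim
    case (elim t)
    have "real (m t) \<le> n (1/2 * t)" using m_le_n[of "1/2 * t" t] elim by simp
    also have "\<dots> \<le> C * K (1/2 * t)" using elim by simp
    also have "\<dots> \<le> C * ((1 + (1/2) powr (- D)) * K t)" using elim c by (intro mult_left_mono) auto
    finally have m: "m t \<le> C' * K t" by (simp add: C'_def mult.assoc)
    have "2 * C' * K t \<le> c * K (b * t)" using elim c by (simp add: field_simps)
    also have "\<dots> \<le> n (b * t)" using elim by simp
    also have "\<dots> \<le> m (b * t)" using n_le_m[of "b * t"] elim b by simp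
    finally have "C' * K t \<le> m (b * t) - real (m t)" using m by linarith
    then have "b * (C' * K t) \<le> b * (m (b * t) - real (m t))" using b by (intro mult_left_mono) auto
    also have "\<dots> \<le> G (1 / t)" using G_ge_count[of t b] b elim by simp
    finally show ?case by (simp add: mult.assoc)
  qed
  with up show "asymp_bounds (at_right 0) K (\<lambda>t. G (1 / t))"
    unfolding asymp_bounds_def eventually_conj_iff using b C' C0
    by (intro exI[of _ "b * C'"] exI[of _ C0]) auto
next
  assume "asymp_bounds (at_right 0) K (\<lambda>t. G (1 / t))"
  then obtain c C where c: "0 < c" "0 < C" and
    ev: "\<forall>\<^sub>F t in at_right 0. c * K t \<le> G (1 / t)" "\<forall>\<^sub>F t in at_right 0. G (1 / t) \<le> C * K t"
    unfolding asymp_bounds_def eventually_conj_iff by blast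
  have low: "\<forall>\<^sub>F t in at_right 0. c * h t \<le> W t"
    using ev(1) eventually_at_right_less[of "0::real"]
  proof eventually_elim
    case (elim t)
    have "t * (c * K t) \<le> t * G (1 / t)" using elim by (intro mult_left_mono) auto
    also have "\<dots> \<le> W t" using G_le_W[of t] elim by simp
    finally show ?case using elim by (simp add: K_def)
  qed
  \<comment> \<open>Strictly between the limit ratio \<open>2 powr (- D)\<close> and 1, so doubling
    the argument contracts \<open>K\<close>.\<close>
  define \<rho> where "\<rho> = 2 powr (- D / 2)"
  have \<rho>: "0 < \<rho>" "\<rho> < 1" "2 powr (- D) < \<rho>" using D by (auto simp: \<rho>_def powr_less_one)
  have "\<forall>\<^sub>F t in at_right 0. K (2 * t) \<le> \<rho> * K t" using \<rho> by (intro K_scale_le) auto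
  moreover have "\<forall>\<^sub>F t in at_right 0. m t - real (m (2 * t)) \<le> 2 * C * K (2 * t)"
    using eventually_scale[OF ev(2), of 2, simplified] eventually_at_right_less[of "0::real"]
  proof eventually_elim
    case (elim t)
    then show ?case using G_ge_count[of "2 * t" "1/2"] by simp
  qed
  ultimately have "\<forall>\<^sub>F t in at_right 0. 0 < K t \<and> K (2 * t) \<le> \<rho> * K t \<and> m t - real (m (2 * t)) \<le> 2 * C * K (2 * t)"
    using ev_K_pos by eventually_elim auto
  then obtain t0 where t0: "0 < t0" and
    t0': "\<And>t. 0 < t \<Longrightarrow> t < t0 \<Longrightarrow> 0 < K t \<and> K (2 * t) \<le> \<rho> * K t \<and> m t - real (m (2 * t)) \<le> 2 * C * K (2 * t)"
    unfolding eventually_at_right_field by auto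
  \<comment> \<open>The solution of \<open>(B + 2 * C) * \<rho> = B\<close>, which lets the
    induction below reproduce its own bound.\<close>
  define B where "B = 2 * C * \<rho> / (1 - \<rho>)"
  have B: "0 < B" using c \<rho> by (simp add: B_def)
  have "(B + 2 * C) * \<rho> = B" using \<rho> by (simp add: B_def field_simps)
  \<comment> \<open>Induction over the number of doublings needed to bring \<open>t\<close> into
    \<open>[t0 / 2, t0)\<close>. For \<open>k = 0\<close> the hypotheses contradict each
    other.\<close>
  have bound: "t0 / 2 ^ k \<le> t \<Longrightarrow> t < t0 \<Longrightarrow> m t \<le> m (t0 / 2) + B * K t" for k t
  proof (induction k arbitrary: t)
    case 0 then show ?case by simp
  next
    case (Suc k)
    have "0 < t" using Suc.prems(1) t0 by (meson divide_pos_pos less_le_trans zero_less_numeral zero_less_power)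
    show ?case
    proof (cases "t0 / 2 \<le> t")
      case True
      then have "m t \<le> m (t0 / 2)" using t0 by (intro m_mono) auto
      then show ?thesis using t0'[of t] \<open>0 < t\<close> Suc.prems B
        by (smt (verit) mult_nonneg_nonneg of_nat_le_iff)
    next
      case False
      then have "m (2 * t) \<le> m (t0 / 2) + B * K (2 * t)"
        using Suc.prems by (intro Suc.IH) (auto simp: field_simps)
      then have "m t \<le> m (t0 / 2) + (B + 2 * C) * K (2 * t)"
        using t0'[of t] \<open>0 < t\<close> Suc.prems by (simp add: algebra_simps)
      also have "(B + 2 * C) * K (2 * t) \<le> (B + 2 * C) * (\<rho> * K t)"
        using t0'[of t] \<open>0 < t\<close> Suc.prems B c by (intro mult_left_mono) auto
      also have "\<dots> = B * K t" using \<open>(B + 2 * C) * \<rho> = B\<close> by (simp add: mult.assoc[symmetric])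
      finally show ?thesis by simp
    qed
  qed
  have "\<forall>\<^sub>F t in at_right 0. real (m (t0 / 2)) \<le> K t"
    using K_at_top by (simp add: filterlim_at_top)
  moreover have "\<forall>\<^sub>F t in at_right 0. 0 < t \<and> t < t0"
    using eventually_at_right_real[OF t0] by eventually_elim auto
  ultimately have "\<forall>\<^sub>F t in at_right 0. n t \<le> (B + 1) * K t"
  proof eventually_elim
    case (elim t)
    obtain k where "t0 / t < 2 ^ k" using real_arch_pow[of 2 "t0 / t"] by auto
    then have "t0 / 2 ^ k \<le> t" using elim by (simp add: field_simps)
    from bound[OF this] elim n_le_m[of t] show ?case by (simp add: algebra_simps)
  qed
  moreover have "(B + 1) / (1 - D) < (B + 2) / (1 - D)" using D by (intro divide_strict_right_mono) auto
  ultimately have "\<forall>\<^sub>F t in at_right 0. W t \<le> (B + 2) / (1 - D) * h t"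
    using B by (intro W_le_of_n_le[of "B + 1"]) auto
  with low show "asymp_bounds (at_right 0) h W"
    unfolding asymp_bounds_def eventually_conj_iff using c B D
    by (intro exI[of _ c] exI[of _ "(B + 2) / (1 - D)"]) auto
qed

text \<open>For fixed \<open>A\<close> the truncation has a limit as \<open>t\<close> tends to 0,
  because it involves only \<open>W (A * t)\<close> and finitely many counts. The limits are not
  uniform in \<open>A\<close>, so \<open>A\<close> is fixed first and taken large according to the
  tolerance.\<close>

lemma tendsto_G:
  assumes \<kappa>: "0 < \<kappa>" and n: "((\<lambda>t. n t / K t) \<longlongrightarrow> \<kappa>) (at_right 0)"
    and Z: "(\<lambda>A. (\<Sum>k=1..A. real k powr (- D)) - real A powr (1 - D) / (1 - D)) \<longlonglongrightarrow> Z"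
  shows "((\<lambda>t. G (1 / t) / K t) \<longlongrightarrow> - \<kappa> * Z) (at_right 0)"
proof -
  \<comment> \<open>The limit of \<open>\<Phi> A t / K t\<close>: up to the factor
    \<open>- \<kappa>\<close>, a partial sum of the zeta series with its divergent part
    removed.\<close>
  define c where "c A = \<kappa> * (real A powr (1 - D) / (1 - D) - (\<Sum>k=1..A. real k powr (- D)))" for A
  have "(\<lambda>A. \<kappa> * - ((\<Sum>k=1..A. real k powr (- D)) - real A powr (1 - D) / (1 - D))) \<longlonglongrightarrow> \<kappa> * - Z"
    by (intro tendsto_intros Z)
  then have c: "c \<longlonglongrightarrow> - \<kappa> * Z" by (simp add: c_def[abs_def])
  \<comment> \<open>The price of the truncation: the limit of \<open>m (A * t) / K t\<close>,
    negligible for large \<open>A\<close> since \<open>D > 0\<close>.\<close>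
  have tail: "(\<lambda>A. \<kappa> * real A powr (- D)) \<longlonglongrightarrow> 0"
    using D by (intro tendsto_mult_right_zero tendsto_neg_powr filterlim_real_sequentially) auto
  define \<Phi> where "\<Phi> A t = W (A * t) / t - (\<Sum>k=1..A. real (m (k * t)))" for A :: nat and t :: real
  have mk: "((\<lambda>t::real. m (k * t) / K t) \<longlongrightarrow> \<kappa> * k powr (- D)) (at_right 0)" if "1 \<le> k" for k :: nat
  proof -
    have k: "0 < real k" using that by simp
    have "((\<lambda>t::real. m (k * t) / K (k * t) * (K (k * t) / K t)) \<longlongrightarrow> \<kappa> * k powr (- D)) (at_right 0)"
      using filterlim_compose[OF tendsto_m_of_n[OF n] filterlim_times_at_right_0[OF k]] K_ratio[OF k]
      by (rule tendsto_mult)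
    moreover have "\<forall>\<^sub>F t in at_right (0::real). m (k * t) / K (k * t) * (K (k * t) / K t) = m (k * t) / K t"
      using eventually_scale[OF ev_K_pos k] by eventually_elim auto
    ultimately show ?thesis by (rule Lim_transform_eventually)
  qed
  have lim\<Phi>: "((\<lambda>t::real. \<Phi> A t / K t) \<longlongrightarrow> c A) (at_right 0)" if A: "1 \<le> A" for A
  proof -
    have L: "((\<lambda>t::real. W (A * t) / h t - (\<Sum>k=1..A. m (k * t) / K t)) \<longlongrightarrow>
        \<kappa> / (1 - D) * A powr (1 - D) - (\<Sum>k=1..A. \<kappa> * k powr (- D))) (at_right 0)"
      using A by (intro tendsto_intros h_ratio_W tendsto_W_of_n[OF \<kappa> n] mk) auto
    have E: "\<kappa> / (1 - D) * A powr (1 - D) - (\<Sum>k=1..A. \<kappa> * k powr (- D)) = c A"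
      by (simp add: c_def right_diff_distrib sum_distrib_left)
    have ev: "\<forall>\<^sub>F t in at_right (0::real). W (A * t) / h t - (\<Sum>k=1..A. m (k * t) / K t) = \<Phi> A t / K t"
      using eventually_at_right_less[of "0::real"]
      by eventually_elim
        (simp add: \<Phi>_def K_def left_diff_distrib diff_divide_distrib sum_distrib_right sum_divide_distrib)
    show ?thesis by (rule Lim_transform_eventually[OF L[unfolded E] ev])
  qed
  show ?thesis
  proof (rule order_tendstoI)
    fix a assume a: "a < - \<kappa> * Z"
    obtain A where A: "1 \<le> A" "a < c A"
      using eventually_happens[OF eventually_conj[OF eventually_ge_at_top[of 1] order_tendstoD(1)[OF c a]]] by auto
    show "\<forall>\<^sub>F t in at_right 0. a < G (1 / t) / K t"
      using order_tendstoD(1)[OF lim\<Phi>[OF A(1)] A(2)] ev_K_pos eventually_at_right_less[of "0::real"]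
    proof eventually_elim
      case (elim t)
      have "\<Phi> A t \<le> G (1 / t)" using G_truncate[of t A] elim A by (simp add: \<Phi>_def)
      then have "\<Phi> A t / K t \<le> G (1 / t) / K t" using elim by (intro divide_right_mono) auto
      then show ?case using elim by simp
    qed
  next
    fix a assume a: "- \<kappa> * Z < a"
    have "(\<lambda>A. c A + \<kappa> * real A powr (- D)) \<longlonglongrightarrow> - \<kappa> * Z + 0" by (intro tendsto_add c tail)
    from order_tendstoD(2)[OF this, of a] a
    have "\<forall>\<^sub>F A in sequentially. c A + \<kappa> * real A powr (- D) < a" by simp
    from eventually_happens[OF eventually_conj[OF eventually_ge_at_top[of 1] this]]
    obtain A where A: "1 \<le> A" "c A + \<kappa> * real A powr (- D) < a" by auto
    have "((\<lambda>t::real. \<Phi> A t / K t + m (A * t) / K t) \<longlongrightarrow> c A + \<kappa> * A powr (- D)) (at_right 0)"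
      by (intro tendsto_add lim\<Phi> mk A)
    from order_tendstoD(2)[OF this A(2)]
    show "\<forall>\<^sub>F t in at_right 0. G (1 / t) / K t < a"
      using ev_K_pos eventually_at_right_less[of "0::real"]
    proof eventually_elim
      case (elim t)
      have "G (1 / t) \<le> \<Phi> A t + m (A * t)" using G_truncate[of t A] elim A by (simp add: \<Phi>_def)
      then have "G (1 / t) / K t \<le> (\<Phi> A t + m (A * t)) / K t" using elim by (intro divide_right_mono) auto
      then show ?case using elim by (simp add: add_divide_distrib)
    qed
  qed
qed

end

section \<open>The zeta function on the real interval (0, 1)\<close>

text \<open>With \<open>k = Suc n\<close>, this is \<open>k powr (- s)\<close> minus the integral of
  \<open>x powr (- s)\<close> over \<open>[k, k + 1]\<close>.\<close>

definition zeta_term :: "nat \<Rightarrow> complex \<Rightarrow> complex" where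
  "zeta_term n s = of_nat (Suc n) powr (- s)
     - (of_nat (Suc (Suc n)) powr (1 - s) - of_nat (Suc n) powr (1 - s)) / (1 - s)"

text \<open>For \<open>Re s > 1\<close> the pole term is the integral of \<open>x powr (- s)\<close>
  over \<open>[1, \<infinity>)\<close>, which the series has subtracted piece by piece.\<close>

definition zeta_ext :: "complex \<Rightarrow> complex" where
  "zeta_ext s = 1 / (s - 1) + (\<Sum>n. zeta_term n s)"

lemma norm_powr_diff_le:
  assumes "0 < a" and x: "a \<le> x" and s: "0 < Re s"
  shows "norm (complex_of_real a powr (- s) - complex_of_real x powr (- s)) \<le> norm s * a powr (- Re s - 1) * (x - a)"
proof -
  define S where "S = closed_segment (complex_of_real a) (complex_of_real x)"
  have S: "\<exists>t. z = complex_of_real t \<and> a \<le> t" if "z \<in> S" for z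
    using that x unfolding S_def closed_segment_of_real by (auto simp: closed_segment_eq_real_ivl)
  have "norm (complex_of_real a powr (- s) - complex_of_real x powr (- s))
      \<le> norm s * a powr (- Re s - 1) * norm (complex_of_real a - complex_of_real x)"
  proof (rule field_differentiable_bound[of S _ "\<lambda>z. - s * z powr (- s - 1)"])
    show "convex S" by (simp add: S_def)
    fix z assume "z \<in> S"
    then obtain t where t: "z = complex_of_real t" "a \<le> t" using S by blast
    then have "z \<notin> \<real>\<^sub>\<le>\<^sub>0" using assms by (auto simp: complex_nonpos_Reals_iff)
    then show "((\<lambda>z. z powr (- s)) has_field_derivative - s * z powr (- s - 1)) (at z within S)"
      by (auto intro!: derivative_eq_intros)
    have "norm (z powr (- s - 1)) = t powr (- Re s - 1)"
      using t assms by (simp add: norm_powr_real_powr)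
    also have "\<dots> \<le> a powr (- Re s - 1)" using t assms by (intro powr_mono2') auto
    finally show "norm (- s * z powr (- s - 1)) \<le> norm s * a powr (- Re s - 1)"
      by (simp add: norm_mult mult_left_mono)
  qed (auto simp: S_def)
  moreover have "norm (complex_of_real a - complex_of_real x) = x - a"
    using x by (simp add: of_real_diff[symmetric] del: of_real_diff)
  ultimately show ?thesis by simp
qed

text \<open>Comparing the summand with its integral over a unit interval gains one power of
  \<open>Suc n\<close>, which is what makes the series converge for all
  \<open>Re s > 0\<close>.\<close>

lemma norm_zeta_term_le:
  assumes s: "0 < Re s" "s \<noteq> 1"
  shows "norm (zeta_term n s) \<le> norm s * real (Suc n) powr (- Re s - 1)"
proof -
  define a where "a = real (Suc n)"
  have a: "0 < a" by (simp add: a_def)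
  \<comment> \<open>A primitive of \<open>a powr (- s) - z powr (- s)\<close>, whose increment from
    \<open>a\<close> to \<open>a + 1\<close> is the zeta term; the mean value inequality then
    applies twice.\<close>
  define \<psi> where "\<psi> z = complex_of_real a powr (- s) * z - z powr (1 - s) / (1 - s)" for z
  define S where "S = closed_segment (complex_of_real a) (complex_of_real (a + 1))"
  have S: "\<exists>t. z = complex_of_real t \<and> a \<le> t \<and> t \<le> a + 1" if "z \<in> S" for z
    using that unfolding S_def closed_segment_of_real by (auto simp: closed_segment_eq_real_ivl)
  have "norm (\<psi> (a + 1) - \<psi> a) \<le> norm s * a powr (- Re s - 1) * norm (complex_of_real (a + 1) - complex_of_real a)"
  proof (rule field_differentiable_bound[of S _ "\<lambda>z. complex_of_real a powr (- s) - z powr (- s)"])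
    show "convex S" by (simp add: S_def)
    fix z assume "z \<in> S"
    then obtain t where t: "z = complex_of_real t" "a \<le> t" "t \<le> a + 1" using S by blast
    then have "z \<notin> \<real>\<^sub>\<le>\<^sub>0" using a by (auto simp: complex_nonpos_Reals_iff)
    then show "(\<psi> has_field_derivative complex_of_real a powr (- s) - z powr (- s)) (at z within S)"
      unfolding \<psi>_def using s by (auto intro!: derivative_eq_intros)
    have "norm (complex_of_real a powr (- s) - z powr (- s)) \<le> norm s * a powr (- Re s - 1) * (t - a)"
      unfolding t(1) using t s a by (intro norm_powr_diff_le) auto
    also have "\<dots> \<le> norm s * a powr (- Re s - 1) * 1" using t by (intro mult_left_mono) auto
    finally show "norm (complex_of_real a powr (- s) - z powr (- s)) \<le> norm s * a powr (- Re s - 1)" by simp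
  qed (auto simp: S_def)
  also have "\<psi> (a + 1) - \<psi> a = zeta_term n s"
    by (simp add: \<psi>_def zeta_term_def a_def algebra_simps diff_divide_distrib)
  finally show ?thesis by (simp add: a_def)
qed

lemma summable_zeta_bound: "0 < \<sigma> \<Longrightarrow> summable (\<lambda>n. C * real (Suc n) powr (- \<sigma> - 1))"
proof -
  assume "0 < \<sigma>"
  then have "summable (\<lambda>n. real n powr (- \<sigma> - 1))" by (subst summable_real_powr_iff) auto
  then have "summable (\<lambda>n. real (Suc n) powr (- \<sigma> - 1))" by (subst summable_Suc_iff)
  then show ?thesis by (rule summable_mult)
qed

lemma summable_zeta_term: "0 < Re s \<Longrightarrow> s \<noteq> 1 \<Longrightarrow> summable (\<lambda>n. zeta_term n s)"
  by (rule summable_comparison_test'[OF summable_zeta_bound, of "Re s" 0 _ "norm s"])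
    (use norm_zeta_term_le in auto)

abbreviation zeta_domain :: "complex set" where
  "zeta_domain \<equiv> {s. 0 < Re s} - {1}"

lemma open_zeta_domain: "open zeta_domain"
  by (intro open_Diff open_halfspace_Re_gt) auto

lemma connected_zeta_domain: "connected zeta_domain"
  by (intro connected_open_delete open_halfspace_Re_gt convex_connected convex_halfspace_Re_gt) auto

lemma zeta_term_holomorphic: "zeta_term n holomorphic_on zeta_domain"
  unfolding zeta_term_def by (intro holomorphic_intros) auto

lemma zeta_ext_holomorphic: "zeta_ext holomorphic_on zeta_domain"
proof -
  have "(\<lambda>s. \<Sum>n. zeta_term n s) holomorphic_on zeta_domain"
  proof (rule holomorphic_uniform_sequence[OF open_zeta_domain])
    show "(\<lambda>s. \<Sum>n<N. zeta_term n s) holomorphic_on zeta_domain" for N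
      by (intro holomorphic_intros zeta_term_holomorphic)
    fix s assume s: "s \<in> zeta_domain"
    obtain e where e: "0 < e" "cball s e \<subseteq> zeta_domain"
      using open_contains_cball open_zeta_domain s by blast
    \<comment> \<open>Keeps \<open>Re z \<ge> Re s / 2\<close> on the ball, so one summable majorant
      serves for all its points.\<close>
    define d where "d = min e (Re s / 2)"
    have d: "0 < d" "d \<le> e" "d \<le> Re s / 2" using e s by (auto simp: d_def)
    have sub: "cball s d \<subseteq> zeta_domain" using e d by (meson order.trans subset_cball)
    have "uniform_limit (cball s d) (\<lambda>N s. \<Sum>n<N. zeta_term n s) (\<lambda>s. \<Sum>n. zeta_term n s) sequentially"
    proof (rule Weierstrass_m_test)
      show "summable (\<lambda>n. (norm s + d) * real (Suc n) powr (- (Re s / 2) - 1))"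
        using s by (intro summable_zeta_bound) auto
      fix n z assume z: "z \<in> cball s d"
      have "norm (z - s) \<le> d" using z by (simp add: dist_norm norm_minus_commute)
      then have "norm z \<le> norm s + d" "Re s / 2 \<le> Re z"
        using norm_triangle_ineq2[of z s] abs_Re_le_cmod[of "z - s"] d by auto
      then have "norm z * real (Suc n) powr (- Re z - 1) \<le> (norm s + d) * real (Suc n) powr (- (Re s / 2) - 1)"
        using d by (intro mult_mono powr_mono) auto
      moreover have "z \<in> zeta_domain" using z sub by blast
      then have "norm (zeta_term n z) \<le> norm z * real (Suc n) powr (- Re z - 1)"
        by (intro norm_zeta_term_le) auto
      ultimately show "norm (zeta_term n z) \<le> (norm s + d) * real (Suc n) powr (- (Re s / 2) - 1)"
        by linarith
    qed
    then show "\<exists>d>0. cball s d \<subseteq> zeta_domain \<and>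
        uniform_limit (cball s d) (\<lambda>N s. \<Sum>n<N. zeta_term n s) (\<lambda>s. \<Sum>n. zeta_term n s) sequentially"
      using d sub by blast
  qed
  then show ?thesis unfolding zeta_ext_def[abs_def] by (intro holomorphic_intros) auto
qed

text \<open>The integrals telescope, and the pole term cancels the contribution of their lower end
  1.\<close>

lemma zeta_term_partial_sum:
  assumes "s \<noteq> 1"
  shows "1 / (s - 1) + (\<Sum>n<N. zeta_term n s) =
    (\<Sum>n<N. of_nat (Suc n) powr (- s)) - of_nat (Suc N) powr (1 - s) / (1 - s)"
proof -
  have "(\<Sum>n<N. (of_nat (Suc (Suc n)) powr (1 - s) - of_nat (Suc n) powr (1 - s)) / (1 - s))
      = (of_nat (Suc N) powr (1 - s) - 1) / (1 - s)"
    unfolding sum_divide_distrib[symmetric]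
    using sum_lessThan_telescope[of "\<lambda>n. of_nat (Suc n) powr (1 - s)" N] by simp
  moreover have "1 / (s - 1) = - (1 / (1 - s))" by (metis minus_diff_eq minus_divide_right)
  ultimately show ?thesis unfolding zeta_term_def sum_subtractf by (simp add: diff_divide_distrib)
qed

lemma zeta_ext_limit:
  assumes "0 < Re s" "s \<noteq> 1"
  shows "(\<lambda>N. (\<Sum>n<N. of_nat (Suc n) powr (- s)) - of_nat (Suc N) powr (1 - s) / (1 - s)) \<longlonglongrightarrow> zeta_ext s"
  unfolding zeta_term_partial_sum[OF assms(2), symmetric] zeta_ext_def
  by (intro tendsto_intros summable_LIMSEQ summable_zeta_term assms)

lemma zeta_ext_sums:
  assumes "1 < Re s"
  shows "(\<lambda>n. of_nat (Suc n) powr (- s)) sums zeta_ext s"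
proof -
  have "(\<lambda>N. real (Suc N) powr (1 - Re s)) \<longlonglongrightarrow> 0"
    using assms by (intro tendsto_neg_powr filterlim_compose[OF filterlim_real_sequentially] filterlim_Suc) auto
  then have "(\<lambda>N. norm (of_nat (Suc N) powr (1 - s) :: complex)) \<longlonglongrightarrow> 0"
    by (simp add: norm_powr_real_powr del: of_nat_Suc)
  then have "(\<lambda>N. of_nat (Suc N) powr (1 - s) :: complex) \<longlonglongrightarrow> 0"
    by (rule tendsto_norm_zero_cancel)
  then have "(\<lambda>N. of_nat (Suc N) powr (1 - s) / (1 - s)) \<longlonglongrightarrow> 0 / (1 - s)"
    by (rule tendsto_divide) (use assms in auto)
  moreover have "0 < Re s" "s \<noteq> 1" using assms by auto
  ultimately show ?thesis using tendsto_add[OF zeta_ext_limit[of s]] by (fastforce simp: sums_def)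
qed

text \<open>\<open>riemann_zeta\<close> is a choice among admissible continuations;
  \<open>zeta_ext\<close> shows that one exists, and the identity theorem on the connected
  \<open>zeta_domain\<close> makes the choice immaterial.\<close>

lemma riemann_zeta_eq_zeta_ext:
  assumes "s \<in> zeta_domain"
  shows "riemann_zeta s = zeta_ext s"
proof -
  let ?P = "\<lambda>Z. Z holomorphic_on zeta_domain \<and> (\<forall>s. 1 < Re s \<longrightarrow> (\<lambda>n. of_nat (Suc n) powr (- s)) sums Z s)"
  have "?P zeta_ext" by (intro conjI allI impI zeta_ext_holomorphic zeta_ext_sums)
  from someI[of ?P, OF this] have P: "?P riemann_zeta" by (fold riemann_zeta_def)
  have "riemann_zeta s - zeta_ext s = 0"
  proof (rule analytic_continuation[of "\<lambda>s. riemann_zeta s - zeta_ext s" zeta_domain "{s. 1 < Re s}" 2])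
    show "(\<lambda>s. riemann_zeta s - zeta_ext s) holomorphic_on zeta_domain"
      using P zeta_ext_holomorphic by (intro holomorphic_intros) auto
    show "2 islimpt {s. 1 < Re s}"
      by (rule interior_limit_point) (simp add: interior_open open_halfspace_Re_gt)
    show "riemann_zeta z - zeta_ext z = 0" if "z \<in> {s. 1 < Re s}" for z
      using sums_unique2[of _ "riemann_zeta z" "zeta_ext z"] P zeta_ext_sums[of z] that by auto
    show "open zeta_domain" "connected zeta_domain" "s \<in> zeta_domain"
      by (fact open_zeta_domain connected_zeta_domain assms)+
  qed auto
  then show ?thesis by simp
qed

lemma riemann_zeta_real_limit:
  assumes D: "0 < D" "D < 1"
  shows "(\<lambda>A. (\<Sum>k=1..A. real k powr (- D)) - real A powr (1 - D) / (1 - D)) \<longlonglongrightarrow> Re (riemann_zeta (complex_of_real D))"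
proof -
  define s where "s = complex_of_real D"
  have s: "0 < Re s" "s \<noteq> 1" using D by (auto simp: s_def)
  have eq: "Re ((\<Sum>n<N. of_nat (Suc n) powr (- s)) - of_nat (Suc N) powr (1 - s) / (1 - s))
      = (\<Sum>k=1..N. real k powr (- D)) - real (Suc N) powr (1 - D) / (1 - D)" for N
  proof -
    have 1: "of_nat (Suc n) powr (- s) = complex_of_real (real (Suc n) powr (- D))" for n
      using powr_of_real[of "real (Suc n)" "- D"] by (simp add: s_def)
    have 2: "of_nat (Suc N) powr (1 - s) / (1 - s) = complex_of_real (real (Suc N) powr (1 - D) / (1 - D))"
      using powr_of_real[of "real (Suc N)" "1 - D"] by (simp add: s_def)
    have "(\<Sum>n<N. real (Suc n) powr (- D)) = (\<Sum>k=1..N. real k powr (- D))"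
      by (rule sum.reindex_bij_witness[of _ "\<lambda>k. k - 1" Suc]) auto
    then show ?thesis unfolding 1 2 by (simp flip: of_real_sum)
  qed
  have "(\<lambda>N. (\<Sum>k=1..N. real k powr (- D)) - real (Suc N) powr (1 - D) / (1 - D)) \<longlonglongrightarrow> Re (zeta_ext s)"
    unfolding eq[symmetric] by (intro tendsto_Re zeta_ext_limit s)
  \<comment> \<open>The sum stops at \<open>N\<close> while the power is taken at
    \<open>Suc N\<close>; adding the vanishing next term aligns the two.\<close>
  moreover have "(\<lambda>N. real (Suc N) powr (- D)) \<longlonglongrightarrow> 0"
    using D by (intro tendsto_neg_powr filterlim_compose[OF filterlim_real_sequentially] filterlim_Suc) auto
  ultimately have "(\<lambda>N. (\<Sum>k=1..N. real k powr (- D)) - real (Suc N) powr (1 - D) / (1 - D)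
      + real (Suc N) powr (- D)) \<longlonglongrightarrow> Re (zeta_ext s) + 0" by (rule tendsto_add)
  moreover have "(\<Sum>k=1..N. real k powr (- D)) - real (Suc N) powr (1 - D) / (1 - D) + real (Suc N) powr (- D)
      = (\<Sum>k=1..Suc N. real k powr (- D)) - real (Suc N) powr (1 - D) / (1 - D)" for N
    by simp
  ultimately have "(\<lambda>N. (\<Sum>k=1..Suc N. real k powr (- D)) - real (Suc N) powr (1 - D) / (1 - D)) \<longlonglongrightarrow> Re (zeta_ext s)"
    by (simp only: add_0_right)
  then have "(\<lambda>A. (\<Sum>k=1..A. real k powr (- D)) - real A powr (1 - D) / (1 - D)) \<longlonglongrightarrow> Re (zeta_ext s)"
    by (rule iffD1[OF filterlim_sequentially_Suc])
  moreover have "riemann_zeta s = zeta_ext s" using s by (intro riemann_zeta_eq_zeta_ext) auto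
  ultimately show ?thesis by (simp add: s_def)
qed

section \<open>Geometry of a bounded open subset of the line\<close>

text \<open>An endpoint lying in \<open>\<Omega>\<close> would have a ball inside
  \<open>\<Omega>\<close> that meets the component; maximality would put this ball, and so the
  endpoint, into the open interval.\<close>

lemma bounded_component_real:
  fixes \<Omega> :: "real set"
  assumes "open \<Omega>" "bounded \<Omega>" and C: "C \<in> components \<Omega>"
  obtains a b where "a < b" "C = {a<..<b}" "a \<notin> \<Omega>" "b \<notin> \<Omega>"
proof -
  have oC: "open C" and cC: "connected C" and C0: "C \<noteq> {}" and sub: "C \<subseteq> \<Omega>"
    using open_components[OF assms(1) C] in_components_connected[OF C] in_components_nonempty[OF C]
      in_components_subset[OF C] by auto
  have bC: "bounded C" using sub assms(2) bounded_subset by blast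
  define a b where "a = Inf C" and "b = Sup C"
  have bdd: "bdd_below C" "bdd_above C"
    using bC by (auto simp: bounded_imp_bdd_below bounded_imp_bdd_above)
  have a: "a < x" and b: "x < b" if x: "x \<in> C" for x
  proof -
    obtain e where e: "e > 0" "ball x e \<subseteq> C" by (rule openE[OF oC x])
    have "x - e / 2 \<in> ball x e" "x + e / 2 \<in> ball x e" using e by (auto simp: dist_real_def)
    then have "x - e / 2 \<in> C" "x + e / 2 \<in> C" using e by blast+
    then have "a \<le> x - e / 2" "x + e / 2 \<le> b" unfolding a_def b_def using bdd by (auto intro: cInf_lower cSup_upper)
    then show "a < x" "x < b" using e by auto
  qed
  have CI: "C = {a<..<b}"
  proof
    show "C \<subseteq> {a<..<b}" using a b by auto
    show "{a<..<b} \<subseteq> C"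
    proof
      fix x assume x: "x \<in> {a<..<b}"
      obtain y where "y \<in> C" "y < x" using x cInf_lessD[OF C0, of x] by (auto simp: a_def)
      moreover obtain z where "z \<in> C" "x < z" using x less_cSupD[OF C0, of x] by (auto simp: b_def)
      ultimately show "x \<in> C" using connectedD_interval[OF cC, of y z x] by auto
    qed
  qed
  have ab: "a < b" using C0 a b by (metis all_not_in_conv order.strict_trans)
  have "c \<notin> \<Omega>" if c: "c = a \<or> c = b" for c
  proof
    assume "c \<in> \<Omega>"
    then obtain e where e: "e > 0" "ball c e \<subseteq> \<Omega>" by (rule openE[OF assms(1)])
    define d where "d = min (e / 2) ((b - a) / 2)"
    have d: "0 < d" "d < e" "d < b - a" using e ab by (auto simp: d_def min_def)
    have "C \<inter> ball c e \<noteq> {}"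
    proof (cases "c = a")
      case True
      then have "a + d \<in> C \<inter> ball c e" using d CI by (auto simp: dist_real_def)
      then show ?thesis by blast
    next
      case False
      then have "b - d \<in> C \<inter> ball c e" using d CI c by (auto simp: dist_real_def)
      then show ?thesis by blast
    qed
    then have "ball c e \<subseteq> C" using components_maximal[OF C _ e(2)] by auto
    then have "c \<in> C" using e by auto
    then show False using c CI by auto
  qed
  then show ?thesis using that ab CI by blast
qed

locale real_string =
  fixes \<Omega> :: "real set" and l \<alpha> \<beta> :: "nat \<Rightarrow> real"
  assumes open_\<Omega>: "open \<Omega>" and bounded_\<Omega>: "bounded \<Omega>"
    and less: "\<And>j. 1 \<le> j \<Longrightarrow> \<alpha> j < \<beta> j"
    and ends: "\<And>j. 1 \<le> j \<Longrightarrow> \<alpha> j \<notin> \<Omega>" "\<And>j. 1 \<le> j \<Longrightarrow> \<beta> j \<notin> \<Omega>"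
    and \<Omega>_eq: "\<Omega> = (\<Union>j\<in>{1..}. {\<alpha> j<..<\<beta> j})"
    and disj: "\<And>i j. 1 \<le> i \<Longrightarrow> 1 \<le> j \<Longrightarrow> i \<noteq> j \<Longrightarrow> {\<alpha> i<..<\<beta> i} \<inter> {\<alpha> j<..<\<beta> j} = {}"
    and l_eq: "\<And>j. 1 \<le> j \<Longrightarrow> l j = \<beta> j - \<alpha> j"
    and l_decreasing: "\<And>i j. 1 \<le> i \<Longrightarrow> i \<le> j \<Longrightarrow> l j \<le> l i"

lemma real_string_of_fractal_string:
  assumes "open \<Omega>" "bounded \<Omega>" "fractal_string \<Omega> l"
  obtains \<alpha> \<beta> where "real_string \<Omega> l \<alpha> \<beta>"
proof -
  obtain I where I: "bij_betw I {1..} (components \<Omega>)" "\<And>j. 1 \<le> j \<Longrightarrow> l j = measure lebesgue (I j)"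
    and anti: "\<And>i j. 1 \<le> i \<Longrightarrow> i \<le> j \<Longrightarrow> l j \<le> l i"
    using assms(3) unfolding fractal_string_def by auto
  have "\<exists>a b. a < b \<and> I j = {a<..<b} \<and> a \<notin> \<Omega> \<and> b \<notin> \<Omega>" if "1 \<le> j" for j
    using bounded_component_real[OF assms(1,2), of "I j"] bij_betw_apply[OF I(1)] that by (metis atLeast_iff)
  then obtain \<alpha> \<beta> where ab: "\<And>j. 1 \<le> j \<Longrightarrow> \<alpha> j < \<beta> j \<and> I j = {\<alpha> j<..<\<beta> j} \<and> \<alpha> j \<notin> \<Omega> \<and> \<beta> j \<notin> \<Omega>"
    by metis
  have "real_string \<Omega> l \<alpha> \<beta>"
  proof
    show "l j \<le> l i" if "1 \<le> i" "i \<le> j" for i j by (rule anti[OF that])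
    show "open \<Omega>" "bounded \<Omega>" by fact+
    show "\<alpha> j < \<beta> j" "\<alpha> j \<notin> \<Omega>" "\<beta> j \<notin> \<Omega>" "l j = \<beta> j - \<alpha> j" if "1 \<le> j" for j
      using ab[OF that] I(2)[OF that] by auto
    have "\<Omega> = \<Union> (components \<Omega>)" by (simp add: Union_components)
    also have "\<dots> = (\<Union>j\<in>{1..}. {\<alpha> j<..<\<beta> j})"
      using I(1) ab unfolding bij_betw_def by force
    finally show "\<Omega> = (\<Union>j\<in>{1..}. {\<alpha> j<..<\<beta> j})" .
    fix i j :: nat assume ij: "1 \<le> i" "1 \<le> j" "i \<noteq> j"
    then have "I i \<noteq> I j" using I(1) by (auto simp: bij_betw_def dest: inj_onD)
    then show "{\<alpha> i<..<\<beta> i} \<inter> {\<alpha> j<..<\<beta> j} = {}"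
      using ij ab bij_betw_apply[OF I(1)] components_nonoverlap[of "I i" \<Omega> "I j"] by (metis atLeast_iff)
  qed
  then show ?thesis using that by blast
qed

context real_string
begin

lemma sub_\<Omega>: "1 \<le> j \<Longrightarrow> {\<alpha> j<..<\<beta> j} \<subseteq> \<Omega>"
  by (subst \<Omega>_eq) blast

lemma l_positive: "1 \<le> j \<Longrightarrow> 0 < l j"
  by (simp add: l_eq less)

text \<open>Countable additivity over the components: \<open>S = UNIV\<close> gives the summability
  of the lengths, a parallel set gives the tube volume.\<close>

lemma sums_measure_Int:
  assumes "S \<in> sets lebesgue"
  shows "(\<lambda>j. measure lebesgue (S \<inter> {\<alpha> (Suc j)<..<\<beta> (Suc j)})) sums measure lebesgue (S \<inter> \<Omega>)"
proof -
  have "\<Omega> \<in> sets lebesgue" using open_\<Omega> by auto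
  then have "S \<inter> \<Omega> \<in> lmeasurable"
    using assms bounded_\<Omega> by (intro bounded_set_imp_lmeasurable) auto
  moreover have "{1..} = range Suc" by (auto simp: image_iff Suc_le_eq gr0_conv_Suc)
  then have "S \<inter> \<Omega> = (\<Union>j. S \<inter> {\<alpha> (Suc j)<..<\<beta> (Suc j)})"
    unfolding \<Omega>_eq by auto
  moreover have "disjoint_family (\<lambda>j. S \<inter> {\<alpha> (Suc j)<..<\<beta> (Suc j)})"
  proof (unfold disjoint_family_on_def, intro ballI impI)
    fix i j :: nat assume "i \<noteq> j"
    then have "{\<alpha> (Suc i)<..<\<beta> (Suc i)} \<inter> {\<alpha> (Suc j)<..<\<beta> (Suc j)} = {}"
      by (intro disj) auto
    then show "(S \<inter> {\<alpha> (Suc i)<..<\<beta> (Suc i)}) \<inter> (S \<inter> {\<alpha> (Suc j)<..<\<beta> (Suc j)}) = {}" by blast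
  qed
  ultimately show ?thesis using assms
      measure_UNION[of "\<lambda>j. S \<inter> {\<alpha> (Suc j)<..<\<beta> (Suc j)}" lebesgue]
    by (fastforce dest: fmeasurableD2)
qed

sublocale length_sequence l
proof
  have "(\<lambda>j. measure lebesgue (UNIV \<inter> {\<alpha> (Suc j)<..<\<beta> (Suc j)})) sums measure lebesgue (UNIV \<inter> \<Omega>)"
    by (rule sums_measure_Int) simp
  then show "summable (\<lambda>j. l (Suc j))" using l_eq less by (auto simp: sums_iff less_imp_le)
  show "0 < l j" if "1 \<le> j" for j by (rule l_positive[OF that])
  show "l j \<le> l i" if "1 \<le> i" "i \<le> j" for i j by (rule l_decreasing[OF that])
qed

lemma l_sums: "(\<lambda>j. l (Suc j)) sums measure lebesgue \<Omega>"
  using sums_measure_Int[of UNIV] l_eq less by (auto simp: less_imp_le)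

lemma ends_frontier:
  assumes "1 \<le> j"
  shows "\<alpha> j \<in> frontier \<Omega>" "\<beta> j \<in> frontier \<Omega>"
proof -
  have "closure {\<alpha> j<..<\<beta> j} \<subseteq> closure \<Omega>" by (rule closure_mono[OF sub_\<Omega>[OF assms]])
  then show "\<alpha> j \<in> frontier \<Omega>" "\<beta> j \<in> frontier \<Omega>"
    unfolding frontier_def using ends[OF assms] open_\<Omega> less[OF assms] by (auto simp: interior_open)
qed

text \<open>The endpoints are boundary points and no boundary point lies between them, so only the
  nearer endpoint matters and the geometry decouples into single intervals.\<close>

lemma infdist_frontier:
  assumes j: "1 \<le> j" and x: "x \<in> {\<alpha> j<..<\<beta> j}"
  shows "infdist x (frontier \<Omega>) = min (x - \<alpha> j) (\<beta> j - x)"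
proof (rule antisym)
  have "infdist x (frontier \<Omega>) \<le> dist x (\<alpha> j)" "infdist x (frontier \<Omega>) \<le> dist x (\<beta> j)"
    using ends_frontier[OF j] by (auto intro: infdist_le)
  then show "infdist x (frontier \<Omega>) \<le> min (x - \<alpha> j) (\<beta> j - x)" using x by (auto simp: dist_real_def)
  have ne: "frontier \<Omega> \<noteq> {}" using ends_frontier[OF j] by auto
  show "min (x - \<alpha> j) (\<beta> j - x) \<le> infdist x (frontier \<Omega>)"
    unfolding infdist_notempty[OF ne]
  proof (rule cINF_greatest[OF ne])
    fix y assume "y \<in> frontier \<Omega>"
    then have "y \<notin> \<Omega>" using open_\<Omega> by (auto simp: frontier_def interior_open)
    then have "y \<notin> {\<alpha> j<..<\<beta> j}" using sub_\<Omega>[OF j] by auto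
    then show "min (x - \<alpha> j) (\<beta> j - x) \<le> dist x y" using x by (auto simp: dist_real_def)
  qed
qed

lemma parallel_set_Int:
  assumes j: "1 \<le> j"
  shows "parallel_set (frontier \<Omega>) r \<inter> {\<alpha> j<..<\<beta> j} = {x \<in> {\<alpha> j<..<\<beta> j}. x \<le> \<alpha> j + r \<or> \<beta> j - r \<le> x}"
  using infdist_frontier[OF j] unfolding parallel_set_def by (auto simp: min_le_iff_disj)

lemma closed_parallel_set: "closed (parallel_set F r)"
  unfolding parallel_set_def by (intro closed_Collect_le continuous_intros)

lemma measure_parallel_set_Int:
  assumes j: "1 \<le> j" and r: "0 < r"
  shows "measure lebesgue (parallel_set (frontier \<Omega>) r \<inter> {\<alpha> j<..<\<beta> j}) = min (l j) (2 * r)"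
proof (cases "l j \<le> 2 * r")
  case True
  then have "{x \<in> {\<alpha> j<..<\<beta> j}. x \<le> \<alpha> j + r \<or> \<beta> j - r \<le> x} = {\<alpha> j<..<\<beta> j}"
    using l_eq[OF j] by auto
  then show ?thesis using True l_eq[OF j] less[OF j] by (simp add: parallel_set_Int[OF j])
next
  case False
  then have "{x \<in> {\<alpha> j<..<\<beta> j}. x \<le> \<alpha> j + r \<or> \<beta> j - r \<le> x} = {\<alpha> j<..\<alpha> j + r} \<union> {\<beta> j - r..<\<beta> j}"
    using l_eq[OF j] r by auto
  moreover have "measure lebesgue ({\<alpha> j<..\<alpha> j + r} \<union> {\<beta> j - r..<\<beta> j}) = r + r"
    by (subst measure_Union) (use False l_eq[OF j] r in \<open>auto simp: fmeasurable_def\<close>)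
  ultimately show ?thesis using False by (simp add: parallel_set_Int[OF j])
qed

lemma measure_parallel_set:
  assumes "0 < r"
  shows "measure lebesgue (parallel_set (frontier \<Omega>) r \<inter> \<Omega>) = W (2 * r)"
proof -
  have "parallel_set (frontier \<Omega>) r \<in> sets lebesgue"
    using closed_parallel_set by (simp add: borel_closed)
  from sums_measure_Int[OF this]
  have "(\<lambda>j. min (l (Suc j)) (2 * r)) sums measure lebesgue (parallel_set (frontier \<Omega>) r \<inter> \<Omega>)"
    using measure_parallel_set_Int assms by simp
  then show ?thesis unfolding W_def by (simp add: sums_iff)
qed

text \<open>At \<open>2 * r = l j\<close> the two covered halves already meet and the whole interval
  is interior to the parallel set; hence the strict inequality.\<close>

lemma frontier_parallel_set_Int:
  assumes j: "1 \<le> j" and r: "0 < r"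
  shows "frontier (parallel_set (frontier \<Omega>) r) \<inter> {\<alpha> j<..<\<beta> j} = (if 2 * r < l j then {\<alpha> j + r, \<beta> j - r} else {})"
proof -
  define P where "P = parallel_set (frontier \<Omega>) r"
  have P: "x \<in> P \<longleftrightarrow> x \<le> \<alpha> j + r \<or> \<beta> j - r \<le> x" if "x \<in> {\<alpha> j<..<\<beta> j}" for x
    using parallel_set_Int[OF j, of r] that unfolding P_def by blast
  have fr: "frontier P = P - interior P"
    unfolding frontier_def P_def by (simp add: closure_closed closed_parallel_set)
  have int: "x \<in> interior P" if "open U" "U \<subseteq> {\<alpha> j<..<\<beta> j}" "x \<in> U"
      "\<And>y. y \<in> U \<Longrightarrow> y \<le> \<alpha> j + r \<or> \<beta> j - r \<le> y" for x U
    using that P by (intro interiorI[of U]) auto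
  show ?thesis
  proof (cases "2 * r < l j")
    case False
    have "{\<alpha> j<..<\<beta> j} \<subseteq> interior P"
      by (rule subsetI, rule int[of "{\<alpha> j<..<\<beta> j}"]) (use False l_eq[OF j] in auto)
    then show ?thesis using False fr unfolding P_def by auto
  next
    case True
    then have lt: "\<alpha> j + r < \<beta> j - r" using l_eq[OF j] by simp
    have "x \<in> frontier P \<longleftrightarrow> x = \<alpha> j + r \<or> x = \<beta> j - r" if x: "x \<in> {\<alpha> j<..<\<beta> j}" for x
    proof -
      consider "x < \<alpha> j + r" | "x = \<alpha> j + r" | "\<alpha> j + r < x" "x < \<beta> j - r" | "x = \<beta> j - r" | "\<beta> j - r < x"
        by linarith
      then show ?thesis
      proof cases
        case 1
        then have "x \<in> interior P" by (intro int[of "{\<alpha> j<..<\<alpha> j + r}"]) (use x lt r in auto)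
        then show ?thesis using fr 1 lt by auto
      next
        case 2
        have "x \<notin> interior P"
        proof
          assume "x \<in> interior P"
          then obtain e where e: "e > 0" "ball x e \<subseteq> P" unfolding mem_interior by blast
          \<comment> \<open>A point of the ball inside the uncovered gap to the right of
            \<open>x\<close>.\<close>
          define y where "y = x + min (e / 2) ((\<beta> j - r - x) / 2)"
          have "x < y" "y < \<beta> j - r" "y < x + e" unfolding y_def using e 2 lt by (auto simp: min_def field_simps)
          then have "y \<in> P" "y \<notin> P" using e P[of y] 2 x r by (auto simp: dist_real_def subset_iff)
          then show False by blast
        qed
        then show ?thesis using fr 2 P[OF x] by auto
      next
        case 3
        then show ?thesis using fr P[OF x] by auto
      next
        case 4
        have "x \<notin> interior P"
        proof
          assume "x \<in> interior P"
          then obtain e where e: "e > 0" "ball x e \<subseteq> P" unfolding mem_interior by blast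
          define y where "y = x - min (e / 2) ((x - \<alpha> j - r) / 2)"
          have "y < x" "\<alpha> j + r < y" "x - e < y" unfolding y_def using e 4 lt by (auto simp: min_def field_simps)
          then have "y \<in> P" "y \<notin> P" using e P[of y] 4 x r by (auto simp: dist_real_def subset_iff)
          then show False by blast
        qed
        then show ?thesis using fr 4 P[OF x] by auto
      next
        case 5
        then have "x \<in> interior P" by (intro int[of "{\<beta> j - r<..<\<beta> j}"]) (use x lt r in auto)
        then show ?thesis using fr 5 lt by auto
      qed
    qed
    moreover have "\<alpha> j + r \<in> {\<alpha> j<..<\<beta> j}" "\<beta> j - r \<in> {\<alpha> j<..<\<beta> j}" using lt r by auto
    ultimately show ?thesis using True unfolding P_def by auto
  qed
qed

lemma emeasure_frontier_parallel_set:
  assumes r: "0 < r"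
  shows "emeasure (count_space UNIV) (frontier (parallel_set (frontier \<Omega>) r) \<inter> \<Omega>) = ennreal (2 * n (2 * r))"
proof -
  let ?J = "{j. 1 \<le> j \<and> 2 * r < l j}" and ?P = "frontier (parallel_set (frontier \<Omega>) r)"
  have "?P \<inter> \<Omega> = (\<Union>j\<in>{1..}. ?P \<inter> {\<alpha> j<..<\<beta> j})" unfolding \<Omega>_eq by blast
  also have "\<dots> = (\<Union>j\<in>{1..}. if 2 * r < l j then {\<alpha> j + r, \<beta> j - r} else {})"
    using frontier_parallel_set_Int[OF _ r] by (intro SUP_cong) auto
  also have "\<dots> = (\<Union>j\<in>?J. {\<alpha> j + r, \<beta> j - r})" by (auto split: if_splits)
  finally have eq: "?P \<inter> \<Omega> = (\<Union>j\<in>?J. {\<alpha> j + r, \<beta> j - r})" .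
  have fin: "finite ?J" using fin_gt[of "2 * r"] r by auto
  have in_I: "{\<alpha> j + r, \<beta> j - r} \<subseteq> {\<alpha> j<..<\<beta> j}" if "j \<in> ?J" for j
    using that l_eq[of j] r by auto
  have "card (\<Union>j\<in>?J. {\<alpha> j + r, \<beta> j - r}) = (\<Sum>j\<in>?J. card {\<alpha> j + r, \<beta> j - r})"
  proof (rule card_UN_disjoint[OF fin])
    show "\<forall>i\<in>?J. \<forall>j\<in>?J. i \<noteq> j \<longrightarrow> {\<alpha> i + r, \<beta> i - r} \<inter> {\<alpha> j + r, \<beta> j - r} = {}"
      using in_I disj by (metis (no_types, lifting) Int_mono mem_Collect_eq subset_empty)
  qed auto
  also have "\<dots> = (\<Sum>j\<in>?J. 2)"
  proof (rule sum.cong)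
    fix j assume "j \<in> ?J"
    then have "\<alpha> j + r \<noteq> \<beta> j - r" using l_eq[of j] by auto
    then show "card {\<alpha> j + r, \<beta> j - r} = 2" by simp
  qed simp
  also have "\<dots> = 2 * n (2 * r)" by (simp add: n_def)
  finally have "card (?P \<inter> \<Omega>) = 2 * n (2 * r)" unfolding eq .
  moreover have "finite (?P \<inter> \<Omega>)" unfolding eq using fin by auto
  ultimately show ?thesis by (simp add: emeasure_count_space ennreal_of_nat_eq_real_of_nat)
qed

end

section \<open>Smooth cutoff functions\<close>

text \<open>Recursion through \<open>deriv f\<close> instead of iterates of \<open>deriv\<close>
  lets closure under products, inverses and affine substitution be proved by induction with
  \<open>f\<close> generalized where needed.\<close>

fun diffable :: "nat \<Rightarrow> (real \<Rightarrow> real) \<Rightarrow> bool" where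
  "diffable 0 f = True"
| "diffable (Suc n) f = ((\<forall>x. f differentiable (at x)) \<and> diffable n (deriv f))"

lemma diffable_iff: "diffable n f \<longleftrightarrow> (\<forall>k<n. \<forall>x. ((deriv ^^ k) f) differentiable (at x))"
proof (induction n arbitrary: f)
  case (Suc n)
  have "(deriv ^^ Suc k) f = (deriv ^^ k) (deriv f)" for k by (simp add: funpow_swap1)
  then show ?case using Suc by (simp add: All_less_Suc2)
qed simp

lemma smooth_iff_diffable: "(\<forall>n x. ((deriv ^^ n) f) differentiable (at x)) \<longleftrightarrow> (\<forall>n. diffable n f)"
  unfolding diffable_iff by blast

lemma DERIV_diffable: "diffable (Suc n) f \<Longrightarrow> (f has_real_derivative deriv f x) (at x)"
  by (simp add: DERIV_deriv_iff_real_differentiable)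

lemma diffable_SucI:
  assumes "\<And>x. (f has_real_derivative f' x) (at x)" "diffable n f'"
  shows "diffable (Suc n) f"
proof -
  have "deriv f = f'" using assms(1) DERIV_imp_deriv by blast
  then show ?thesis using assms by (auto simp: real_differentiable_def)
qed

lemma diffable_Suc_imp: "diffable (Suc n) f \<Longrightarrow> diffable n f"
  unfolding diffable_iff by auto

lemma diffable_const: "diffable n (\<lambda>x. c)"
proof (induction n arbitrary: c)
  case (Suc n)
  show ?case by (rule diffable_SucI[where f' = "\<lambda>_. 0"]) (auto intro: Suc)
qed simp

lemma diffable_add: "diffable n f \<Longrightarrow> diffable n g \<Longrightarrow> diffable n (\<lambda>x. f x + g x)"
proof (induction n arbitrary: f g)
  case (Suc n)
  show ?case
    by (rule diffable_SucI[where f' = "\<lambda>x. deriv f x + deriv g x"])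
      (use Suc.prems Suc.IH DERIV_diffable[OF Suc.prems(1)] DERIV_diffable[OF Suc.prems(2)] in \<open>auto intro!: DERIV_add\<close>)
qed simp

lemma diffable_mult: "diffable n f \<Longrightarrow> diffable n g \<Longrightarrow> diffable n (\<lambda>x. f x * g x)"
proof (induction n arbitrary: f g)
  case (Suc n)
  show ?case
  proof (rule diffable_SucI[where f' = "\<lambda>x. deriv f x * g x + deriv g x * f x"])
    show "((\<lambda>x. f x * g x) has_real_derivative deriv f x * g x + deriv g x * f x) (at x)" for x
      by (rule DERIV_mult) (use Suc.prems DERIV_diffable in auto)
    show "diffable n (\<lambda>x. deriv f x * g x + deriv g x * f x)"
      by (intro diffable_add Suc.IH) (use Suc.prems diffable_Suc_imp[OF Suc.prems(1)] diffable_Suc_imp[OF Suc.prems(2)] in auto)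
  qed
qed simp

lemma diffable_inverse:
  assumes "\<And>x. f x \<noteq> 0"
  shows "diffable n f \<Longrightarrow> diffable n (\<lambda>x. inverse (f x))"
proof (induction n)
  case (Suc n)
  have f: "diffable n f" "diffable n (deriv f)" using Suc.prems diffable_Suc_imp by auto
  show ?case
  proof (rule diffable_SucI[where f' = "\<lambda>x. (- 1) * (deriv f x * (inverse (f x) * inverse (f x)))"])
    show "((\<lambda>x. inverse (f x)) has_real_derivative (- 1) * (deriv f x * (inverse (f x) * inverse (f x)))) (at x)" for x
      using DERIV_inverse_fun[OF DERIV_diffable[OF Suc.prems] assms, of x] by (simp add: field_simps)
    show "diffable n (\<lambda>x. (- 1) * (deriv f x * (inverse (f x) * inverse (f x))))"
      by (intro diffable_mult diffable_const Suc.IH f)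
  qed
qed simp

lemma diffable_affine: "diffable n f \<Longrightarrow> diffable n (\<lambda>x. f (c * x + d))"
proof (induction n arbitrary: f)
  case (Suc n)
  show ?case
  proof (rule diffable_SucI[where f' = "\<lambda>x. deriv f (c * x + d) * c"])
    show "((\<lambda>x. f (c * x + d)) has_real_derivative deriv f (c * x + d) * c) (at x)" for x
      by (rule DERIV_chain2[OF DERIV_diffable[OF Suc.prems]]) (auto intro!: derivative_eq_intros)
    show "diffable n (\<lambda>x. deriv f (c * x + d) * c)"
      using Suc by (intro diffable_mult diffable_const) auto
  qed
qed simp

lemma diffable_trig: "diffable n (\<lambda>x. A * sin x + B * cos x)"
proof (induction n arbitrary: A B)
  case (Suc n)
  show ?case
  proof (rule diffable_SucI)
    show "((\<lambda>x. A * sin x + B * cos x) has_real_derivative (- B) * sin x + A * cos x) (at x)" for x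
      by (auto intro!: derivative_eq_intros)
  qed (rule Suc)
qed simp

lemma diffable_continuous: "diffable (Suc n) f \<Longrightarrow> continuous_on S f"
  by (intro continuous_at_imp_continuous_on ballI DERIV_isCont[OF DERIV_diffable])

lemma poly_div_exp_tendsto_0: "((\<lambda>x. poly p x / exp x) \<longlongrightarrow> (0::real)) at_top"
proof -
  have "((\<lambda>x. \<Sum>i\<le>degree p. coeff p i * (x ^ i / exp x)) \<longlongrightarrow> (\<Sum>i\<le>degree p. coeff p i * 0)) at_top"
    by (intro tendsto_intros tendsto_power_div_exp_0)
  then show ?thesis by (simp add: poly_altdef sum_divide_distrib)
qed

text \<open>The derivative of \<open>p(1/x) exp(-1/x)\<close> is again of this form.\<close>

definition flat :: "real poly \<Rightarrow> real \<Rightarrow> real" where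
  "flat p x = (if 0 < x then poly p (1 / x) * exp (- (1 / x)) else 0)"

text \<open>With \<open>y = 1 / x\<close>, the chain rule contributes \<open>- (y ^ 2)\<close>, the
  factor \<open>[:0, 0, 1:]\<close> up to sign. At 0 the exponential beats
  \<open>poly p (1 / x) / x\<close>.\<close>

lemma DERIV_flat: "(flat p has_real_derivative flat ([:0, 0, 1:] * (p - pderiv p)) x) (at x)"
proof (cases x "0 :: real" rule: linorder_cases)
  case greater
  have "((\<lambda>x. poly p (1 / x) * exp (- (1 / x))) has_real_derivative flat ([:0, 0, 1:] * (p - pderiv p)) x) (at x)"
    using greater by (auto intro!: derivative_eq_intros simp: flat_def field_simps power2_eq_square)
  then show ?thesis
    by (rule has_field_derivative_transform_within_open[of _ _ _ "{0<..}"]) (use greater in \<open>auto simp: flat_def\<close>)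
next
  case less
  have "((\<lambda>x. 0) has_real_derivative flat ([:0, 0, 1:] * (p - pderiv p)) x) (at x)"
    using less by (simp add: flat_def)
  then show ?thesis
    by (rule has_field_derivative_transform_within_open[of _ _ _ "{..<0}"]) (use less in \<open>auto simp: flat_def\<close>)
next
  case equal
  have "((\<lambda>y. flat p y / y) \<longlongrightarrow> 0) (at_right 0)"
  proof -
    have "((\<lambda>y. poly ([:0, 1:] * p) (inverse y) / exp (inverse y)) \<longlongrightarrow> 0) (at_right (0::real))"
      by (rule filterlim_compose[OF poly_div_exp_tendsto_0 filterlim_inverse_at_top_right])
    moreover have "\<forall>\<^sub>F y in at_right (0::real). poly ([:0, 1:] * p) (inverse y) / exp (inverse y) = flat p y / y"
      using eventually_at_right_less[of "0::real"]
      by eventually_elim (simp add: flat_def exp_minus field_simps)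
    ultimately show ?thesis by (rule Lim_transform_eventually)
  qed
  moreover have "((\<lambda>y. flat p y / y) \<longlongrightarrow> 0) (at_left 0)"
  proof (rule tendsto_eventually)
    show "\<forall>\<^sub>F y in at_left 0. flat p y / y = 0"
      using eventually_at_left_real[of "-1" "0::real"] by (auto simp: flat_def elim: eventually_mono)
  qed
  ultimately have "((\<lambda>y. (flat p y - flat p 0) / (y - 0)) \<longlongrightarrow> 0) (at 0)"
    by (simp add: filterlim_split_at flat_def)
  then show ?thesis by (simp add: has_field_derivative_iff equal flat_def)
qed

lemma diffable_flat: "diffable n (flat p)"
proof (induction n arbitrary: p)
  case (Suc n)
  show ?case by (rule diffable_SucI[OF DERIV_flat Suc])
qed simp

text \<open>The classical quotient of \<open>exp (- 1 / x)\<close> by its sum with the reflection at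
  \<open>1 - x\<close>. The reflection is written as an affine expression to match
  \<open>diffable_affine\<close>.\<close>

definition smooth_step :: "real \<Rightarrow> real" where
  "smooth_step x = flat 1 x * inverse (flat 1 x + flat 1 ((- 1) * x + 1))"

lemma flat_1: "0 \<le> flat 1 x" "0 < x \<Longrightarrow> 0 < flat 1 x" "x \<le> 0 \<Longrightarrow> flat 1 x = 0"
  by (auto simp: flat_def)

lemma smooth_step_denominator: "0 < flat 1 x + flat 1 ((- 1) * x + 1)"
  using flat_1(1)[of x] flat_1(1)[of "(- 1) * x + 1"] flat_1(2)[of x] flat_1(2)[of "(- 1) * x + 1"]
  by (cases "0 < x") linarith+

lemma diffable_smooth_step: "diffable n smooth_step"
  unfolding smooth_step_def[abs_def]
  by (intro diffable_mult diffable_inverse diffable_add diffable_affine[of _ "flat 1"] diffable_flat)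
    (metis less_irrefl smooth_step_denominator)

lemma smooth_step_0: "x \<le> 0 \<Longrightarrow> smooth_step x = 0"
  by (simp add: smooth_step_def flat_1)

lemma smooth_step_1: "1 \<le> x \<Longrightarrow> smooth_step x = 1"
  using flat_1(2)[of x] by (auto simp: smooth_step_def flat_1(3))

lemma smooth_step_bounds: "0 \<le> smooth_step x" "smooth_step x \<le> 1"
proof -
  define u v where "u = flat 1 x" and "v = flat 1 ((- 1) * x + 1)"
  have "0 \<le> u" "0 \<le> v" "0 < u + v" using flat_1 smooth_step_denominator by (auto simp: u_def v_def)
  then show "0 \<le> smooth_step x" "smooth_step x \<le> 1"
    unfolding smooth_step_def u_def[symmetric] v_def[symmetric] by (auto simp: field_simps)
qed

lemma deriv_smooth_step_outside: "x < 0 \<or> 1 < x \<Longrightarrow> deriv smooth_step x = 0"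
proof -
  have "(smooth_step has_real_derivative 0) (at x)" if "x < 0"
    by (rule has_field_derivative_transform_within_open[of "\<lambda>_. 0" _ _ "{..<0}"])
      (use that in \<open>auto simp: smooth_step_0\<close>)
  moreover have "(smooth_step has_real_derivative 0) (at x)" if "1 < x"
    by (rule has_field_derivative_transform_within_open[of "\<lambda>_. 1" _ _ "{1<..}"])
      (use that in \<open>auto simp: smooth_step_1\<close>)
  ultimately show "x < 0 \<or> 1 < x \<Longrightarrow> deriv smooth_step x = 0" using DERIV_imp_deriv by blast
qed

lemma deriv_smooth_step_bounded: "\<exists>C. \<forall>x. \<bar>deriv smooth_step x\<bar> \<le> C"
proof -
  have "continuous_on {0..1} (deriv smooth_step)"
    using diffable_smooth_step[of "Suc (Suc 0)"] by (intro diffable_continuous[of 0]) auto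
  then have "bounded (deriv smooth_step ` {0..1})" by (intro compact_imp_bounded compact_continuous_image) auto
  then obtain C where C: "0 < C" "\<And>x. x \<in> {0..1} \<Longrightarrow> \<bar>deriv smooth_step x\<bar> \<le> C"
    unfolding bounded_pos by auto
  have "\<bar>deriv smooth_step x\<bar> \<le> C" for x
    using C(1) C(2)[of x] deriv_smooth_step_outside[of x] by (cases "x < 0 \<or> 1 < x") auto
  then show ?thesis by blast
qed

section \<open>Test functions and approximation of functions vanishing at both ends\<close>

lemma test_functionI:
  assumes "\<And>n. diffable n \<phi>" "compact K" "K \<subseteq> \<Omega>" "\<And>x. x \<notin> K \<Longrightarrow> \<phi> x = 0"
  shows "test_function \<Omega> \<phi>"
  unfolding test_function_def smooth_iff_diffable using assms by auto

lemma test_function_support: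
  assumes "test_function \<Omega> \<phi>"
  obtains K where "compact K" "K \<subseteq> \<Omega>" "\<And>x. x \<notin> K \<Longrightarrow> \<phi> x = 0"
proof -
  have "\<exists>K. compact K \<and> K \<subseteq> \<Omega> \<and> (\<forall>x. x \<notin> K \<longrightarrow> \<phi> x = 0)"
    using assms unfolding test_function_def by (rule conjunct2)
  then show ?thesis using that by blast
qed

lemma test_function_diffable: "test_function \<Omega> \<phi> \<Longrightarrow> diffable n \<phi>"
  unfolding test_function_def smooth_iff_diffable by blast

lemma test_function_mono: "test_function A \<phi> \<Longrightarrow> A \<subseteq> B \<Longrightarrow> test_function B \<phi>"
  unfolding test_function_def by blast

lemma test_function_DERIV: "test_function \<Omega> \<phi> \<Longrightarrow> (\<phi> has_real_derivative deriv \<phi> x) (at x)"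
  by (rule DERIV_diffable[OF test_function_diffable])

lemma test_function_deriv:
  assumes "test_function \<Omega> \<phi>"
  shows "test_function \<Omega> (deriv \<phi>)"
proof -
  obtain K where K: "compact K" "K \<subseteq> \<Omega>" "\<And>x. x \<notin> K \<Longrightarrow> \<phi> x = 0"
    using test_function_support[OF assms] by metis
  have "diffable n (deriv \<phi>)" for n
    using test_function_diffable[OF assms, of "Suc n"] by (simp only: diffable.simps)
  moreover have "deriv \<phi> x = 0" if "x \<notin> K" for x
  proof (rule DERIV_imp_deriv)
    show "(\<phi> has_real_derivative 0) (at x)"
      by (rule has_field_derivative_transform_within_open[of "\<lambda>_. 0" _ _ "- K"])
        (use that K in \<open>auto simp: compact_imp_closed\<close>)
  qed
  ultimately show ?thesis using K by (intro test_functionI[of _ K]) auto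
qed

lemma test_function_outside: "test_function \<Omega> \<phi> \<Longrightarrow> x \<notin> \<Omega> \<Longrightarrow> \<phi> x = 0"
  by (metis test_function_support subsetD)

lemma test_function_continuous: "test_function \<Omega> \<phi> \<Longrightarrow> continuous_on S \<phi>"
  by (rule diffable_continuous[OF test_function_diffable])

lemma test_function_bounded:
  assumes "test_function \<Omega> \<phi>"
  shows "\<exists>C>0. \<forall>x. \<bar>\<phi> x\<bar> \<le> C"
proof -
  obtain K where K: "compact K" "\<And>x. x \<notin> K \<Longrightarrow> \<phi> x = 0"
    using test_function_support[OF assms] by metis
  have "bounded (\<phi> ` K)" using K test_function_continuous[OF assms] by (intro compact_imp_bounded compact_continuous_image)
  then obtain C where C: "0 < C" "\<And>x. x \<in> K \<Longrightarrow> \<bar>\<phi> x\<bar> \<le> C" unfolding bounded_pos by auto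
  then have "\<bar>\<phi> x\<bar> \<le> C" for x using K(2)[of x] by (cases "x \<in> K") auto
  then show ?thesis using C(1) by blast
qed

text \<open>Uniform bounds together with pointwise convergence of the functions and their
  derivatives are what dominated convergence needs, both against a fixed integrable function and for
  the \<open>L2\<close> distance.\<close>

lemma H1_approximation:
  fixes s :: "real \<Rightarrow> real"
  assumes ab: "a < b" and s: "\<And>n. diffable n s" and B: "\<And>x. \<bar>deriv s x\<bar> \<le> B"
    and zero: "s a = 0" "s b = 0"
  obtains \<phi> C where "\<And>n::nat. test_function {a<..<b} (\<phi> n)"
    "\<And>n x. x \<in> {a<..<b} \<Longrightarrow> \<bar>\<phi> n x\<bar> \<le> C" "\<And>n x. x \<in> {a<..<b} \<Longrightarrow> \<bar>deriv (\<phi> n) x\<bar> \<le> C"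
    "\<And>x. x \<in> {a<..<b} \<Longrightarrow> (\<lambda>n. \<phi> n x) \<longlonglongrightarrow> s x"
    "\<And>x. x \<in> {a<..<b} \<Longrightarrow> (\<lambda>n. deriv (\<phi> n) x) \<longlonglongrightarrow> deriv s x"
proof -
  define N where "N n = real (Suc n)" for n
  \<comment> \<open>\<open>\<chi>1 n\<close> is 0 up to \<open>a + 1 / N n\<close> and 1 from
    \<open>a + 2 / N n\<close> on; \<open>\<chi>2 n\<close> does the same at
    \<open>b\<close>.\<close>
  define \<chi>1 where "\<chi>1 n x = smooth_step (N n * x + (- N n * a - 1))" for n x
  define \<chi>2 where "\<chi>2 n x = smooth_step ((- N n) * x + (N n * b - 1))" for n x
  define \<phi> where "\<phi> n x = s x * (\<chi>1 n x * \<chi>2 n x)" for n x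
  have Npos: "0 < N n" for n by (simp add: N_def)
  have diff\<chi>: "diffable k (\<chi>1 n)" "diffable k (\<chi>2 n)" for k n
    unfolding \<chi>1_def[abs_def] \<chi>2_def[abs_def] by (intro diffable_affine diffable_smooth_step)+
  have diff\<phi>: "diffable k (\<phi> n)" for k n
    unfolding \<phi>_def[abs_def] by (intro diffable_mult s diff\<chi>)
  have test: "test_function {a<..<b} (\<phi> n)" for n
  proof (rule test_functionI[OF diff\<phi>])
    show "compact {a + 1 / N n..b - 1 / N n}" by auto
    show "{a + 1 / N n..b - 1 / N n} \<subseteq> {a<..<b}" 
    proof
      fix x assume "x \<in> {a + 1 / N n..b - 1 / N n}"
      then have "a + 1 / N n \<le> x" "x \<le> b - 1 / N n" by auto
      moreover have "0 < 1 / N n" using Npos[of n] by simp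
      ultimately have "a < x" "x < b" by linarith+
      then show "x \<in> {a<..<b}" by simp
    qed
    fix x assume "x \<notin> {a + 1 / N n..b - 1 / N n}"
    then have "N n * x + (- N n * a - 1) \<le> 0 \<or> (- N n) * x + (N n * b - 1) \<le> 0"
      using Npos[of n] by (auto simp: field_simps not_le)
    then show "\<phi> n x = 0" by (auto simp: \<phi>_def \<chi>1_def \<chi>2_def smooth_step_0)
  qed
  obtain C0 where C0: "\<And>x. \<bar>deriv smooth_step x\<bar> \<le> C0" using deriv_smooth_step_bounded by blast
  have "0 \<le> C0" using C0[of 0] by linarith
  have "0 \<le> B" using B[of 0] by linarith
  have lip: "\<bar>s x - s y\<bar> \<le> B * \<bar>x - y\<bar>" for x y
    using field_differentiable_bound[of UNIV s "deriv s" B x y] DERIV_diffable[OF s[of "Suc 0"]] B by auto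
  have d\<chi>1: "(\<chi>1 n has_real_derivative deriv smooth_step (N n * x + (- N n * a - 1)) * N n) (at x)" for n x
    unfolding \<chi>1_def[abs_def]
    by (rule DERIV_chain2[OF DERIV_diffable[OF diffable_smooth_step]]) (auto intro!: derivative_eq_intros)
  have d\<chi>2: "(\<chi>2 n has_real_derivative deriv smooth_step ((- N n) * x + (N n * b - 1)) * (- N n)) (at x)" for n x
    unfolding \<chi>2_def[abs_def]
    by (rule DERIV_chain2[OF DERIV_diffable[OF diffable_smooth_step]]) (auto intro!: derivative_eq_intros)
  have \<chi>01: "0 \<le> \<chi>1 n x" "\<chi>1 n x \<le> 1" "0 \<le> \<chi>2 n x" "\<chi>2 n x \<le> 1" for n x
    by (simp_all add: \<chi>1_def \<chi>2_def smooth_step_bounds)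
  have d\<phi>: "deriv (\<phi> n) x = deriv s x * (\<chi>1 n x * \<chi>2 n x)
      + (deriv smooth_step (N n * x + (- N n * a - 1)) * N n * \<chi>2 n x
        + deriv smooth_step ((- N n) * x + (N n * b - 1)) * (- N n) * \<chi>1 n x) * s x" for n x
    unfolding \<phi>_def[abs_def]
    by (intro DERIV_imp_deriv DERIV_mult d\<chi>1 d\<chi>2 DERIV_diffable[OF s])
  text \<open>The factor \<open>N\<close> from differentiating the cutoff is compensated since \<open>s = O(1/N)\<close> where it lives.\<close>
  have p1: "\<bar>deriv smooth_step (N n * x + (- N n * a - 1)) * N n * s x\<bar> \<le> 2 * B * C0" if x: "x \<in> {a<..<b}" for n x
  proof (cases "N n * (x - a) \<le> 2")
    case True
    have "\<bar>s x\<bar> \<le> B * (x - a)" using lip[of x a] zero x by auto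
    then have "N n * \<bar>s x\<bar> \<le> N n * (B * (x - a))" using Npos[of n] by (intro mult_left_mono) auto
    also have "\<dots> = B * (N n * (x - a))" by simp
    also have "\<dots> \<le> B * 2" using True \<open>0 \<le> B\<close> by (intro mult_left_mono) auto
    finally have *: "N n * \<bar>s x\<bar> \<le> B * 2" .
    have "\<bar>deriv smooth_step (N n * x + (- N n * a - 1))\<bar> * (N n * \<bar>s x\<bar>) \<le> C0 * (B * 2)"
      using \<open>0 \<le> C0\<close> Npos[of n] by (intro mult_mono[OF C0 *]) auto
    then show ?thesis using Npos[of n] by (simp add: abs_mult mult_ac)
  next
    case False
    then have "deriv smooth_step (N n * x + (- N n * a - 1)) = 0"
      by (intro deriv_smooth_step_outside) (auto simp: algebra_simps)
    then show ?thesis using \<open>0 \<le> B\<close> \<open>0 \<le> C0\<close> by simp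
  qed
  have p2: "\<bar>deriv smooth_step ((- N n) * x + (N n * b - 1)) * N n * s x\<bar> \<le> 2 * B * C0" if x: "x \<in> {a<..<b}" for n x
  proof (cases "N n * (b - x) \<le> 2")
    case True
    have "\<bar>s x\<bar> \<le> B * (b - x)" using lip[of x b] zero x by auto
    then have "N n * \<bar>s x\<bar> \<le> N n * (B * (b - x))" using Npos[of n] by (intro mult_left_mono) auto
    also have "\<dots> = B * (N n * (b - x))" by simp
    also have "\<dots> \<le> B * 2" using True \<open>0 \<le> B\<close> by (intro mult_left_mono) auto
    finally have *: "N n * \<bar>s x\<bar> \<le> B * 2" .
    have "\<bar>deriv smooth_step ((- N n) * x + (N n * b - 1))\<bar> * (N n * \<bar>s x\<bar>) \<le> C0 * (B * 2)"
      using \<open>0 \<le> C0\<close> Npos[of n] by (intro mult_mono[OF C0 *]) auto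
    then show ?thesis using Npos[of n] by (simp add: abs_mult mult_ac)
  next
    case False
    then have "deriv smooth_step ((- N n) * x + (N n * b - 1)) = 0"
      by (intro deriv_smooth_step_outside) (auto simp: algebra_simps)
    then show ?thesis using \<open>0 \<le> B\<close> \<open>0 \<le> C0\<close> by simp
  qed
  have mult01: "\<bar>u * v\<bar> \<le> \<bar>u\<bar>" if "0 \<le> v" "v \<le> 1" for u v :: real
    using mult_left_le[OF that(2), of "\<bar>u\<bar>"] that(1) by (simp add: abs_mult)
  define C where "C = B * (b - a) + (B + 2 * B * C0 + 2 * B * C0)"
  have "0 \<le> B * (b - a)" "0 \<le> B * C0" using \<open>0 \<le> B\<close> \<open>0 \<le> C0\<close> ab by auto
  show ?thesis
  proof (rule that[of \<phi> C])
    show "test_function {a<..<b} (\<phi> n)" for n by (rule test)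
  next
    fix n x assume x: "x \<in> {a<..<b}"
    have "\<bar>\<phi> n x\<bar> \<le> \<bar>s x\<bar>" unfolding \<phi>_def using \<chi>01 by (intro mult01 mult_nonneg_nonneg mult_le_one)
    also have "\<dots> \<le> B * (x - a)" using lip[of x a] zero x by auto
    also have "\<dots> \<le> B * (b - a)" using x \<open>0 \<le> B\<close> by (intro mult_left_mono) auto
    finally show "\<bar>\<phi> n x\<bar> \<le> C" unfolding C_def using \<open>0 \<le> B\<close> \<open>0 \<le> B * C0\<close> by linarith
    have "\<bar>deriv s x * (\<chi>1 n x * \<chi>2 n x)\<bar> \<le> B"
      using order.trans[OF mult01[of "\<chi>1 n x * \<chi>2 n x" "deriv s x"] B[of x]] \<chi>01[of n x] by (simp add: mult_le_one)
    moreover have "\<bar>(deriv smooth_step (N n * x + (- N n * a - 1)) * N n * s x) * \<chi>2 n x\<bar> \<le> 2 * B * C0"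
      using order.trans[OF mult01 p1[OF x]] \<chi>01[of n x] by blast
    moreover have "\<bar>(deriv smooth_step ((- N n) * x + (N n * b - 1)) * N n * s x) * \<chi>1 n x\<bar> \<le> 2 * B * C0"
      using order.trans[OF mult01 p2[OF x]] \<chi>01[of n x] by blast
    moreover have "deriv (\<phi> n) x = deriv s x * (\<chi>1 n x * \<chi>2 n x)
      + (deriv smooth_step (N n * x + (- N n * a - 1)) * N n * s x) * \<chi>2 n x
      - (deriv smooth_step ((- N n) * x + (N n * b - 1)) * N n * s x) * \<chi>1 n x"
      unfolding d\<phi> by (simp add: algebra_simps)
    ultimately show "\<bar>deriv (\<phi> n) x\<bar> \<le> C" unfolding C_def using \<open>0 \<le> B * (b - a)\<close> by linarith
  next
    fix x assume x: "x \<in> {a<..<b}"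
    have ev: "\<forall>\<^sub>F n in sequentially. 2 < N n * (x - a) \<and> 2 < N n * (b - x)"
    proof -
      have "filterlim N at_top sequentially"
        unfolding N_def[abs_def] by (rule filterlim_compose[OF filterlim_real_sequentially filterlim_Suc])
      then have "\<forall>\<^sub>F n in sequentially. 2 / (x - a) < N n" "\<forall>\<^sub>F n in sequentially. 2 / (b - x) < N n"
        by (auto simp: filterlim_at_top_dense)
      then show ?thesis by eventually_elim (use x in \<open>auto simp: field_simps\<close>)
    qed
    then have eq: "\<forall>\<^sub>F n in sequentially. \<phi> n x = s x \<and> deriv (\<phi> n) x = deriv s x"
    proof eventually_elim
      case (elim n)
      then have 1: "1 < N n * x + (- N n * a - 1)" "1 < (- N n) * x + (N n * b - 1)"
        by (auto simp: algebra_simps)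
      then have "\<chi>1 n x = 1" "\<chi>2 n x = 1" by (auto simp: \<chi>1_def \<chi>2_def intro!: smooth_step_1)
      moreover have "deriv smooth_step (N n * x + (- N n * a - 1)) = 0"
        "deriv smooth_step ((- N n) * x + (N n * b - 1)) = 0"
        using 1 by (blast intro: deriv_smooth_step_outside)+
      ultimately show ?case unfolding d\<phi> by (simp add: \<phi>_def)
    qed
    from eq show "(\<lambda>n. \<phi> n x) \<longlonglongrightarrow> s x" by (auto intro!: tendsto_eventually elim: eventually_mono)
    from eq show "(\<lambda>n. deriv (\<phi> n) x) \<longlonglongrightarrow> deriv s x" by (auto intro!: tendsto_eventually elim: eventually_mono)
  qed
qed

section \<open>Tools for the Dirichlet problem\<close>

lemma set_integral_derivative_eq_0:
  fixes F f :: "real \<Rightarrow> real"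
  assumes "a < b" and F: "\<And>x. (F has_real_derivative f x) (at x)" and f: "continuous_on UNIV f"
    and "F a = 0" "F b = 0"
  shows "set_integrable lebesgue {a<..<b} f" "(LINT x:{a<..<b}|lebesgue. f x) = 0"
proof -
  have "(f has_integral F b - F a) {a..b}"
    using assms(1) F by (intro fundamental_theorem_of_calculus)
      (auto simp: has_real_derivative_iff_has_vector_derivative[symmetric] intro: DERIV_subset)
  then have "integral {a..b} f = 0" using assms by (simp add: integral_unique)
  then have 0: "integral {a<..<b} f = 0" by (simp add: integral_open_interval_real)
  have "set_integrable lebesgue {a..b} f"
    using f by (intro absolutely_integrable_continuous_real) (auto intro: continuous_on_subset)
  then show 1: "set_integrable lebesgue {a<..<b} f"
    by (rule set_integrable_subset) auto
  show "(LINT x:{a<..<b}|lebesgue. f x) = 0"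
    using set_lebesgue_integral_eq_integral(2)[OF 1] 0 by simp
qed

lemma integrable_mult_bounded:
  fixes w f :: "'a \<Rightarrow> real"
  assumes w: "integrable M w" and f: "f \<in> borel_measurable M" and C: "\<And>x. \<bar>f x\<bar> \<le> C"
  shows "integrable M (\<lambda>x. w x * f x)"
proof (rule Bochner_Integration.integrable_bound)
  show "integrable M (\<lambda>x. C * \<bar>w x\<bar>)" using w by auto
  show "(\<lambda>x. w x * f x) \<in> borel_measurable M" using w f by auto
  have "0 \<le> C" using C[of undefined] by linarith
  then show "AE x in M. norm (w x * f x) \<le> norm (C * \<bar>w x\<bar>)"
    using C by (intro AE_I2) (auto simp: abs_mult mult.commute intro: mult_right_mono)
qed

text \<open>The weighted inequality between arithmetic and geometric mean replaces Cauchy-Schwarz;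
  its weight \<open>t\<close> is adjusted to the tolerance.\<close>

lemma integral_mult_tendsto_0:
  fixes d :: "nat \<Rightarrow> 'a \<Rightarrow> real"
  assumes d2: "\<And>n. integrable M (\<lambda>x. (d n x)\<^sup>2)" and w2: "integrable M (\<lambda>x. (w x)\<^sup>2)"
    and dw: "\<And>n. integrable M (\<lambda>x. d n x * w x)"
    and lim: "(\<lambda>n. \<integral>x. (d n x)\<^sup>2 \<partial>M) \<longlonglongrightarrow> 0"
  shows "(\<lambda>n. \<integral>x. d n x * w x \<partial>M) \<longlonglongrightarrow> 0"
proof -
  define V where "V = (\<integral>x. (w x)\<^sup>2 \<partial>M)"
  have V: "0 \<le> V" unfolding V_def by (rule integral_nonneg_AE) auto
  have amgm: "\<bar>\<integral>x. d n x * w x \<partial>M\<bar> \<le> t / 2 * (\<integral>x. (d n x)\<^sup>2 \<partial>M) + V / (2 * t)" if t: "0 < t" for t n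
  proof -
    have pt: "\<bar>y * z\<bar> \<le> t / 2 * y\<^sup>2 + 1 / (2 * t) * z\<^sup>2" for y z :: real
    proof -
      have "0 \<le> (t * \<bar>y\<bar> - \<bar>z\<bar>)\<^sup>2" by simp
      then have "2 * t * \<bar>y * z\<bar> \<le> t\<^sup>2 * y\<^sup>2 + z\<^sup>2"
        by (simp add: power2_diff power_mult_distrib abs_mult algebra_simps)
      then show ?thesis using t by (simp add: field_simps power2_eq_square)
    qed
    have "\<bar>\<integral>x. d n x * w x \<partial>M\<bar> \<le> (\<integral>x. \<bar>d n x * w x\<bar> \<partial>M)" by (rule integral_abs_bound)
    also have "\<dots> \<le> (\<integral>x. t / 2 * (d n x)\<^sup>2 + 1 / (2 * t) * (w x)\<^sup>2 \<partial>M)"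
      using pt dw d2 w2 by (intro integral_mono) auto
    also have "\<dots> = t / 2 * (\<integral>x. (d n x)\<^sup>2 \<partial>M) + V / (2 * t)"
      using d2 w2 by (simp add: V_def)
    finally show ?thesis .
  qed
  show ?thesis
  proof (rule LIMSEQ_I)
    fix e :: real assume e: "0 < e"
    \<comment> \<open>Anything above \<open>V / e\<close> makes the fixed part
      \<open>V / (2 * t)\<close> less than \<open>e / 2\<close>; adding 1 keeps \<open>t\<close>
      positive when \<open>V = 0\<close>.\<close>
    define t where "t = V / e + 1"
    have t: "0 < t" using V e by (simp add: t_def add_nonneg_pos)
    have "V / (2 * t) < e / 2" using t V e unfolding t_def by (simp add: field_simps)
    have "\<forall>\<^sub>F n in sequentially. (\<integral>x. (d n x)\<^sup>2 \<partial>M) < e / t"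
      using order_tendstoD(2)[OF lim] e t by simp
    then have "\<forall>\<^sub>F n in sequentially. norm ((\<integral>x. d n x * w x \<partial>M) - 0) < e"
    proof eventually_elim
      case (elim n)
      have "t / 2 * (\<integral>x. (d n x)\<^sup>2 \<partial>M) < t / 2 * (e / t)" using elim t by (intro mult_strict_left_mono) auto
      also have "\<dots> = e / 2" using t by simp
      finally show ?case using amgm[OF t, of n] \<open>V / (2 * t) < e / 2\<close> by simp
    qed
    then show "\<exists>no. \<forall>n\<ge>no. norm ((\<integral>x. d n x * w x \<partial>M) - 0) < e"
      by (simp add: eventually_sequentially)
  qed
qed

text \<open>Test \<open>W\<close> against continuous approximations of its sign.\<close>

lemma AE_eq_0_if_orthogonal_to_continuous:
  fixes W :: "real \<Rightarrow> real"
  assumes W: "integrable lebesgue W"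
    and orth: "\<And>\<psi>. continuous_on UNIV \<psi> \<Longrightarrow> (\<And>x. \<bar>\<psi> x\<bar> \<le> 1) \<Longrightarrow> (\<integral>x. W x * \<psi> x \<partial>lebesgue) = 0"
  shows "AE x in lebesgue. W x = 0"
proof -
  have "(\<lambda>x. sgn (W x)) \<in> borel_measurable lebesgue" using W by measurable
  then have "(\<lambda>x. sgn (W x)) measurable_on UNIV"
    by (intro lebesgue_measurable_imp_measurable_on_real) auto
  then obtain N g where N: "negligible N" and g: "\<And>n. continuous_on UNIV (g n)"
    and lim: "\<And>x. x \<notin> N \<Longrightarrow> (\<lambda>n. g n x) \<longlonglongrightarrow> sgn (W x)"
    unfolding measurable_on_def by auto
  \<comment> \<open>Clipping does not disturb the limit, since \<open>sgn\<close> takes values in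
    \<open>[- 1, 1]\<close>, and it supplies the majorant.\<close>
  define \<psi> where "\<psi> n x = max (- 1) (min 1 (g n x))" for n :: nat and x
  have \<psi>: "continuous_on UNIV (\<psi> n)" "\<bar>\<psi> n x\<bar> \<le> 1" for n x
    unfolding \<psi>_def[abs_def] by (auto intro!: continuous_intros g)
  have \<psi>m: "\<psi> n \<in> borel_measurable lebesgue" for n
    using borel_measurable_continuous_onI[OF \<psi>(1)] by (simp add: measurable_completion)
  have "AE x in lebesgue. x \<notin> N" using N by (intro AE_not_in) (simp add: negligible_iff_null_sets)
  then have AE: "AE x in lebesgue. (\<lambda>n. W x * \<psi> n x) \<longlonglongrightarrow> \<bar>W x\<bar>"
  proof eventually_elim
    case (elim x)
    have "(\<lambda>n. W x * \<psi> n x) \<longlonglongrightarrow> W x * max (- 1) (min 1 (sgn (W x)))"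
      unfolding \<psi>_def using lim[OF elim] by (intro tendsto_intros)
    moreover have "W x * max (- 1) (min 1 (sgn (W x))) = \<bar>W x\<bar>" by (simp add: sgn_if)
    ultimately show ?case by simp
  qed
  have "(\<lambda>n. \<integral>x. W x * \<psi> n x \<partial>lebesgue) \<longlonglongrightarrow> (\<integral>x. \<bar>W x\<bar> \<partial>lebesgue)"
  proof (rule integral_dominated_convergence[where w = "\<lambda>x. \<bar>W x\<bar>"])
    show "(\<lambda>x. \<bar>W x\<bar>) \<in> borel_measurable lebesgue" "integrable lebesgue (\<lambda>x. \<bar>W x\<bar>)" using W by auto
    show "(\<lambda>x. W x * \<psi> n x) \<in> borel_measurable lebesgue" for n using W \<psi>m[of n] by auto
    show "AE x in lebesgue. norm (W x * \<psi> n x) \<le> \<bar>W x\<bar>" for n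
      using \<psi>(2) by (intro AE_I2) (auto simp: abs_mult intro: mult_left_le)
  qed (rule AE)
  then have "(\<integral>x. \<bar>W x\<bar> \<partial>lebesgue) = 0" using orth[OF \<psi>] by (simp add: LIMSEQ_const_iff)
  then have "AE x in lebesgue. \<bar>W x\<bar> = 0"
    using W by (subst (asm) integral_nonneg_eq_0_iff_AE) auto
  then show ?thesis by simp
qed

text \<open>Orthogonality to all \<open>sin (k \<theta>)\<close> gives orthogonality to all
  \<open>sin \<theta> P (cos \<theta>)\<close>, and the polynomials in \<open>cos \<theta>\<close> are dense by the Weierstrass theorem.\<close>

lemma sines_complete:
  fixes u :: "real \<Rightarrow> real"
  assumes ab: "a < b" and u: "set_integrable lebesgue {a<..<b} u"
    and orth: "\<And>k::nat. 1 \<le> k \<Longrightarrow> (LINT x:{a<..<b}|lebesgue. u x * sin (k * pi / (b - a) * (x - a))) = 0"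
  shows "AE x\<in>{a<..<b} in lebesgue. u x = 0"
proof -
  define w where "w x = indicat_real {a<..<b} x * u x" for x
  define \<theta> where "\<theta> x = pi / (b - a) * (x - a)" for x
  have w: "integrable lebesgue w" using u by (simp add: set_integrable_def w_def[abs_def])
  have cont_meas: "f \<in> borel_measurable lebesgue" if "continuous_on UNIV f" for f :: "real \<Rightarrow> real"
    using borel_measurable_continuous_onI[OF that] by (simp add: measurable_completion)
  have int: "integrable lebesgue (\<lambda>x. w x * f x)" if "continuous_on UNIV f" "\<And>x. \<bar>f x\<bar> \<le> C" for f C
    by (rule integrable_mult_bounded[OF w cont_meas[OF that(1)] that(2)])
  have cont\<theta>: "continuous_on UNIV \<theta>" unfolding \<theta>_def[abs_def] by (intro continuous_intros)
  have cosm: "\<bar>cos y ^ m\<bar> \<le> 1" for y :: real and m by (simp add: power_abs power_le_one)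
  have int': "integrable lebesgue (\<lambda>x. w x * (sin (real k * \<theta> x) * cos (\<theta> x) ^ m))" for k m
  proof (rule int)
    show "\<bar>sin (real k * \<theta> x) * cos (\<theta> x) ^ m\<bar> \<le> 1" for x
    proof -
      have "\<bar>sin (real k * \<theta> x)\<bar> * \<bar>cos (\<theta> x) ^ m\<bar> \<le> 1 * 1" by (intro mult_mono cosm) auto
      then show ?thesis by (simp only: abs_mult mult_1)
    qed
  qed (intro continuous_intros cont\<theta>)
  \<comment> \<open>The product-to-sum formula trades a factor \<open>cos \<theta>\<close> for the
    frequencies \<open>k + 1\<close> and \<open>k - 1\<close>, so the induction on \<open>m\<close>
    runs over all \<open>k\<close> at once; \<open>k = 0\<close> is trivial.\<close>
  have moment: "(\<integral>x. w x * (sin (real k * \<theta> x) * cos (\<theta> x) ^ m) \<partial>lebesgue) = 0" for k m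
  proof (induction m arbitrary: k)
    case 0
    show ?case
    proof (cases "k = 0")
      case False
      have "(\<integral>x. w x * (sin (real k * \<theta> x) * cos (\<theta> x) ^ 0) \<partial>lebesgue)
          = (LINT x:{a<..<b}|lebesgue. u x * sin (k * pi / (b - a) * (x - a)))"
        unfolding set_lebesgue_integral_def w_def \<theta>_def by (simp add: mult.assoc)
      then show ?thesis using orth[of k] False by simp
    qed simp
  next
    case (Suc m)
    show ?case
    proof (cases k)
      case (Suc k')
      have trig: "sin (real k * y) * cos y = sin (real (k + 1) * y) / 2 + sin (real k' * y) / 2" for y
        using sin_times_cos[of "real k * y" y] Suc by (simp add: algebra_simps add_divide_distrib)
      have "w x * (sin (real k * \<theta> x) * cos (\<theta> x) ^ Suc m)
          = (w x * (sin (real (k + 1) * \<theta> x) * cos (\<theta> x) ^ m)) / 2 + (w x * (sin (real k' * \<theta> x) * cos (\<theta> x) ^ m)) / 2" for x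
        using arg_cong[OF trig[of "\<theta> x"], of "\<lambda>z. w x * (z * cos (\<theta> x) ^ m)"] by (simp add: algebra_simps)
      then show ?thesis using Suc.IH[of "k + 1"] Suc.IH[of k'] int'[of "k + 1" m] int'[of k' m] by simp
    qed simp
  qed
  \<comment> \<open>The moments with \<open>k = 1\<close> make \<open>W\<close> orthogonal to
    polynomials in \<open>cos \<theta>\<close>; since \<open>sin \<theta>\<close> is positive inside
    the interval, vanishing of \<open>W\<close> gives vanishing of \<open>u\<close> there.\<close>
  define W where "W x = w x * sin (\<theta> x)" for x
  have W: "integrable lebesgue W" unfolding W_def[abs_def]
    by (rule int[of _ 1]) (auto intro!: continuous_intros cont\<theta>)
  have "AE x in lebesgue. W x = 0"
  proof (rule AE_eq_0_if_orthogonal_to_continuous[OF W])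
    fix \<psi> :: "real \<Rightarrow> real" assume \<psi>: "continuous_on UNIV \<psi>" "\<And>x. \<bar>\<psi> x\<bar> \<le> 1"
    \<comment> \<open>\<open>\<psi>\<close> in the variable \<open>y = cos \<theta>\<close>, so that
      polynomial approximation on \<open>[- 1, 1]\<close> applies.\<close>
    define F where "F y = \<psi> (a + (b - a) / pi * arccos y)" for y
    have F: "continuous_on {- 1..1} F" unfolding F_def
      by (intro continuous_on_compose2[OF \<psi>(1)] continuous_intros continuous_on_arccos) auto
    have F\<theta>: "F (cos (\<theta> x)) = \<psi> x" if "x \<in> {a<..<b}" for x
    proof -
      have "0 \<le> \<theta> x" "\<theta> x \<le> pi" using that by (auto simp: \<theta>_def field_simps)
      then have "arccos (cos (\<theta> x)) = \<theta> x" by (rule arccos_cos)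
      then show ?thesis using ab by (simp add: F_def \<theta>_def)
    qed
    have absw: "integrable lebesgue (\<lambda>x. \<bar>w x\<bar>)" using w by auto
    have W\<psi>: "integrable lebesgue (\<lambda>x. W x * \<psi> x)"
      by (rule integrable_mult_bounded[OF W cont_meas[OF \<psi>(1)] \<psi>(2)])
    have small: "\<bar>\<integral>x. W x * \<psi> x \<partial>lebesgue\<bar> \<le> e * (\<integral>x. \<bar>w x\<bar> \<partial>lebesgue)" if e: "0 < e" for e
    proof -
      obtain P where "real_polynomial_function P" and P: "\<And>y. y \<in> {- 1..1} \<Longrightarrow> \<bar>F y - P y\<bar> < e"
        using Stone_Weierstrass_real_polynomial_function[OF _ F e] by auto
      then obtain c n where Pc: "P = (\<lambda>y. \<Sum>i\<le>n. c i * y ^ i)"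
        unfolding real_polynomial_function_iff_sum by blast
      have WP: "W x * P (cos (\<theta> x)) = (\<Sum>i\<le>n. c i * (w x * (sin (real 1 * \<theta> x) * cos (\<theta> x) ^ i)))" for x
        unfolding W_def Pc by (simp add: sum_distrib_left algebra_simps)
      have intP: "integrable lebesgue (\<lambda>x. W x * P (cos (\<theta> x)))"
        unfolding WP by (intro Bochner_Integration.integrable_sum integrable_mult_right int')
      have "(\<integral>x. W x * P (cos (\<theta> x)) \<partial>lebesgue) = 0"
        unfolding WP
        by (subst Bochner_Integration.integral_sum)
          (intro integrable_mult_right int', simp only: integral_mult_right_zero moment mult_zero_right sum.neutral_const)
      then have "\<bar>\<integral>x. W x * \<psi> x \<partial>lebesgue\<bar> = \<bar>\<integral>x. W x * \<psi> x - W x * P (cos (\<theta> x)) \<partial>lebesgue\<bar>"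
        using W\<psi> intP by simp
      also have "\<dots> \<le> (\<integral>x. \<bar>W x * \<psi> x - W x * P (cos (\<theta> x))\<bar> \<partial>lebesgue)" by (rule integral_abs_bound)
      also have "\<dots> \<le> (\<integral>x. e * \<bar>w x\<bar> \<partial>lebesgue)"
      proof (rule integral_mono)
        show "integrable lebesgue (\<lambda>x. \<bar>W x * \<psi> x - W x * P (cos (\<theta> x))\<bar>)" using W\<psi> intP by auto
        show "integrable lebesgue (\<lambda>x. e * \<bar>w x\<bar>)" using absw by auto
        fix x
        show "\<bar>W x * \<psi> x - W x * P (cos (\<theta> x))\<bar> \<le> e * \<bar>w x\<bar>"
        proof (cases "x \<in> {a<..<b}")
          case True
          have "\<bar>\<psi> x - P (cos (\<theta> x))\<bar> \<le> e" using P[of "cos (\<theta> x)"] F\<theta>[OF True] by (simp add: less_imp_le)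
          moreover have "\<bar>sin (\<theta> x)\<bar> \<le> 1" by simp
          ultimately have "\<bar>sin (\<theta> x)\<bar> * \<bar>\<psi> x - P (cos (\<theta> x))\<bar> \<le> 1 * e" by (intro mult_mono) auto
          then have "\<bar>w x\<bar> * (\<bar>sin (\<theta> x)\<bar> * \<bar>\<psi> x - P (cos (\<theta> x))\<bar>) \<le> \<bar>w x\<bar> * e" by (intro mult_left_mono) auto
          moreover have "W x * \<psi> x - W x * P (cos (\<theta> x)) = w x * (sin (\<theta> x) * (\<psi> x - P (cos (\<theta> x))))"
            by (simp add: W_def algebra_simps)
          ultimately show ?thesis by (simp add: abs_mult mult.commute)
        next
          case False
          then show ?thesis by (simp add: W_def w_def)
        qed
      qed
      also have "\<dots> = e * (\<integral>x. \<bar>w x\<bar> \<partial>lebesgue)" by simp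
      finally show ?thesis .
    qed
    have "\<bar>\<integral>x. W x * \<psi> x \<partial>lebesgue\<bar> \<le> 0"
    proof (rule field_le_epsilon)
      fix e :: real assume e: "0 < e"
      define V where "V = (\<integral>x. \<bar>w x\<bar> \<partial>lebesgue)"
      have V: "0 \<le> V" unfolding V_def by (rule integral_nonneg_AE) auto
      \<comment> \<open>Dividing by \<open>V + 1\<close> covers the case
        \<open>V = 0\<close>.\<close>
      have "e / (V + 1) * V \<le> e" using V e by (simp add: field_simps)
      moreover have "0 < e / (V + 1)" using V e by simp
      from small[OF this] have "\<bar>\<integral>x. W x * \<psi> x \<partial>lebesgue\<bar> \<le> e / (V + 1) * V" by (simp add: V_def)
      ultimately show "\<bar>\<integral>x. W x * \<psi> x \<partial>lebesgue\<bar> \<le> 0 + e" by linarith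
    qed
    then show "(\<integral>x. W x * \<psi> x \<partial>lebesgue) = 0" by simp
  qed
  then show ?thesis
  proof eventually_elim
    case (elim x)
    show ?case
    proof
      assume x: "x \<in> {a<..<b}"
      then have "0 < \<theta> x" "\<theta> x < pi" by (auto simp: \<theta>_def field_simps)
      then have "0 < sin (\<theta> x)" by (rule sin_gt_zero)
      then show "u x = 0" using elim x by (simp add: W_def w_def)
    qed
  qed
qed

section \<open>Dimension modulo null sets\<close>

lemma underdetermined_system:
  fixes A :: "'a \<Rightarrow> nat \<Rightarrow> real"
  assumes "finite S" "m < card S"
  shows "\<exists>c. (\<exists>i\<in>S. c i \<noteq> 0) \<and> (\<forall>k<m. (\<Sum>i\<in>S. c i * A i k) = 0)"
  using assms
proof (induction m arbitrary: S A)
  case 0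
  then have "S \<noteq> {}" by auto
  then show ?case by (intro exI[of _ "\<lambda>_. 1"]) auto
next
  case (Suc m)
  show ?case
  proof (cases "\<forall>i\<in>S. A i m = 0")
    case True
    obtain c where "\<exists>i\<in>S. c i \<noteq> 0" "\<forall>k<m. (\<Sum>i\<in>S. c i * A i k) = 0"
      using Suc.IH[OF Suc.prems(1), of A] Suc.prems(2) by auto
    then show ?thesis using True by (intro exI[of _ c]) (auto simp: less_Suc_eq)
  next
    case False
    then obtain p where p: "p \<in> S" "A p m \<noteq> 0" by blast
    \<comment> \<open>Elimination with pivot \<open>p\<close>: the unknown \<open>c p\<close> is
      expressed through the others by equation \<open>m\<close>, leaving one unknown and one
      equation fewer.\<close>
    define B where "B i k = A i k - A i m / A p m * A p k" for i k
    have "m < card (S - {p})" using Suc.prems p by simp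
    with Suc.IH[of "S - {p}" B] Suc.prems(1) obtain c
      where c: "\<exists>i\<in>S - {p}. c i \<noteq> 0" "\<And>k. k < m \<Longrightarrow> (\<Sum>i\<in>S - {p}. c i * B i k) = 0"
      by auto
    define d where "d = c(p := - (\<Sum>i\<in>S - {p}. c i * A i m) / A p m)"
    have sum_d: "(\<Sum>i\<in>S. d i * A i k) = (\<Sum>i\<in>S - {p}. c i * A i k) - (\<Sum>i\<in>S - {p}. c i * A i m) / A p m * A p k" for k
      using Suc.prems(1) p(1) by (simp add: sum.remove d_def)
    have "(\<Sum>i\<in>S. d i * A i k) = 0" if "k < Suc m" for k
    proof (cases "k = m")
      case True
      then show ?thesis using p(2) by (simp add: sum_d)
    next
      case False
      then have "(\<Sum>i\<in>S - {p}. c i * B i k) = 0" using c(2) that by simp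
      moreover have "(\<Sum>i\<in>S - {p}. c i * B i k)
          = (\<Sum>i\<in>S - {p}. c i * A i k) - (\<Sum>i\<in>S - {p}. c i * A i m) / A p m * A p k"
        by (simp add: B_def right_diff_distrib sum_subtractf sum_divide_distrib sum_distrib_right mult.assoc)
      ultimately show ?thesis by (simp add: sum_d)
    qed
    moreover have "\<exists>i\<in>S. d i \<noteq> 0" using c(1) by (auto simp: d_def)
    ultimately show ?thesis by blast
  qed
qed

text \<open>If \<open>m' > m\<close>, the coefficients of the \<open>b' i\<close> with respect to
  \<open>b\<close> satisfy a nontrivial linear relation, which holds for the functions outside a
  finite union of null sets.\<close>

lemma independent_AE_le_spanning_AE:
  fixes b b' :: "nat \<Rightarrow> real \<Rightarrow> real"
  assumes span: "\<And>u. u \<in> E \<Longrightarrow> \<exists>c. AE x\<in>\<Omega> in lebesgue. u x = (\<Sum>i<m. c i * b i x)"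
    and b': "\<And>i. i < m' \<Longrightarrow> b' i \<in> E"
    and indep: "\<And>c. AE x\<in>\<Omega> in lebesgue. (\<Sum>i<m'. c i * b' i x) = 0 \<Longrightarrow> \<forall>i<m'. c i = 0"
  shows "m' \<le> m"
proof (rule ccontr)
  assume "\<not> m' \<le> m"
  have "\<forall>i\<in>{..<m'}. \<exists>c. AE x\<in>\<Omega> in lebesgue. b' i x = (\<Sum>k<m. c k * b k x)"
    using span b' by auto
  from bchoice[OF this] obtain A
    where A: "\<And>i. i < m' \<Longrightarrow> AE x\<in>\<Omega> in lebesgue. b' i x = (\<Sum>k<m. A i k * b k x)"
    by auto
  obtain c where c: "\<exists>i\<in>{..<m'}. c i \<noteq> 0" "\<And>k. k < m \<Longrightarrow> (\<Sum>i\<in>{..<m'}. c i * A i k) = 0"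
    using underdetermined_system[of "{..<m'}" m A] \<open>\<not> m' \<le> m\<close> by auto
  have "AE x in lebesgue. \<forall>i\<in>{..<m'}. x \<in> \<Omega> \<longrightarrow> b' i x = (\<Sum>k<m. A i k * b k x)"
    using A by (intro eventually_ball_finite) auto
  then have "AE x\<in>\<Omega> in lebesgue. (\<Sum>i<m'. c i * b' i x) = 0"
  proof eventually_elim
    case (elim x)
    show ?case
    proof
      assume "x \<in> \<Omega>"
      then have "(\<Sum>i<m'. c i * b' i x) = (\<Sum>i<m'. \<Sum>k<m. c i * A i k * b k x)"
        using elim by (intro sum.cong) (auto simp: sum_distrib_left mult.assoc)
      also have "\<dots> = (\<Sum>k<m. (\<Sum>i<m'. c i * A i k) * b k x)"
        by (subst sum.swap) (simp add: sum_distrib_right)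
      also have "\<dots> = 0" using c(2) by simp
      finally show "(\<Sum>i<m'. c i * b' i x) = 0" .
    qed
  qed
  then show False using indep c(1) by blast
qed

lemma has_dim_AE_unique:
  assumes "has_dim_AE \<Omega> E m" "has_dim_AE \<Omega> E m'"
  shows "m = m'"
proof -
  have "m' \<le> m" if "has_dim_AE \<Omega> E m" "has_dim_AE \<Omega> E m'" for m m'
  proof -
    from that(1) obtain b
      where span: "\<forall>u\<in>E. \<exists>c. AE x\<in>\<Omega> in lebesgue. u x = (\<Sum>i<m. c i * b i x)"
      unfolding has_dim_AE_def by blast
    from that(2) obtain b' where b': "\<forall>i<m'. b' i \<in> E"
      and indep: "\<forall>c. (AE x\<in>\<Omega> in lebesgue. (\<Sum>i<m'. c i * b' i x) = 0) \<longrightarrow> (\<forall>i<m'. c i = 0)"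
      unfolding has_dim_AE_def by blast
    show ?thesis
    proof (rule independent_AE_le_spanning_AE)
      show "\<exists>c. AE x\<in>\<Omega> in lebesgue. u x = (\<Sum>i<m. c i * b i x)" if "u \<in> E" for u
        by (rule span[rule_format, OF that])
      show "b' i \<in> E" if "i < m'" for i by (rule b'[rule_format, OF that])
      show "\<forall>i<m'. c i = 0" if "AE x\<in>\<Omega> in lebesgue. (\<Sum>i<m'. c i * b' i x) = 0" for c
        by (rule indep[THEN spec, THEN mp, OF that])
    qed
  qed
  then show ?thesis using assms by (meson antisym)
qed

section \<open>The Dirichlet spectrum\<close>

lemma borel_measurable_lebesgue_continuous:
  fixes f :: "real \<Rightarrow> real"
  shows "continuous_on UNIV f \<Longrightarrow> f \<in> borel_measurable lebesgue"
  using borel_measurable_continuous_onI[of f] by (simp add: measurable_completion)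

lemma diffable_sin_affine: "diffable n (\<lambda>x. sin (\<omega> * (x - a)))"
proof -
  have "diffable n sin" using diffable_trig[of n 1 0] by simp
  from diffable_affine[OF this, of \<omega> "- \<omega> * a"] show ?thesis by (simp add: algebra_simps)
qed

lemma DERIV_sin_affine: "((\<lambda>x. sin (\<omega> * (x - a))) has_real_derivative \<omega> * cos (\<omega> * (x - a))) (at x)"
  by (auto intro!: derivative_eq_intros)

context real_string
begin

definition \<omega> :: "nat \<Rightarrow> nat \<Rightarrow> real" where "\<omega> k j = real k * pi / l j"
definition I :: "nat \<Rightarrow> real set" where "I j = {\<alpha> j<..<\<beta> j}"
definition s :: "nat \<Rightarrow> nat \<Rightarrow> real \<Rightarrow> real" where "s k j x = sin (\<omega> k j * (x - \<alpha> j))"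
definition c :: "nat \<Rightarrow> nat \<Rightarrow> real \<Rightarrow> real" where "c k j x = \<omega> k j * cos (\<omega> k j * (x - \<alpha> j))"
text \<open>Extension by zero of the sine on one component. Since it vanishes at both ends no
  boundary terms arise, and \<open>e'\<close> is the weak derivative of \<open>e\<close> although
  the cosine itself jumps there.\<close>

definition e :: "nat \<Rightarrow> nat \<Rightarrow> real \<Rightarrow> real" where "e k j x = indicat_real (I j) x * s k j x"
definition e' :: "nat \<Rightarrow> nat \<Rightarrow> real \<Rightarrow> real" where "e' k j x = indicat_real (I j) x * c k j x"

lemma I_sub: "1 \<le> j \<Longrightarrow> I j \<subseteq> \<Omega>"
  unfolding I_def by (rule sub_\<Omega>)

lemma I_meas: "I j \<in> sets lebesgue"
  by (simp add: I_def)

lemma \<Omega>_meas: "\<Omega> \<in> sets lebesgue"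
  using open_\<Omega> by auto

lemma \<Omega>_finite: "emeasure lebesgue \<Omega> < \<infinity>"
  using bounded_set_imp_lmeasurable[OF bounded_\<Omega> \<Omega>_meas] by (simp only: fmeasurable_def mem_Collect_eq infinity_ennreal_def)

lemma integrable_bounded_support:
  assumes "f \<in> borel_measurable lebesgue" "\<And>x. \<bar>f x\<bar> \<le> (C::real)" "\<And>x. x \<notin> \<Omega> \<Longrightarrow> f x = 0"
  shows "integrable lebesgue f"
proof (rule Bochner_Integration.integrable_bound)
  show "integrable lebesgue (\<lambda>x. C * indicat_real \<Omega> x)" using \<Omega>_meas \<Omega>_finite by auto
  have "\<bar>f x\<bar> \<le> \<bar>C * indicat_real \<Omega> x\<bar>" for x
    using assms(2)[of x] assms(3)[of x] by (cases "x \<in> \<Omega>") auto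
  then show "AE x in lebesgue. norm (f x) \<le> norm (C * indicat_real \<Omega> x)" by (intro AE_I2) simp
qed (rule assms)

lemma s_props:
  assumes "1 \<le> j"
  shows "s k j (\<alpha> j) = 0" "s k j (\<beta> j) = 0" "diffable i (s k j)"
    "(s k j has_real_derivative c k j x) (at x)" "(c k j has_real_derivative - (\<omega> k j)\<^sup>2 * s k j x) (at x)"
    "\<bar>s k j x\<bar> \<le> 1" "\<bar>c k j x\<bar> \<le> \<bar>\<omega> k j\<bar>" "deriv (s k j) = c k j"
    "continuous_on UNIV (s k j)" "continuous_on UNIV (c k j)"
proof -
  show "s k j (\<alpha> j) = 0" by (simp add: s_def)
  have "\<omega> k j * (\<beta> j - \<alpha> j) = real k * pi"
    using l_eq[OF assms] l_positive[OF assms] by (simp add: \<omega>_def)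
  then show "s k j (\<beta> j) = 0" by (simp add: s_def)
  show "diffable i (s k j)" unfolding s_def[abs_def] by (rule diffable_sin_affine)
  show "(s k j has_real_derivative c k j x) (at x)" for x
    unfolding s_def[abs_def] c_def by (rule DERIV_sin_affine)
  then show "deriv (s k j) = c k j" using DERIV_imp_deriv by blast
  show "(c k j has_real_derivative - (\<omega> k j)\<^sup>2 * s k j x) (at x)"
    unfolding s_def c_def[abs_def]
    by (auto intro!: derivative_eq_intros simp: power2_eq_square)
  show "\<bar>s k j x\<bar> \<le> 1" by (simp add: s_def)
  show "\<bar>c k j x\<bar> \<le> \<bar>\<omega> k j\<bar>" by (simp add: c_def abs_mult mult_left_le)
  show "continuous_on UNIV (s k j)" "continuous_on UNIV (c k j)"
    unfolding s_def[abs_def] c_def[abs_def] by (intro continuous_intros)+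
qed

lemma e_props:
  assumes "1 \<le> j"
  shows "e k j \<in> borel_measurable lebesgue" "\<bar>e k j x\<bar> \<le> 1" "x \<notin> \<Omega> \<Longrightarrow> e k j x = 0"
    "e' k j \<in> borel_measurable lebesgue" "\<bar>e' k j x\<bar> \<le> \<bar>\<omega> k j\<bar>" "x \<notin> \<Omega> \<Longrightarrow> e' k j x = 0"
    "indicat_real \<Omega> x * e k j x = e k j x" "indicat_real \<Omega> x * e' k j x = e' k j x"
proof -
  show "e k j \<in> borel_measurable lebesgue" "e' k j \<in> borel_measurable lebesgue"
    unfolding e_def[abs_def] e'_def[abs_def]
    using I_meas[of j] borel_measurable_lebesgue_continuous[OF s_props(9)[OF assms, of k]]
      borel_measurable_lebesgue_continuous[OF s_props(10)[OF assms, of k]] by auto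
  show "\<bar>e k j x\<bar> \<le> 1" "\<bar>e' k j x\<bar> \<le> \<bar>\<omega> k j\<bar>"
    using s_props(6,7)[OF assms, of k x] by (auto simp: e_def e'_def indicator_def)
  show "indicat_real \<Omega> x * e k j x = e k j x" "indicat_real \<Omega> x * e' k j x = e' k j x"
    using I_sub[OF assms] by (auto simp: e_def e'_def indicator_def)
  then show "x \<notin> \<Omega> \<Longrightarrow> e k j x = 0" "x \<notin> \<Omega> \<Longrightarrow> e' k j x = 0" by auto
qed

lemma test_props:
  assumes "test_function \<Omega> \<psi>"
  shows "\<psi> \<in> borel_measurable lebesgue" "x \<notin> \<Omega> \<Longrightarrow> \<psi> x = 0"
    "integrable lebesgue \<psi>" "integrable lebesgue (\<lambda>x. (\<psi> x)\<^sup>2)"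
proof -
  show m: "\<psi> \<in> borel_measurable lebesgue"
    by (rule borel_measurable_lebesgue_continuous[OF test_function_continuous[OF assms]])
  show 0: "x \<notin> \<Omega> \<Longrightarrow> \<psi> x = 0" for x by (rule test_function_outside[OF assms])
  obtain C where C: "\<And>x. \<bar>\<psi> x\<bar> \<le> C" using test_function_bounded[OF assms] by blast
  show "integrable lebesgue \<psi>" using m C 0 by (rule integrable_bounded_support)
  show "integrable lebesgue (\<lambda>x. (\<psi> x)\<^sup>2)"
  proof (rule integrable_bounded_support)
    show "\<bar>(\<psi> x)\<^sup>2\<bar> \<le> C\<^sup>2" for x using power_mono[OF C, of x 2] by simp
  qed (use m 0 in auto)
qed

lemma L2_props:
  assumes "u \<in> L2_on \<Omega>"
  defines "U \<equiv> \<lambda>x. indicat_real \<Omega> x * u x"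
  shows "integrable lebesgue U" "integrable lebesgue (\<lambda>x. (U x)\<^sup>2)"
proof -
  have m: "U \<in> borel_measurable lebesgue"
    using assms(1) by (simp add: L2_on_def set_borel_measurable_def U_def)
  have "(indicat_real \<Omega> x * u x)\<^sup>2 = indicat_real \<Omega> x *\<^sub>R (u x)\<^sup>2" for x by (simp add: indicator_def)
  then show 2: "integrable lebesgue (\<lambda>x. (U x)\<^sup>2)"
    using assms(1) by (simp add: L2_on_def set_integrable_def U_def)
  show "integrable lebesgue U"
  proof (rule Bochner_Integration.integrable_bound)
    show "integrable lebesgue (\<lambda>x. indicat_real \<Omega> x + (U x)\<^sup>2)" using 2 \<Omega>_meas \<Omega>_finite by auto
    have "\<bar>y\<bar> \<le> 1 + y\<^sup>2" for y :: real
    proof -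
      have "0 \<le> (\<bar>y\<bar> - 1)\<^sup>2" by simp
      then show ?thesis by (simp add: power2_diff)
    qed
    then have "\<bar>U x\<bar> \<le> \<bar>indicat_real \<Omega> x + (U x)\<^sup>2\<bar>" for x
      unfolding U_def by (simp add: indicator_def)
    then show "AE x in lebesgue. norm (U x) \<le> norm (indicat_real \<Omega> x + (U x)\<^sup>2)" by (intro AE_I2) simp
  qed (rule m)
qed

lemma set_integral_\<Omega>: "(LINT x:\<Omega>|lebesgue. u x * f x) = (\<integral>x. (indicat_real \<Omega> x * u x) * f x \<partial>lebesgue)"
  by (simp add: set_lebesgue_integral_def mult.assoc)

lemma sine_H1_approximation:
  assumes "1 \<le> j"
  obtains \<phi> C where "\<And>n::nat. test_function \<Omega> (\<phi> n)" "0 \<le> C"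
    "\<And>n x. \<bar>\<phi> n x\<bar> \<le> C" "\<And>n x. \<bar>deriv (\<phi> n) x\<bar> \<le> C"
    "\<And>x. (\<lambda>n. \<phi> n x) \<longlonglongrightarrow> e k j x" "\<And>x. (\<lambda>n. deriv (\<phi> n) x) \<longlonglongrightarrow> e' k j x"
proof -
  obtain \<phi> C where \<phi>: "\<And>n::nat. test_function {\<alpha> j<..<\<beta> j} (\<phi> n)"
    "\<And>n x. x \<in> {\<alpha> j<..<\<beta> j} \<Longrightarrow> \<bar>\<phi> n x\<bar> \<le> C" "\<And>n x. x \<in> {\<alpha> j<..<\<beta> j} \<Longrightarrow> \<bar>deriv (\<phi> n) x\<bar> \<le> C"
    "\<And>x. x \<in> {\<alpha> j<..<\<beta> j} \<Longrightarrow> (\<lambda>n. \<phi> n x) \<longlonglongrightarrow> s k j x"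
    "\<And>x. x \<in> {\<alpha> j<..<\<beta> j} \<Longrightarrow> (\<lambda>n. deriv (\<phi> n) x) \<longlonglongrightarrow> deriv (s k j) x"
  proof (rule H1_approximation[of "\<alpha> j" "\<beta> j" "s k j" "\<bar>\<omega> k j\<bar>"])
    show "\<bar>deriv (s k j) x\<bar> \<le> \<bar>\<omega> k j\<bar>" for x
      using s_props(7)[OF assms] by (simp add: s_props(8)[OF assms])
  qed (use less[OF assms] s_props(1-3)[OF assms] in auto)
  have out: "\<phi> n x = 0" "deriv (\<phi> n) x = 0" if "x \<notin> {\<alpha> j<..<\<beta> j}" for n x
    using test_function_outside[OF \<phi>(1) that] test_function_outside[OF test_function_deriv[OF \<phi>(1)] that] by auto
  have "(\<alpha> j + \<beta> j) / 2 \<in> {\<alpha> j<..<\<beta> j}" using less[OF assms] by auto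
  from \<phi>(2)[OF this, of 0] have "0 \<le> C" by linarith
  show ?thesis
  proof (rule that[of \<phi> C])
    show "test_function \<Omega> (\<phi> n)" for n by (rule test_function_mono[OF \<phi>(1) sub_\<Omega>[OF assms]])
    show "\<bar>\<phi> n x\<bar> \<le> C" for n x using \<phi>(2)[of x n] out(1)[of x n] \<open>0 \<le> C\<close> by (cases "x \<in> {\<alpha> j<..<\<beta> j}") auto
    show "\<bar>deriv (\<phi> n) x\<bar> \<le> C" for n x using \<phi>(3)[of x n] out(2)[of x n] \<open>0 \<le> C\<close> by (cases "x \<in> {\<alpha> j<..<\<beta> j}") auto
    show "(\<lambda>n. \<phi> n x) \<longlonglongrightarrow> e k j x" for x
      using \<phi>(4)[of x] out(1)[of x] by (cases "x \<in> {\<alpha> j<..<\<beta> j}") (auto simp: e_def I_def)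
    show "(\<lambda>n. deriv (\<phi> n) x) \<longlonglongrightarrow> e' k j x" for x
      using \<phi>(5)[of x] out(2)[of x] by (cases "x \<in> {\<alpha> j<..<\<beta> j}") (auto simp: e'_def I_def s_props(8)[OF assms])
  qed fact
qed

lemma integral_I_derivative:
  assumes j: "1 \<le> j" and F: "\<And>x. (F has_real_derivative f x) (at x)" and f: "continuous_on UNIV f"
    and "F (\<alpha> j) = 0" "F (\<beta> j) = 0"
  shows "(\<integral>x. indicat_real (I j) x * f x \<partial>lebesgue) = 0"
  using set_integral_derivative_eq_0(2)[OF less[OF j] F f] assms(4,5)
  by (simp add: I_def set_lebesgue_integral_def)

lemma test_ends:
  assumes "test_function \<Omega> \<psi>" "1 \<le> j"
  shows "\<psi> (\<alpha> j) = 0" "\<psi> (\<beta> j) = 0"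
  using test_function_outside[OF assms(1)] ends[OF assms(2)] by auto

lemma integrable_mult_e:
  assumes "integrable lebesgue w" "1 \<le> j"
  shows "integrable lebesgue (\<lambda>x. w x * e k j x)" "integrable lebesgue (\<lambda>x. w x * e' k j x)"
  using integrable_mult_bounded[OF assms(1) e_props(1)[OF assms(2)] e_props(2)[OF assms(2)]]
    integrable_mult_bounded[OF assms(1) e_props(4)[OF assms(2)] e_props(5)[OF assms(2)]] by auto

lemma e_integrable:
  assumes j: "1 \<le> j"
  shows "integrable lebesgue (e k j)" "integrable lebesgue (e' k j)"
    "integrable lebesgue (\<lambda>x. (e k j x)\<^sup>2)" "integrable lebesgue (\<lambda>x. (e' k j x)\<^sup>2)"
proof -
  show 1: "integrable lebesgue (e k j)"
    by (rule integrable_bounded_support[OF e_props(1)[OF j] e_props(2)[OF j] e_props(3)[OF j]])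
  show 2: "integrable lebesgue (e' k j)"
    by (rule integrable_bounded_support[OF e_props(4)[OF j] e_props(5)[OF j] e_props(6)[OF j]])
  show "integrable lebesgue (\<lambda>x. (e k j x)\<^sup>2)" "integrable lebesgue (\<lambda>x. (e' k j x)\<^sup>2)"
    using integrable_mult_e(1)[OF 1 j] integrable_mult_e(2)[OF 2 j] by (simp_all add: power2_eq_square)
qed

text \<open>Test functions on \<open>\<Omega>\<close> vanish at the endpoints of every component,
  because these lie outside \<open>\<Omega>\<close>. This kills the boundary terms even for the
  cosine.\<close>

lemma green_test:
  assumes \<psi>: "test_function \<Omega> \<psi>" and j: "1 \<le> j"
  shows "(\<integral>x. deriv \<psi> x * e' k j x \<partial>lebesgue) = (\<omega> k j)\<^sup>2 * (\<integral>x. \<psi> x * e k j x \<partial>lebesgue)"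
    and "(\<integral>x. deriv \<psi> x * e k j x \<partial>lebesgue) = - (\<integral>x. \<psi> x * e' k j x \<partial>lebesgue)"
proof -
  have \<psi>': "test_function \<Omega> (deriv \<psi>)" by (rule test_function_deriv[OF \<psi>])
  note int = integrable_mult_e[OF test_props(3)[OF \<psi>] j, of k] integrable_mult_e[OF test_props(3)[OF \<psi>'] j, of k]
  have "(\<integral>x. indicat_real (I j) x * (deriv \<psi> x * c k j x + (- (\<omega> k j)\<^sup>2 * s k j x) * \<psi> x) \<partial>lebesgue) = 0"
    by (rule integral_I_derivative[OF j, of "\<lambda>x. \<psi> x * c k j x"])
      (intro DERIV_mult test_function_DERIV[OF \<psi>] s_props(5)[OF j],
       auto intro!: continuous_intros test_function_continuous[OF \<psi>] test_function_continuous[OF \<psi>']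
         s_props(9,10)[OF j] simp: test_ends[OF \<psi> j])
  also have "(\<lambda>x. indicat_real (I j) x * (deriv \<psi> x * c k j x + (- (\<omega> k j)\<^sup>2 * s k j x) * \<psi> x))
      = (\<lambda>x. deriv \<psi> x * e' k j x - (\<omega> k j)\<^sup>2 * (\<psi> x * e k j x))"
    by (auto simp: e_def e'_def algebra_simps)
  finally show "(\<integral>x. deriv \<psi> x * e' k j x \<partial>lebesgue) = (\<omega> k j)\<^sup>2 * (\<integral>x. \<psi> x * e k j x \<partial>lebesgue)"
    using int by simp
  have "(\<integral>x. indicat_real (I j) x * (deriv \<psi> x * s k j x + c k j x * \<psi> x) \<partial>lebesgue) = 0"
    by (rule integral_I_derivative[OF j, of "\<lambda>x. \<psi> x * s k j x"])
      (intro DERIV_mult test_function_DERIV[OF \<psi>] s_props(4)[OF j],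
       auto intro!: continuous_intros test_function_continuous[OF \<psi>] test_function_continuous[OF \<psi>']
         s_props(9,10)[OF j] simp: test_ends[OF \<psi> j])
  also have "(\<lambda>x. indicat_real (I j) x * (deriv \<psi> x * s k j x + c k j x * \<psi> x))
      = (\<lambda>x. deriv \<psi> x * e k j x + \<psi> x * e' k j x)"
    by (auto simp: e_def e'_def algebra_simps)
  finally show "(\<integral>x. deriv \<psi> x * e k j x \<partial>lebesgue) = - (\<integral>x. \<psi> x * e' k j x \<partial>lebesgue)"
    using int by simp
qed

text \<open>The integral of \<open>V * e'\<close> is evaluated in two ways. Approximating the sine
  by test functions and using the weak equation gives \<open>\<mu>\<close> times the integral of
  \<open>U * e\<close>; approximating \<open>u\<close> by test functions, as membership in
  \<open>H10\<close> allows, and using \<open>green_test\<close> gives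
  \<open>(\<omega> k j)\<^sup>2\<close> times the same integral.\<close>

lemma eigenspace_orthogonal:
  assumes u: "u \<in> eigenspace \<Omega> \<mu>" and j: "1 \<le> j"
  shows "(\<mu> - (\<omega> k j)\<^sup>2) * (LINT x:I j|lebesgue. u x * s k j x) = 0"
proof -
  from u obtain v \<psi> where uL: "u \<in> L2_on \<Omega>" and vL: "v \<in> L2_on \<Omega>" and wd: "weak_deriv \<Omega> u v"
    and \<psi>: "\<And>n. test_function \<Omega> (\<psi> n)"
    and lim: "(\<lambda>n. (LINT x:\<Omega>|lebesgue. (\<psi> n x - u x)\<^sup>2) + (LINT x:\<Omega>|lebesgue. (deriv (\<psi> n) x - v x)\<^sup>2)) \<longlonglongrightarrow> 0"
    and eig: "\<And>\<phi>. test_function \<Omega> \<phi> \<Longrightarrow>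
      - (LINT x:\<Omega>|lebesgue. u x * deriv (deriv \<phi>) x) = \<mu> * (LINT x:\<Omega>|lebesgue. u x * \<phi> x)"
    unfolding eigenspace_def H10_def by blast
  define U where "U x = indicat_real \<Omega> x * u x" for x
  define V where "V x = indicat_real \<Omega> x * v x" for x
  have U: "integrable lebesgue U" "integrable lebesgue (\<lambda>x. (U x)\<^sup>2)"
    and V: "integrable lebesgue V" "integrable lebesgue (\<lambda>x. (V x)\<^sup>2)"
    using L2_props[OF uL] L2_props[OF vL] by (auto simp: U_def[abs_def] V_def[abs_def])
  have weak: "(\<integral>x. V x * deriv \<phi> x \<partial>lebesgue) = \<mu> * (\<integral>x. U x * \<phi> x \<partial>lebesgue)" if "test_function \<Omega> \<phi>" for \<phi>
  proof -
    have "(LINT x:\<Omega>|lebesgue. u x * deriv (deriv \<phi>) x) = - (LINT x:\<Omega>|lebesgue. v x * deriv \<phi> x)"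
      using wd test_function_deriv[OF that] unfolding weak_deriv_def by blast
    then show ?thesis using eig[OF that] by (simp add: set_integral_\<Omega> U_def V_def)
  qed
  obtain \<phi> C where \<phi>: "\<And>n::nat. test_function \<Omega> (\<phi> n)" and C: "0 \<le> C" "\<And>n x. \<bar>\<phi> n x\<bar> \<le> C" "\<And>n x. \<bar>deriv (\<phi> n) x\<bar> \<le> C"
    and \<phi>lim: "\<And>x. (\<lambda>n. \<phi> n x) \<longlonglongrightarrow> e k j x" "\<And>x. (\<lambda>n. deriv (\<phi> n) x) \<longlonglongrightarrow> e' k j x"
    by (rule sine_H1_approximation[OF j, of k]) (rule that)
  have dom: "(\<lambda>n. \<integral>x. w x * f n x \<partial>lebesgue) \<longlonglongrightarrow> (\<integral>x. w x * g x \<partial>lebesgue)"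
    if w: "integrable lebesgue w" and f: "\<And>n. f n \<in> borel_measurable lebesgue" "\<And>n x. \<bar>f n x\<bar> \<le> C"
      "\<And>x. (\<lambda>n. f n x) \<longlonglongrightarrow> g x" and g: "g \<in> borel_measurable lebesgue"
    for w g :: "real \<Rightarrow> real" and f :: "nat \<Rightarrow> real \<Rightarrow> real"
  proof (rule integral_dominated_convergence[where w = "\<lambda>x. \<bar>w x\<bar> * C"])
    show "integrable lebesgue (\<lambda>x. \<bar>w x\<bar> * C)" using w by auto
    show "(\<lambda>x. w x * g x) \<in> borel_measurable lebesgue" "\<And>n. (\<lambda>x. w x * f n x) \<in> borel_measurable lebesgue"
      using w f(1) g by auto
    show "AE x in lebesgue. (\<lambda>n. w x * f n x) \<longlonglongrightarrow> w x * g x"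
      by (intro AE_I2 tendsto_intros f(3))
    show "AE x in lebesgue. norm (w x * f n x) \<le> \<bar>w x\<bar> * C" for n
      by (intro AE_I2) (simp add: abs_mult mult_left_mono f(2))
  qed
  \<comment> \<open>First evaluation: the weak equation for the truncated sines passes to the
    limit.\<close>
  have "(\<lambda>n. \<integral>x. V x * deriv (\<phi> n) x \<partial>lebesgue) \<longlonglongrightarrow> (\<integral>x. V x * e' k j x \<partial>lebesgue)"
    by (rule dom[OF V(1) test_props(1)[OF test_function_deriv[OF \<phi>]] C(3) \<phi>lim(2) e_props(4)[OF j]])
  moreover have "(\<lambda>n. \<integral>x. U x * \<phi> n x \<partial>lebesgue) \<longlonglongrightarrow> (\<integral>x. U x * e k j x \<partial>lebesgue)"
    by (rule dom[OF U(1) test_props(1)[OF \<phi>] C(2) \<phi>lim(1) e_props(1)[OF j]])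
  then have "(\<lambda>n. \<mu> * (\<integral>x. U x * \<phi> n x \<partial>lebesgue)) \<longlonglongrightarrow> \<mu> * (\<integral>x. U x * e k j x \<partial>lebesgue)"
    by (intro tendsto_intros)
  ultimately have eq1: "(\<integral>x. V x * e' k j x \<partial>lebesgue) = \<mu> * (\<integral>x. U x * e k j x \<partial>lebesgue)"
    unfolding weak[OF \<phi>] using LIMSEQ_unique by blast
  have sq: "(LINT x:\<Omega>|lebesgue. (f x - w x)\<^sup>2) = (\<integral>x. (f x - indicat_real \<Omega> x * w x)\<^sup>2 \<partial>lebesgue)"
    if "test_function \<Omega> f" for f w
    unfolding set_lebesgue_integral_def
    by (rule Bochner_Integration.integral_cong) (auto simp: indicator_def test_props(2)[OF that])
  have nn: "0 \<le> (\<integral>x. (f x)\<^sup>2 \<partial>lebesgue)" for f :: "real \<Rightarrow> real" by (rule integral_nonneg_AE) auto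
  from lim have lim': "(\<lambda>n. (\<integral>x. (\<psi> n x - U x)\<^sup>2 \<partial>lebesgue) + (\<integral>x. (deriv (\<psi> n) x - V x)\<^sup>2 \<partial>lebesgue)) \<longlonglongrightarrow> 0"
    unfolding sq[OF \<psi>] sq[OF test_function_deriv[OF \<psi>]] U_def V_def .
  have limU: "(\<lambda>n. \<integral>x. (\<psi> n x - U x)\<^sup>2 \<partial>lebesgue) \<longlonglongrightarrow> 0"
    by (rule tendsto_sandwich[OF _ _ tendsto_const lim']) (auto simp: nn)
  have limV: "(\<lambda>n. \<integral>x. (deriv (\<psi> n) x - V x)\<^sup>2 \<partial>lebesgue) \<longlonglongrightarrow> 0"
    by (rule tendsto_sandwich[OF _ _ tendsto_const lim']) (auto simp: nn)
  have sqint: "integrable lebesgue (\<lambda>x. (f x - w x)\<^sup>2)"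
    if f: "integrable lebesgue f" "integrable lebesgue (\<lambda>x. (f x)\<^sup>2)"
      and w: "integrable lebesgue w" "integrable lebesgue (\<lambda>x. (w x)\<^sup>2)" for f w :: "real \<Rightarrow> real"
  proof (rule Bochner_Integration.integrable_bound)
    show "integrable lebesgue (\<lambda>x. 2 * (f x)\<^sup>2 + 2 * (w x)\<^sup>2)" using f w by auto
    show "(\<lambda>x. (f x - w x)\<^sup>2) \<in> borel_measurable lebesgue" using f(1) w(1) by auto
    have "(y - z)\<^sup>2 \<le> 2 * y\<^sup>2 + 2 * z\<^sup>2" for y z :: real
    proof -
      have "0 \<le> (y + z)\<^sup>2" by simp
      then show ?thesis by (simp add: power2_diff power2_sum)
    qed
    then show "AE x in lebesgue. norm ((f x - w x)\<^sup>2) \<le> norm (2 * (f x)\<^sup>2 + 2 * (w x)\<^sup>2)"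
      by (intro AE_I2) simp
  qed
  note e2 = e_integrable(3,4)[OF j]
  note \<psi>i = test_props(3,4)[OF \<psi>] test_props(3,4)[OF test_function_deriv[OF \<psi>]]
  \<comment> \<open>Second evaluation: the \<open>\<psi> n\<close> converge to \<open>u\<close> in
    the \<open>H1\<close> sense, and Green's formula holds for each of them.\<close>
  have "(\<lambda>n. \<integral>x. (deriv (\<psi> n) x - V x) * e' k j x \<partial>lebesgue) \<longlonglongrightarrow> 0"
    by (intro integral_mult_tendsto_0 sqint \<psi>i V e2 limV integrable_mult_e Bochner_Integration.integrable_diff j)
  moreover have "(\<integral>x. (deriv (\<psi> n) x - V x) * e' k j x \<partial>lebesgue)
      = (\<omega> k j)\<^sup>2 * (\<integral>x. \<psi> n x * e k j x \<partial>lebesgue) - (\<integral>x. V x * e' k j x \<partial>lebesgue)" for n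
    using integrable_mult_e(2)[OF \<psi>i(3) j, of n k] integrable_mult_e(2)[OF V(1) j, of k] green_test(1)[OF \<psi> j, of n k]
    by (simp add: left_diff_distrib)
  moreover have "(\<lambda>n. \<integral>x. (\<psi> n x - U x) * e k j x \<partial>lebesgue) \<longlonglongrightarrow> 0"
    by (intro integral_mult_tendsto_0 sqint \<psi>i U e2 limU integrable_mult_e Bochner_Integration.integrable_diff j)
  moreover have "(\<integral>x. (\<psi> n x - U x) * e k j x \<partial>lebesgue)
      = (\<integral>x. \<psi> n x * e k j x \<partial>lebesgue) - (\<integral>x. U x * e k j x \<partial>lebesgue)" for n
    using integrable_mult_e(1)[OF \<psi>i(1) j, of n k] integrable_mult_e(1)[OF U(1) j, of k]
    by (simp add: left_diff_distrib)
  ultimately have l1: "(\<lambda>n. (\<omega> k j)\<^sup>2 * (\<integral>x. \<psi> n x * e k j x \<partial>lebesgue) - (\<integral>x. V x * e' k j x \<partial>lebesgue)) \<longlonglongrightarrow> 0"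
    and l2: "(\<lambda>n. (\<integral>x. \<psi> n x * e k j x \<partial>lebesgue) - (\<integral>x. U x * e k j x \<partial>lebesgue)) \<longlonglongrightarrow> 0"
    by simp_all
  \<comment> \<open>In this combination the integrals of \<open>\<psi> n * e\<close> cancel, leaving
    a constant sequence with limit 0.\<close>
  have "(\<lambda>n. (\<omega> k j)\<^sup>2 * ((\<integral>x. \<psi> n x * e k j x \<partial>lebesgue) - (\<integral>x. U x * e k j x \<partial>lebesgue))
      - ((\<omega> k j)\<^sup>2 * (\<integral>x. \<psi> n x * e k j x \<partial>lebesgue) - (\<integral>x. V x * e' k j x \<partial>lebesgue))) \<longlonglongrightarrow> (\<omega> k j)\<^sup>2 * 0 - 0"
    by (intro tendsto_intros l1 l2)
  then have "(\<integral>x. V x * e' k j x \<partial>lebesgue) = (\<omega> k j)\<^sup>2 * (\<integral>x. U x * e k j x \<partial>lebesgue)"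
    by (simp add: right_diff_distrib LIMSEQ_const_iff)
  then have "(\<mu> - (\<omega> k j)\<^sup>2) * (\<integral>x. U x * e k j x \<partial>lebesgue) = 0" using eq1 by (simp add: algebra_simps)
  moreover have "(\<integral>x. U x * e k j x \<partial>lebesgue) = (LINT x:I j|lebesgue. u x * s k j x)"
    unfolding set_lebesgue_integral_def
    by (rule Bochner_Integration.integral_cong) (use I_sub[OF j] in \<open>auto simp: U_def e_def indicator_def\<close>)
  ultimately show ?thesis by simp
qed

end

section \<open>Eigenfunctions on single components and multiplicities\<close>

context real_string
begin

text \<open>Weak derivative and weak equation are \<open>green_test\<close>. Membership in the
  closure uses the truncated sines, whose bounded pointwise convergence is \<open>L2\<close>
  convergence on a set of finite measure.\<close>

lemma e_in_eigenspace:
  assumes j: "1 \<le> j"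
  shows "e k j \<in> eigenspace \<Omega> ((\<omega> k j)\<^sup>2)"
proof -
  note int = e_integrable[OF j, of k]
  have e\<Omega>: "(\<lambda>x. indicat_real \<Omega> x *\<^sub>R e k j x) = e k j" "(\<lambda>x. indicat_real \<Omega> x *\<^sub>R e' k j x) = e' k j"
    "(\<lambda>x. indicat_real \<Omega> x *\<^sub>R (e k j x)\<^sup>2) = (\<lambda>x. (e k j x)\<^sup>2)"
    "(\<lambda>x. indicat_real \<Omega> x *\<^sub>R (e' k j x)\<^sup>2) = (\<lambda>x. (e' k j x)\<^sup>2)"
  proof -
    have "indicat_real \<Omega> x *\<^sub>R e k j x = e k j x \<and> indicat_real \<Omega> x *\<^sub>R e' k j x = e' k j x
      \<and> indicat_real \<Omega> x *\<^sub>R (e k j x)\<^sup>2 = (e k j x)\<^sup>2 \<and> indicat_real \<Omega> x *\<^sub>R (e' k j x)\<^sup>2 = (e' k j x)\<^sup>2" for x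
      using e_props(3,6)[OF j, of x k] by (cases "x \<in> \<Omega>") auto
    then show "(\<lambda>x. indicat_real \<Omega> x *\<^sub>R e k j x) = e k j" "(\<lambda>x. indicat_real \<Omega> x *\<^sub>R e' k j x) = e' k j"
      "(\<lambda>x. indicat_real \<Omega> x *\<^sub>R (e k j x)\<^sup>2) = (\<lambda>x. (e k j x)\<^sup>2)"
      "(\<lambda>x. indicat_real \<Omega> x *\<^sub>R (e' k j x)\<^sup>2) = (\<lambda>x. (e' k j x)\<^sup>2)" by blast+
  qed
  have L2: "e k j \<in> L2_on \<Omega>" "e' k j \<in> L2_on \<Omega>"
    unfolding L2_on_def mem_Collect_eq set_borel_measurable_def set_integrable_def e\<Omega>
    using e_props(1,4)[OF j] int by auto
  have conv: "(LINT x:\<Omega>|lebesgue. e k j x * f x) = (\<integral>x. f x * e k j x \<partial>lebesgue)"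
    "(LINT x:\<Omega>|lebesgue. e' k j x * f x) = (\<integral>x. f x * e' k j x \<partial>lebesgue)" for f
    unfolding set_integral_\<Omega> e_props(7,8)[OF j] by (simp_all add: mult.commute)
  have wd: "weak_deriv \<Omega> (e k j) (e' k j)"
    unfolding weak_deriv_def conv using green_test(2)[OF _ j] by blast
  have eig: "- (LINT x:\<Omega>|lebesgue. e k j x * deriv (deriv \<phi>) x) = (\<omega> k j)\<^sup>2 * (LINT x:\<Omega>|lebesgue. e k j x * \<phi> x)"
    if \<phi>: "test_function \<Omega> \<phi>" for \<phi>
    unfolding conv using green_test(2)[OF test_function_deriv[OF \<phi>] j] green_test(1)[OF \<phi> j] by simp
  obtain \<phi> C where \<phi>: "\<And>n::nat. test_function \<Omega> (\<phi> n)" and C: "0 \<le> C" "\<And>n x. \<bar>\<phi> n x\<bar> \<le> C" "\<And>n x. \<bar>deriv (\<phi> n) x\<bar> \<le> C"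
    and \<phi>lim: "\<And>x. (\<lambda>n. \<phi> n x) \<longlonglongrightarrow> e k j x" "\<And>x. (\<lambda>n. deriv (\<phi> n) x) \<longlonglongrightarrow> e' k j x"
    by (rule sine_H1_approximation[OF j, of k]) (rule that)
  have dom: "(\<lambda>n. LINT x:\<Omega>|lebesgue. (f n x - g x)\<^sup>2) \<longlonglongrightarrow> 0"
    if f: "\<And>n. f n \<in> borel_measurable lebesgue" "\<And>n x. \<bar>f n x\<bar> \<le> C" "\<And>x. (\<lambda>n. f n x) \<longlonglongrightarrow> g x"
      and g: "g \<in> borel_measurable lebesgue" "\<And>x. \<bar>g x\<bar> \<le> B" for f :: "nat \<Rightarrow> real \<Rightarrow> real" and g B
  proof -
    have "(\<lambda>n. \<integral>x. indicat_real \<Omega> x *\<^sub>R (f n x - g x)\<^sup>2 \<partial>lebesgue) \<longlonglongrightarrow> (\<integral>x. 0 \<partial>(lebesgue :: real measure))"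
    proof (rule integral_dominated_convergence[where w = "\<lambda>x. indicat_real \<Omega> x * (C + B)\<^sup>2"])
      show "(\<lambda>x. 0) \<in> borel_measurable lebesgue" by simp
      show "(\<lambda>x. indicat_real \<Omega> x *\<^sub>R (f n x - g x)\<^sup>2) \<in> borel_measurable lebesgue" for n
        using f(1)[of n] g(1) \<Omega>_meas by auto
      show "integrable lebesgue (\<lambda>x. indicat_real \<Omega> x * (C + B)\<^sup>2)" using \<Omega>_meas \<Omega>_finite by auto
      have "(\<lambda>n. indicat_real \<Omega> x *\<^sub>R (f n x - g x)\<^sup>2) \<longlonglongrightarrow> indicat_real \<Omega> x *\<^sub>R (g x - g x)\<^sup>2" for x
        by (intro tendsto_intros f(3))
      then show "AE x in lebesgue. (\<lambda>n. indicat_real \<Omega> x *\<^sub>R (f n x - g x)\<^sup>2) \<longlonglongrightarrow> 0" by (intro AE_I2) simp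
      show "AE x in lebesgue. norm (indicat_real \<Omega> x *\<^sub>R (f n x - g x)\<^sup>2) \<le> indicat_real \<Omega> x * (C + B)\<^sup>2" for n
      proof (rule AE_I2)
        fix x
        have "\<bar>f n x - g x\<bar> \<le> C + B" using f(2)[of n x] g(2)[of x] by linarith
        then have "\<bar>f n x - g x\<bar>\<^sup>2 \<le> (C + B)\<^sup>2" by (intro power_mono) auto
        then show "norm (indicat_real \<Omega> x *\<^sub>R (f n x - g x)\<^sup>2) \<le> indicat_real \<Omega> x * (C + B)\<^sup>2"
          by (simp add: indicator_def)
      qed
    qed
    then show ?thesis by (simp add: set_lebesgue_integral_def)
  qed
  have "(\<lambda>n. (LINT x:\<Omega>|lebesgue. (\<phi> n x - e k j x)\<^sup>2) + (LINT x:\<Omega>|lebesgue. (deriv (\<phi> n) x - e' k j x)\<^sup>2)) \<longlonglongrightarrow> 0 + 0"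
    by (rule tendsto_add[OF dom[OF test_props(1)[OF \<phi>] C(2) \<phi>lim(1) e_props(1,2)[OF j]]
        dom[OF test_props(1)[OF test_function_deriv[OF \<phi>]] C(3) \<phi>lim(2) e_props(4,5)[OF j]]])
  then have "(\<lambda>n. (LINT x:\<Omega>|lebesgue. (\<phi> n x - e k j x)\<^sup>2) + (LINT x:\<Omega>|lebesgue. (deriv (\<phi> n) x - e' k j x)\<^sup>2)) \<longlonglongrightarrow> 0"
    by (simp only: add_0_right)
  then have "e k j \<in> H10 \<Omega>"
    unfolding H10_def mem_Collect_eq using L2 wd \<phi> by blast
  then show ?thesis unfolding eigenspace_def mem_Collect_eq using eig by blast
qed

lemma \<omega>_pos: "1 \<le> j \<Longrightarrow> 1 \<le> k \<Longrightarrow> 0 < \<omega> k j"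
  by (simp add: \<omega>_def l_positive)

lemma not_AE_s_eq_0:
  assumes j: "1 \<le> j" and k: "1 \<le> k"
  shows "\<not> (AE x\<in>I j in lebesgue. s k j x = 0)"
proof
  assume AE: "AE x\<in>I j in lebesgue. s k j x = 0"
  \<comment> \<open>The end of the first arch of the sine, on which it is positive.\<close>
  define b where "b = \<alpha> j + l j / k"
  have lpos: "0 < l j" by (rule l_positive[OF j])
  have "l j / k \<le> l j" using k lpos by (simp add: field_simps)
  then have b: "\<alpha> j < b" "b \<le> \<beta> j" using l_eq[OF j] lpos k by (auto simp: b_def)
  have "s k j x \<noteq> 0" if "x \<in> {\<alpha> j<..<b}" for x
  proof -
    have "x - \<alpha> j < l j / k" using that by (simp add: b_def)
    then have "\<omega> k j * (x - \<alpha> j) < \<omega> k j * (l j / k)"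
      using \<omega>_pos[OF j k] by (intro mult_strict_left_mono)
    also have "\<dots> = pi" using k lpos by (simp add: \<omega>_def)
    finally have "0 < \<omega> k j * (x - \<alpha> j)" "\<omega> k j * (x - \<alpha> j) < pi"
      using that \<omega>_pos[OF j k] by auto
    then have "0 < sin (\<omega> k j * (x - \<alpha> j))" by (rule sin_gt_zero)
    then show ?thesis by (simp add: s_def)
  qed
  moreover have "{\<alpha> j<..<b} \<subseteq> I j" using b by (auto simp: I_def)
  ultimately have "AE x in lebesgue. x \<notin> {\<alpha> j<..<b}" using AE by (auto elim!: eventually_mono)
  then have "{\<alpha> j<..<b} \<in> null_sets lebesgue" by (subst AE_iff_null_sets) auto
  then have "emeasure lebesgue {\<alpha> j<..<b} = 0" by (rule null_setsD1)
  then show False using b by simp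
qed

lemma s_square_integral_pos:
  assumes j: "1 \<le> j" and k: "1 \<le> k"
  shows "(LINT x:I j|lebesgue. s k j x * s k j x) \<noteq> 0"
proof
  assume 0: "(LINT x:I j|lebesgue. s k j x * s k j x) = 0"
  have "(LINT x:I j|lebesgue. s k j x * s k j x) = (\<integral>x. (e k j x)\<^sup>2 \<partial>lebesgue)"
    unfolding set_lebesgue_integral_def
    by (rule Bochner_Integration.integral_cong) (auto simp: e_def indicator_def power2_eq_square)
  with 0 have "AE x in lebesgue. (e k j x)\<^sup>2 = 0"
    using integral_nonneg_eq_0_iff_AE[OF e_integrable(3)[OF j]] by auto
  then have "AE x\<in>I j in lebesgue. s k j x = 0" by eventually_elim (auto simp: e_def)
  then show False using not_AE_s_eq_0[OF j k] by blast
qed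

lemma eigenspace_set_integrable:
  assumes "u \<in> eigenspace \<Omega> \<mu>" "1 \<le> j"
  shows "set_integrable lebesgue (I j) u"
proof -
  have "u \<in> L2_on \<Omega>" using assms(1) by (simp add: eigenspace_def H10_def)
  from integrable_mult_indicator[OF I_meas L2_props(1)[OF this], of j]
  have "integrable lebesgue (\<lambda>x. indicat_real (I j) x *\<^sub>R (indicat_real \<Omega> x * u x))" .
  moreover have "indicat_real (I j) x *\<^sub>R (indicat_real \<Omega> x * u x) = indicat_real (I j) x *\<^sub>R u x" for x
    using I_sub[OF assms(2)] by (auto simp: indicator_def)
  ultimately show ?thesis by (simp only: set_integrable_def)
qed

lemma set_integrable_mult_s:
  assumes "set_integrable lebesgue (I j) u" "1 \<le> j"
  shows "set_integrable lebesgue (I j) (\<lambda>x. u x * s k j x)"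
  using integrable_mult_bounded[OF assms(1)[unfolded set_integrable_def]
      borel_measurable_lebesgue_continuous[OF s_props(9)[OF assms(2)]] s_props(6)[OF assms(2)], of k]
  by (simp add: set_integrable_def mult.assoc)

lemma AE_0_of_orthogonal:
  assumes j: "1 \<le> j" and u: "set_integrable lebesgue (I j) u"
    and orth: "\<And>k. 1 \<le> k \<Longrightarrow> (LINT x:I j|lebesgue. u x * s k j x) = 0"
  shows "AE x\<in>I j in lebesgue. u x = 0"
  unfolding I_def
  by (rule sines_complete[OF less[OF j]])
    (use u orth in \<open>simp_all add: I_def s_def \<omega>_def l_eq[OF j]\<close>)

lemma eigenspace_on_I_eq_0:
  assumes u: "u \<in> eigenspace \<Omega> \<mu>" and j: "1 \<le> j" and \<mu>: "\<And>k. 1 \<le> k \<Longrightarrow> \<mu> \<noteq> (\<omega> k j)\<^sup>2"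
  shows "AE x\<in>I j in lebesgue. u x = 0"
  by (rule AE_0_of_orthogonal[OF j eigenspace_set_integrable[OF u j]])
    (use eigenspace_orthogonal[OF u j] \<mu> in fastforce)

text \<open>After subtracting the projection on the \<open>k\<close>-th sine, the remainder is
  orthogonal to every sine: for \<open>i = k\<close> by the choice of \<open>A\<close>, for
  \<open>i \<noteq> k\<close> because the frequencies differ.\<close>

lemma eigenspace_on_I:
  assumes u: "u \<in> eigenspace \<Omega> \<mu>" and j: "1 \<le> j" and k: "1 \<le> k" "\<mu> = (\<omega> k j)\<^sup>2"
  shows "\<exists>A. AE x\<in>I j in lebesgue. u x = A * s k j x"
proof -
  define A where "A = (LINT x:I j|lebesgue. u x * s k j x) / (LINT x:I j|lebesgue. s k j x * s k j x)"
  have ui: "set_integrable lebesgue (I j) u" by (rule eigenspace_set_integrable[OF u j])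
  have si: "set_integrable lebesgue (I j) (s k j)"
    using e_integrable(1)[OF j, of k] by (simp add: set_integrable_def e_def[abs_def])
  have neq: "\<mu> \<noteq> (\<omega> i j)\<^sup>2" if "i \<noteq> k" for i
  proof -
    have "\<omega> i j \<noteq> \<omega> k j" using that l_positive[OF j] by (auto simp: \<omega>_def)
    moreover have "0 \<le> \<omega> i j" "0 \<le> \<omega> k j" using l_positive[OF j] by (auto simp: \<omega>_def)
    ultimately show ?thesis using k by (simp add: power2_eq_iff_nonneg)
  qed
  have "AE x\<in>I j in lebesgue. u x - A * s k j x = 0"
  proof (rule AE_0_of_orthogonal[OF j])
    show "set_integrable lebesgue (I j) (\<lambda>x. u x - A * s k j x)" using ui si by auto
    fix i :: nat assume i: "1 \<le> i"
    have "(LINT x:I j|lebesgue. (u x - A * s k j x) * s i j x)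
        = (LINT x:I j|lebesgue. u x * s i j x - A * (s k j x * s i j x))"
      by (simp add: left_diff_distrib mult.assoc)
    also have "\<dots> = (LINT x:I j|lebesgue. u x * s i j x) - A * (LINT x:I j|lebesgue. s k j x * s i j x)"
      using set_integrable_mult_s[OF ui j, of i] set_integrable_mult_s[OF si j, of i] by simp
    also have "\<dots> = 0"
    proof (cases "i = k")
      case True
      then show ?thesis using s_square_integral_pos[OF j k(1)] by (simp add: A_def)
    next
      case False
      have "(LINT x:I j|lebesgue. u x * s i j x) = 0"
        using eigenspace_orthogonal[OF u j, of i] neq[OF False] by simp
      \<comment> \<open>Orthogonality of distinct sines comes without computing an integral, since
        \<open>e k j\<close> is itself an eigenfunction.\<close>
      moreover have "(LINT x:I j|lebesgue. e k j x * s i j x) = 0"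
        using eigenspace_orthogonal[OF e_in_eigenspace[OF j, of k] j, of i] neq[OF False] k(2) by simp
      moreover have "(LINT x:I j|lebesgue. e k j x * s i j x) = (LINT x:I j|lebesgue. s k j x * s i j x)"
        unfolding set_lebesgue_integral_def
        by (rule Bochner_Integration.integral_cong) (auto simp: e_def indicator_def)
      ultimately show ?thesis by simp
    qed
    finally show "(LINT x:I j|lebesgue. (u x - A * s k j x) * s i j x) = 0" .
  qed
  then show ?thesis by auto
qed

text \<open>The components whose own spectrum contains \<open>\<mu>\<close>. On one component
  different \<open>k\<close> give different eigenvalues, so each component in \<open>J \<mu>\<close>
  accounts for exactly one dimension.\<close>

definition J :: "real \<Rightarrow> nat set" where "J \<mu> = {j. 1 \<le> j \<and> (\<exists>k\<ge>1. \<mu> = (\<omega> k j)\<^sup>2)}"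
definition freq :: "real \<Rightarrow> nat \<Rightarrow> nat" where "freq \<mu> j = (SOME k. 1 \<le> k \<and> \<mu> = (\<omega> k j)\<^sup>2)"

lemma freq: "j \<in> J \<mu> \<Longrightarrow> 1 \<le> freq \<mu> j \<and> \<mu> = (\<omega> (freq \<mu> j) j)\<^sup>2"
  unfolding J_def freq_def by (rule someI_ex) auto

lemma \<omega>_le_iff:
  assumes "1 \<le> j" "0 < x"
  shows "(\<omega> k j)\<^sup>2 \<le> x \<longleftrightarrow> real k \<le> l j * sqrt x / pi"
proof -
  have "0 \<le> \<omega> k j" using l_positive[OF assms(1)] by (simp add: \<omega>_def)
  then have "(\<omega> k j)\<^sup>2 \<le> x \<longleftrightarrow> \<omega> k j \<le> sqrt x"
    using real_le_rsqrt real_sqrt_le_iff[of "(\<omega> k j)\<^sup>2" x] by auto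
  also have "\<dots> \<longleftrightarrow> real k \<le> l j * sqrt x / pi"
    using l_positive[OF assms(1)] by (simp add: \<omega>_def field_simps)
  finally show ?thesis .
qed

lemma le_m_of_\<omega>_le:
  assumes "1 \<le> j" "1 \<le> k" "0 < x" "(\<omega> k j)\<^sup>2 \<le> x"
  shows "j \<le> m (pi / sqrt x)"
proof -
  have "1 \<le> real k" using assms(2) by simp
  also have "\<dots> \<le> l j * sqrt x / pi" using assms \<omega>_le_iff[of j x k] by simp
  finally have "1 \<le> l j * sqrt x / pi" .
  then have "pi / sqrt x \<le> l j" using assms(3) by (simp add: field_simps)
  then show ?thesis using m_iff[of "pi / sqrt x" j] assms by simp
qed

lemma finite_J: "finite (J \<mu>)"
proof (cases "J \<mu> = {}")
  case False
  then obtain j k where jk: "1 \<le> j" "1 \<le> k" "\<mu> = (\<omega> k j)\<^sup>2" unfolding J_def by auto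
  then have "0 < \<mu>" using \<omega>_pos[of j k] by simp
  have "J \<mu> \<subseteq> {..m (pi / sqrt \<mu>)}"
  proof
    fix i assume "i \<in> J \<mu>"
    then obtain k where "1 \<le> i" "1 \<le> k" "\<mu> = (\<omega> k i)\<^sup>2" unfolding J_def by auto
    then show "i \<in> {..m (pi / sqrt \<mu>)}" using le_m_of_\<omega>_le[of i k \<mu>] \<open>0 < \<mu>\<close> by simp
  qed
  then show ?thesis by (rule finite_subset) simp
qed simp

lemma e_other:
  assumes "1 \<le> i" "1 \<le> j" "i \<noteq> j" "x \<in> I j"
  shows "e k i x = 0"
  using disj[OF assms(1-3)] assms(4) by (auto simp: e_def I_def indicator_def)

text \<open>The basis has one sine per component in \<open>J \<mu>\<close>. Their supports are
  disjoint, so on each component a linear combination has at most one nonzero term and independence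
  and spanning are checked there.\<close>

lemma has_dim_eigenspace: "has_dim_AE \<Omega> (eigenspace \<Omega> \<mu>) (card (J \<mu>))"
proof -
  obtain \<sigma> where \<sigma>: "bij_betw \<sigma> {..<card (J \<mu>)} (J \<mu>)"
    using ex_bij_betw_nat_finite[OF finite_J, of \<mu>] by (auto simp: lessThan_atLeast0)
  have \<sigma>J: "\<sigma> i \<in> J \<mu>" if "i < card (J \<mu>)" for i using bij_betw_apply[OF \<sigma>] that by auto
  have J1: "1 \<le> j" if "j \<in> J \<mu>" for j using that by (simp add: J_def)
  define b where "b i = e (freq \<mu> (\<sigma> i)) (\<sigma> i)" for i
  have sum1: "(\<Sum>i<card (J \<mu>). a i * b i x) = a i0 * s (freq \<mu> (\<sigma> i0)) (\<sigma> i0) x"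
    if i0: "i0 < card (J \<mu>)" and x: "x \<in> I (\<sigma> i0)" for a :: "nat \<Rightarrow> real" and i0 x
  proof -
    have "b i x = 0" if "i \<in> {..<card (J \<mu>)} - {i0}" for i
    proof -
      have "\<sigma> i \<noteq> \<sigma> i0" using \<sigma> that i0 by (auto simp: bij_betw_def inj_on_def)
      then show ?thesis unfolding b_def using that x by (intro e_other[OF J1[OF \<sigma>J] J1[OF \<sigma>J[OF i0]]]) auto
    qed
    then have "(\<Sum>i<card (J \<mu>). a i * b i x) = a i0 * b i0 x"
      using i0 by (subst sum.remove[of _ i0]) auto
    then show ?thesis using x by (simp add: b_def e_def)
  qed
  show ?thesis unfolding has_dim_AE_def
  proof (intro exI[of _ b] conjI allI impI ballI)
    fix i assume "i < card (J \<mu>)"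
    then show "b i \<in> eigenspace \<Omega> \<mu>"
      using e_in_eigenspace[OF J1[OF \<sigma>J], of i "freq \<mu> (\<sigma> i)"] freq[OF \<sigma>J, of i] by (simp add: b_def)
  next
    fix a :: "nat \<Rightarrow> real" and i
    assume AE: "AE x\<in>\<Omega> in lebesgue. (\<Sum>i<card (J \<mu>). a i * b i x) = 0" and i: "i < card (J \<mu>)"
    show "a i = 0"
    proof (rule ccontr)
      assume "a i \<noteq> 0"
      from AE have "AE x\<in>I (\<sigma> i) in lebesgue. s (freq \<mu> (\<sigma> i)) (\<sigma> i) x = 0"
      proof eventually_elim
        case (elim x)
        then show ?case using sum1[OF i, of x a] I_sub[OF J1[OF \<sigma>J[OF i]]] \<open>a i \<noteq> 0\<close> by auto
      qed
      then show False using not_AE_s_eq_0[OF J1[OF \<sigma>J[OF i]]] freq[OF \<sigma>J[OF i]] by blast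
    qed
  next
    fix u assume u: "u \<in> eigenspace \<Omega> \<mu>"
    have "\<forall>i\<in>{..<card (J \<mu>)}. \<exists>A. AE x\<in>I (\<sigma> i) in lebesgue. u x = A * s (freq \<mu> (\<sigma> i)) (\<sigma> i) x"
    proof
      fix i assume "i \<in> {..<card (J \<mu>)}"
      then have "\<sigma> i \<in> J \<mu>" by (simp add: \<sigma>J)
      then show "\<exists>A. AE x\<in>I (\<sigma> i) in lebesgue. u x = A * s (freq \<mu> (\<sigma> i)) (\<sigma> i) x"
        using eigenspace_on_I[OF u J1] freq by blast
    qed
    from bchoice[OF this] obtain a
      where a: "\<And>i. i < card (J \<mu>) \<Longrightarrow> AE x\<in>I (\<sigma> i) in lebesgue. u x = a i * s (freq \<mu> (\<sigma> i)) (\<sigma> i) x"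
      by auto
    have "AE x\<in>I j in lebesgue. u x = (\<Sum>i<card (J \<mu>). a i * b i x)" if j: "1 \<le> j" for j
    proof (cases "j \<in> J \<mu>")
      case True
      then obtain i where i: "i < card (J \<mu>)" "j = \<sigma> i" using \<sigma> by (auto simp: bij_betw_def)
      from a[OF i(1)] show ?thesis unfolding i(2)
        by eventually_elim (simp add: sum1[OF i(1)])
    next
      case False
      have "AE x\<in>I j in lebesgue. u x = 0"
        by (rule eigenspace_on_I_eq_0[OF u j]) (use False j in \<open>auto simp: J_def\<close>)
      then show ?thesis
      proof eventually_elim
        case (elim x)
        have "b i x = 0" if "x \<in> I j" "i < card (J \<mu>)" for i
          unfolding b_def using that \<sigma>J False j by (intro e_other[OF J1]) auto
        then show ?case using elim by simp
      qed
    qed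
    \<comment> \<open>There are countably many components, so the exceptional null sets may be
      united.\<close>
    then have "AE x in lebesgue. \<forall>j. 1 \<le> j \<longrightarrow> x \<in> I j \<longrightarrow> u x = (\<Sum>i<card (J \<mu>). a i * b i x)"
      by (simp add: AE_all_countable)
    then have "AE x\<in>\<Omega> in lebesgue. u x = (\<Sum>i<card (J \<mu>). a i * b i x)"
    proof eventually_elim
      case (elim x)
      then show ?case by (subst \<Omega>_eq) (auto simp: I_def)
    qed
    then show "\<exists>c. AE x\<in>\<Omega> in lebesgue. u x = (\<Sum>i<card (J \<mu>). c i * b i x)" by blast
  qed
qed

lemma dirichlet_eigenvalue_iff: "dirichlet_eigenvalue \<Omega> \<mu> \<longleftrightarrow> J \<mu> \<noteq> {}"
proof
  assume ev: "dirichlet_eigenvalue \<Omega> \<mu>"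
  show "J \<mu> \<noteq> {}"
  proof
    assume "J \<mu> = {}"
    then have "has_dim_AE \<Omega> (eigenspace \<Omega> \<mu>) 0" using has_dim_eigenspace[of \<mu>] by simp
    then have "\<forall>u\<in>eigenspace \<Omega> \<mu>. AE x\<in>\<Omega> in lebesgue. u x = 0"
      unfolding has_dim_AE_def by simp
    then show False using ev unfolding dirichlet_eigenvalue_def by blast
  qed
next
  assume "J \<mu> \<noteq> {}"
  then obtain j k where jk: "1 \<le> j" "1 \<le> k" "\<mu> = (\<omega> k j)\<^sup>2" unfolding J_def by auto
  have "\<not> (AE x\<in>\<Omega> in lebesgue. e k j x = 0)"
  proof
    assume "AE x\<in>\<Omega> in lebesgue. e k j x = 0"
    then have "AE x\<in>I j in lebesgue. s k j x = 0"
      by eventually_elim (use I_sub[OF jk(1)] in \<open>auto simp: e_def\<close>)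
    then show False using not_AE_s_eq_0[OF jk(1,2)] by blast
  qed
  then show "dirichlet_eigenvalue \<Omega> \<mu>"
    unfolding dirichlet_eigenvalue_def using e_in_eigenspace[OF jk(1), of k] jk(3) by blast
qed

text \<open>Double counting of the pairs \<open>(j, k)\<close> with
  \<open>(\<omega> k j)\<^sup>2 \<le> x\<close>: grouped by eigenvalue they give the multiplicities,
  grouped by component the integer parts. Components beyond \<open>m (pi / sqrt x)\<close> are too
  short to contribute.\<close>

lemma counting_function_eq:
  assumes sp: "dirichlet_spectrum \<Omega> ev" and x: "0 < x"
  shows "counting_function ev x = (\<Sum>j=1..m (pi / sqrt x). real (nat \<lfloor>l j * (sqrt x / pi)\<rfloor>))"
proof -
  define R where "R = m (pi / sqrt x)"
  define N where "N j = nat \<lfloor>l j * (sqrt x / pi)\<rfloor>" for j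
  define S where "S = Sigma {1..R} (\<lambda>j. {1..N j})"
  define f where "f p = (\<omega> (snd p) (fst p))\<^sup>2" for p
  have S_iff: "(j, k) \<in> S \<longleftrightarrow> 1 \<le> j \<and> 1 \<le> k \<and> (\<omega> k j)\<^sup>2 \<le> x" for j k
  proof (cases "1 \<le> j \<and> 1 \<le> k")
    case True
    have "k \<le> N j \<longleftrightarrow> int k \<le> \<lfloor>l j * (sqrt x / pi)\<rfloor>" 
      unfolding N_def using True by (cases "0 \<le> \<lfloor>l j * (sqrt x / pi)\<rfloor>") (auto simp: le_nat_iff)
    then have "k \<le> N j \<longleftrightarrow> real k \<le> l j * sqrt x / pi" by (simp add: le_floor_iff)
    then have "k \<le> N j \<longleftrightarrow> (\<omega> k j)\<^sup>2 \<le> x" using \<omega>_le_iff[of j x k] True x by simp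
    then show ?thesis using True le_m_of_\<omega>_le[of j k x] x by (auto simp: S_def R_def)
  qed (auto simp: S_def)
  have finS: "finite S" by (simp add: S_def)
  have mult: "card {i. 1 \<le> i \<and> ev i = \<mu>} = card (J \<mu>)" "finite {i. 1 \<le> i \<and> ev i = \<mu>}" if "J \<mu> \<noteq> {}" for \<mu>
  proof -
    have "finite {i. 1 \<le> i \<and> ev i = \<mu>} \<and> has_dim_AE \<Omega> (eigenspace \<Omega> \<mu>) (card {i. 1 \<le> i \<and> ev i = \<mu>})"
      using sp that unfolding dirichlet_spectrum_def dirichlet_eigenvalue_iff by blast
    then show "card {i. 1 \<le> i \<and> ev i = \<mu>} = card (J \<mu>)" "finite {i. 1 \<le> i \<and> ev i = \<mu>}"
      using has_dim_AE_unique[OF _ has_dim_eigenspace] by blast+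
  qed
  have JfS: "J \<mu> \<noteq> {}" if "\<mu> \<in> f ` S" for \<mu>
  proof -
    from that obtain j k where "(j, k) \<in> S" "\<mu> = (\<omega> k j)\<^sup>2" by (auto simp: f_def)
    then have "j \<in> J \<mu>" using S_iff unfolding J_def by blast
    then show ?thesis by blast
  qed
  \<comment> \<open>Within a fibre the component determines \<open>k\<close>, so the first
    projection is a bijection onto \<open>J \<mu>\<close>.\<close>
  have fib: "card {p \<in> S. f p = \<mu>} = card (J \<mu>)" if \<mu>: "\<mu> \<in> f ` S" for \<mu>
  proof -
    have "\<mu> \<le> x" using \<mu> S_iff by (auto simp: f_def)
    have "inj_on fst {p \<in> S. f p = \<mu>}"
    proof (rule inj_onI, clarsimp simp: f_def)
      fix j k k' assume "(j, k) \<in> S" "(j, k') \<in> S" and eq: "(\<omega> k' j)\<^sup>2 = (\<omega> k j)\<^sup>2"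
      then have "1 \<le> j" using S_iff by blast
      then have "0 \<le> \<omega> k j" "0 \<le> \<omega> k' j" using l_positive[of j] by (auto simp: \<omega>_def)
      then have "\<omega> k j = \<omega> k' j" using eq by (simp add: power2_eq_iff_nonneg)
      then show "k = k'" using l_positive[OF \<open>1 \<le> j\<close>] by (simp add: \<omega>_def)
    qed
    moreover have "fst ` {p \<in> S. f p = \<mu>} = J \<mu>"
      using S_iff \<open>\<mu> \<le> x\<close> by (force simp: J_def f_def image_iff)
    ultimately show ?thesis by (metis card_image)
  qed
  have "{i. 1 \<le> i \<and> ev i \<le> x} = (\<Union>\<mu>\<in>f ` S. {i. 1 \<le> i \<and> ev i = \<mu>})"
  proof (intro equalityI subsetI)
    fix i assume i: "i \<in> {i. 1 \<le> i \<and> ev i \<le> x}"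
    then have "J (ev i) \<noteq> {}" using sp unfolding dirichlet_spectrum_def dirichlet_eigenvalue_iff by auto
    then obtain j k where "1 \<le> j" "1 \<le> k" "ev i = (\<omega> k j)\<^sup>2" unfolding J_def by auto
    then have "(j, k) \<in> S" "ev i = f (j, k)" using S_iff i by (auto simp: f_def)
    then show "i \<in> (\<Union>\<mu>\<in>f ` S. {i. 1 \<le> i \<and> ev i = \<mu>})" using i by auto
  next
    fix i assume "i \<in> (\<Union>\<mu>\<in>f ` S. {i. 1 \<le> i \<and> ev i = \<mu>})"
    then show "i \<in> {i. 1 \<le> i \<and> ev i \<le> x}" using S_iff by (auto simp: f_def)
  qed
  then have "card {i. 1 \<le> i \<and> ev i \<le> x} = card (\<Union>\<mu>\<in>f ` S. {i. 1 \<le> i \<and> ev i = \<mu>})" by simp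
  also have "\<dots> = (\<Sum>\<mu>\<in>f ` S. card {i. 1 \<le> i \<and> ev i = \<mu>})"
    by (rule card_UN_disjoint) (use finS mult(2) JfS in auto)
  also have "\<dots> = (\<Sum>\<mu>\<in>f ` S. card {p \<in> S. f p = \<mu>})"
    using fib mult(1) JfS by (intro sum.cong) auto
  also have "\<dots> = card S"
    using sum.image_gen[OF finS, of "\<lambda>_. 1 :: nat" f] by simp
  also have "\<dots> = (\<Sum>j=1..R. N j)" by (simp add: S_def)
  finally show ?thesis by (simp add: counting_function_def R_def N_def)
qed

lemma weyl_minus_counting:
  assumes "dirichlet_spectrum \<Omega> ev" and x: "0 < x"
  shows "weyl_term \<Omega> x - counting_function ev x = G (sqrt x / pi)"
proof -
  define y where "y = sqrt x / pi"
  have y: "0 < y" using x by (simp add: y_def)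
  define N where "N j = real (nat \<lfloor>l j * y\<rfloor>)" for j
  have N0: "N j = 0" if "1 \<le> j" "m (pi / sqrt x) < j" for j
  proof -
    have "l j < pi / sqrt x" using m_iff[of "pi / sqrt x" j] that x by auto
    then have "l j * y < 1" using x by (simp add: y_def field_simps)
    then have "\<lfloor>l j * y\<rfloor> \<le> 0" by (simp add: floor_le_iff)
    then show ?thesis by (simp add: N_def)
  qed
  have "(\<lambda>j. N (Suc j)) sums (\<Sum>j<m (pi / sqrt x). N (Suc j))"
    by (rule sums_finite) (use N0 in auto)
  also have "(\<Sum>j<m (pi / sqrt x). N (Suc j)) = (\<Sum>j=1..m (pi / sqrt x). N j)"
    by (rule sum.reindex_bij_witness[of _ "\<lambda>k. k - 1" Suc]) auto
  also have "\<dots> = counting_function ev x"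
    by (simp add: counting_function_eq[OF assms] N_def y_def)
  finally have "(\<lambda>j. l (Suc j) * y - N (Suc j)) sums (measure lebesgue \<Omega> * y - counting_function ev x)"
    by (intro sums_diff sums_mult2 l_sums)
  moreover have "l (Suc j) * y - N (Suc j) = frac (l (Suc j) * y)" for j
    using l_positive[of "Suc j"] y by (simp add: N_def frac_def)
  ultimately have "measure lebesgue \<Omega> * y - counting_function ev x = G y"
    using G_sums[OF y] sums_unique2 by auto
  then show ?thesis by (simp add: weyl_term_def y_def)
qed

end

section \<open>Contents and the main theorem\<close>

lemma asymp_bounds_trans:
  assumes "asymp_bounds A u v" "asymp_bounds A v w"
  shows "asymp_bounds A u w"
proof -
  obtain c C where c: "0 < c" "0 < C" and uv: "\<forall>\<^sub>F y in A. c * u y \<le> v y \<and> v y \<le> C * u y"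
    using assms(1) unfolding asymp_bounds_def by blast
  obtain b B where b: "0 < b" "0 < B" and vw: "\<forall>\<^sub>F y in A. b * v y \<le> w y \<and> w y \<le> B * v y"
    using assms(2) unfolding asymp_bounds_def by blast
  from uv vw have "\<forall>\<^sub>F y in A. b * c * u y \<le> w y \<and> w y \<le> B * C * u y"
  proof eventually_elim
    case (elim y)
    then have "b * (c * u y) \<le> b * v y" "B * v y \<le> B * (C * u y)" using b by auto
    then show ?case using elim by (simp add: mult.assoc)
  qed
  then show ?thesis unfolding asymp_bounds_def using b c
    by (intro exI[of _ "b * c"] exI[of _ "B * C"]) auto
qed

lemma asymp_bounds_tendsto:
  assumes "((\<lambda>y. v y / u y) \<longlongrightarrow> L) A" "0 < L" "\<forall>\<^sub>F y in A. 0 < u y"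
  shows "asymp_bounds A u v"
proof -
  have "L / 2 < L" "L < 2 * L" using assms(2) by auto
  from order_tendstoD(1)[OF assms(1) this(1)] order_tendstoD(2)[OF assms(1) this(2)] assms(3)
  have "\<forall>\<^sub>F y in A. L / 2 * u y \<le> v y \<and> v y \<le> 2 * L * u y"
    by eventually_elim (auto simp: field_simps)
  then show ?thesis unfolding asymp_bounds_def using assms(2)
    by (intro exI[of _ "L / 2"] exI[of _ "2 * L"]) auto
qed

lemma asymp_bounds_cong:
  assumes "\<forall>\<^sub>F y in A. u y = u' y" "\<forall>\<^sub>F y in A. v y = v' y"
  shows "asymp_bounds A u v \<longleftrightarrow> asymp_bounds A u' v'"
proof -
  have "(\<forall>\<^sub>F y in A. c * u y \<le> v y \<and> v y \<le> C * u y) \<longleftrightarrow> (\<forall>\<^sub>F y in A. c * u' y \<le> v' y \<and> v' y \<le> C * u' y)" for c C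
    by (rule eventually_cong[OF eventually_conj[OF assms]]) auto
  then show ?thesis unfolding asymp_bounds_def by simp
qed

lemma asymp_bounds_ratio_iff:
  assumes "\<forall>\<^sub>F y in A. 0 < v y"
  shows "asymp_bounds A (\<lambda>_. 1) (\<lambda>y. u y / v y) \<longleftrightarrow> asymp_bounds A v u"
proof -
  have "(\<forall>\<^sub>F y in A. c * 1 \<le> u y / v y \<and> u y / v y \<le> C * 1) \<longleftrightarrow> (\<forall>\<^sub>F y in A. c * v y \<le> u y \<and> u y \<le> C * v y)" for c C
    by (rule eventually_cong[OF assms]) (auto simp: field_simps)
  then show ?thesis unfolding asymp_bounds_def by simp
qed

lemma asymp_bounds_const_mult:
  assumes "0 < a"
  shows "asymp_bounds A u (\<lambda>y. a * v y) \<longleftrightarrow> asymp_bounds A u v"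
proof -
  have "asymp_bounds A v (\<lambda>y. a * v y)" unfolding asymp_bounds_def
    using assms by (intro exI[of _ a]) auto
  then show ?thesis using asymp_bounds_trans asymp_bounds_sym by blast
qed

section \<open>Changes of variable in asymptotic statements\<close>

lemma eventually_scale_iff:
  assumes "0 < a"
  shows "(\<forall>\<^sub>F t in at_right (0::real). P (a * t)) \<longleftrightarrow> (\<forall>\<^sub>F t in at_right 0. P t)"
proof
  assume "\<forall>\<^sub>F t in at_right 0. P (a * t)"
  from eventually_scale[OF this, of "1 / a"] show "\<forall>\<^sub>F t in at_right 0. P t" using assms by simp
qed (rule eventually_scale[OF _ assms])

lemma asymp_bounds_scale_iff:
  assumes "0 < a"
  shows "asymp_bounds (at_right (0::real)) (\<lambda>t. u (a * t)) (\<lambda>t. v (a * t)) \<longleftrightarrow> asymp_bounds (at_right 0) u v"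
  unfolding asymp_bounds_def
  using eventually_scale_iff[OF assms, of "\<lambda>t. c * u t \<le> v t \<and> v t \<le> C * u t" for c C] by simp

lemma tendsto_scale_iff:
  assumes "0 < a"
  shows "((\<lambda>t. u (a * t)) \<longlongrightarrow> L) (at_right (0::real)) \<longleftrightarrow> (u \<longlongrightarrow> L) (at_right 0)"
  unfolding tendsto_def using eventually_scale_iff[OF assms, of "\<lambda>t. u t \<in> S" for S] by simp

text \<open>The substitution \<open>t = pi / sqrt x\<close>, with inverse
  \<open>x = (pi / t)\<^sup>2\<close>, turns the spectral remainder into
  \<open>G (1 / t)\<close>.\<close>

lemma at_top_sqrt_iff_at_right:
  "(\<forall>\<^sub>F x in at_top. P (pi / sqrt x)) \<longleftrightarrow> (\<forall>\<^sub>F t in at_right (0::real). P t)"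
proof
  assume "\<forall>\<^sub>F t in at_right (0::real). P t"
  moreover have "filterlim (\<lambda>x. pi / sqrt x) (at_right 0) at_top"
    unfolding filterlim_at
    by (intro conjI tendsto_divide_0[OF tendsto_const] filterlim_at_top_imp_at_infinity sqrt_at_top
        eventually_mono[OF eventually_gt_at_top[of 0]]) auto
  ultimately show "\<forall>\<^sub>F x in at_top. P (pi / sqrt x)" by (rule eventually_compose_filterlim)
next
  assume P: "\<forall>\<^sub>F x in at_top. P (pi / sqrt x)"
  have "filterlim (\<lambda>t. (pi * inverse t)\<^sup>2) at_top (at_right (0::real))"
    by (intro filterlim_pow_at_top filterlim_tendsto_pos_mult_at_top[OF tendsto_const]
        filterlim_inverse_at_top_right) auto
  from eventually_compose_filterlim[OF P this] have "\<forall>\<^sub>F t in at_right 0. P (pi / sqrt ((pi * inverse t)\<^sup>2))" .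
  then show "\<forall>\<^sub>F t in at_right 0. P t"
    using eventually_at_right_less[of "0::real"]
  proof eventually_elim
    case (elim t)
    have "sqrt ((pi * inverse t)\<^sup>2) = pi * inverse t"
      using elim(2) by (subst real_sqrt_abs) simp
    then have "pi / sqrt ((pi * inverse t)\<^sup>2) = t" using elim(2) by (simp only:) (simp add: field_simps)
    then show ?case using elim(1) by (simp only:)
  qed
qed

section \<open>Contents as limits of real-valued ratios\<close>

context
  fixes A :: "'a filter" and f :: "'a \<Rightarrow> ereal" and q :: "'a \<Rightarrow> real"
  assumes A: "A \<noteq> bot" and f: "\<forall>\<^sub>F x in A. f x = ereal (q x)"
begin

lemma Liminf_Limsup_bounds_iff:
  "0 < Liminf A f \<and> Liminf A f \<le> Limsup A f \<and> Limsup A f < \<infinity> \<longleftrightarrow> asymp_bounds A (\<lambda>_. 1) q"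
proof
  assume *: "0 < Liminf A f \<and> Liminf A f \<le> Limsup A f \<and> Limsup A f < \<infinity>"
  then obtain c where c: "0 < ereal c" "ereal c < Liminf A f" using ereal_dense2 by blast
  obtain C where C: "Limsup A f < ereal C" using * ereal_dense2 by blast
  from less_LiminfD[OF c(2)] Limsup_lessD[OF C] f
  have "\<forall>\<^sub>F x in A. c * 1 \<le> q x \<and> q x \<le> max C 1 * 1" by eventually_elim (auto simp: less_imp_le)
  then show "asymp_bounds A (\<lambda>_. 1) q" unfolding asymp_bounds_def using c(1)
    by (intro exI[of _ c] exI[of _ "max C 1"]) auto
next
  assume "asymp_bounds A (\<lambda>_. 1) q"
  then obtain c C where c: "0 < c" and ev: "\<forall>\<^sub>F x in A. c * 1 \<le> q x \<and> q x \<le> C * 1"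
    unfolding asymp_bounds_def by blast
  from ev f have "\<forall>\<^sub>F x in A. ereal c \<le> f x" by eventually_elim auto
  then have "ereal c \<le> Liminf A f" by (rule Liminf_bounded)
  moreover from ev f have "\<forall>\<^sub>F x in A. f x \<le> ereal C" by eventually_elim auto
  then have "Limsup A f \<le> ereal C" by (rule Limsup_bounded)
  moreover have "0 < ereal c" "ereal C < \<infinity>" using c by auto
  ultimately show "0 < Liminf A f \<and> Liminf A f \<le> Limsup A f \<and> Limsup A f < \<infinity>"
    using Liminf_le_Limsup[OF A, of f] by (meson le_less_trans less_le_trans)
qed

lemma Liminf_Limsup_content:
  assumes "(q \<longlongrightarrow> M) A"
  shows "Liminf A f = ereal M" "Limsup A f = ereal M" "(THE m. Liminf A f = m \<and> Limsup A f = m) = ereal M"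
proof -
  have "((\<lambda>x. ereal (q x)) \<longlongrightarrow> ereal M) A" using assms by simp
  moreover have "\<forall>\<^sub>F x in A. ereal (q x) = f x" using f by eventually_elim simp
  ultimately have "(f \<longlongrightarrow> ereal M) A" by (rule Lim_transform_eventually)
  then show 1: "Liminf A f = ereal M" "Limsup A f = ereal M"
    using tendsto_iff_Liminf_eq_Limsup[OF A] by auto
  then show "(THE m. Liminf A f = m \<and> Limsup A f = m) = ereal M" by auto
qed

lemma Liminf_Limsup_measurable_iff:
  "Liminf A f = Limsup A f \<and> 0 < (THE m. Liminf A f = m \<and> Limsup A f = m)
      \<and> (THE m. Liminf A f = m \<and> Limsup A f = m) < \<infinity> \<longleftrightarrow> (\<exists>M>0. (q \<longlongrightarrow> M) A)"
proof
  assume *: "Liminf A f = Limsup A f \<and> 0 < (THE m. Liminf A f = m \<and> Limsup A f = m)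
      \<and> (THE m. Liminf A f = m \<and> Limsup A f = m) < \<infinity>"
  then have "(THE m. Liminf A f = m \<and> Limsup A f = m) = Limsup A f" by auto
  with * obtain M where M: "Limsup A f = ereal M" "0 < M"
    by (cases "Limsup A f") auto
  then have "(f \<longlongrightarrow> ereal M) A" using * tendsto_iff_Liminf_eq_Limsup[OF A] by auto
  then have "((\<lambda>x. ereal (q x)) \<longlongrightarrow> ereal M) A" by (rule Lim_transform_eventually[OF _ f])
  then show "\<exists>M>0. (q \<longlongrightarrow> M) A" using M by auto
next
  assume "\<exists>M>0. (q \<longlongrightarrow> M) A"
  then obtain M where M: "0 < M" "(q \<longlongrightarrow> M) A" by blast
  show "Liminf A f = Limsup A f \<and> 0 < (THE m. Liminf A f = m \<and> Limsup A f = m)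
      \<and> (THE m. Liminf A f = m \<and> Limsup A f = m) < \<infinity>"
    unfolding Liminf_Limsup_content[OF M(2)] using M(1) by auto
qed

end

text \<open>Positivity of \<open>h\<close> spreads from a neighbourhood of 0 to all of
  \<open>(0, \<delta>)\<close> by the increase of \<open>gauge_H h\<close>. The inverse exists for
  large arguments by the intermediate value theorem, as \<open>K\<close> tends to infinity at
  0.\<close>

lemma gauge_of_SR:
  assumes D: "0 < D" "D < 1" and h: "h \<in> SR (1 - D)"
    and \<delta>: "0 < \<delta>" and mono: "strict_mono_on {0<..<\<delta>} (gauge_H h)"
  shows "gauge D \<delta> h (gauge_g h \<delta>)"
proof -
  obtain y0 y1 h' where y1: "0 < y1" "ereal y1 < y0" and h_pos0: "\<And>y. 0 < y \<Longrightarrow> ereal y < y0 \<Longrightarrow> 0 < h y"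
    and h': "\<And>y. y \<in> {0<..y1} \<Longrightarrow> (h has_real_derivative h' y) (at y within {0<..y1})"
    and ratio: "\<And>t. 0 < t \<Longrightarrow> ((\<lambda>y. h (t * y) / h y) \<longlongrightarrow> t powr (1 - D)) (at_right 0)"
    using h unfolding SR_def by blast
  have h_pos1: "0 < h y" if "0 < y" "y \<le> y1" for y
    using that y1 by (intro h_pos0) (auto intro: le_less_trans[of _ "ereal y1"])
  have h_pos: "0 < h y" if y: "0 < y" "y < \<delta>" for y
  proof -
    \<comment> \<open>A point below \<open>y\<close> at which \<open>h\<close> is already known to
      be positive.\<close>
    define z where "z = min (y / 2) y1"
    have z: "0 < z" "z < y" "z \<le> y1" using y y1 by (auto simp: z_def)
    have "0 < gauge_H h z" using h_pos1[OF z(1,3)] z by (simp add: gauge_H_def)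
    also have "\<dots> < gauge_H h y" using mono z y by (intro strict_mono_onD[OF mono]) auto
    finally show ?thesis using y by (simp add: gauge_H_def zero_less_divide_iff)
  qed
  interpret gauge_function D \<delta> h
  proof
    fix x y :: real assume xy: "0 < x" "x < y" "y < \<delta>"
    then have "gauge_H h x < gauge_H h y" by (intro strict_mono_onD[OF mono]) auto
    then show "h y / y < h x / x" using h_pos[of x] h_pos[of y] xy by (simp add: gauge_H_def field_simps)
  qed (use D \<delta> h_pos ratio in auto)
  \<comment> \<open>Continuity is known only up to \<open>y1\<close>, so intermediate values are
    sought on \<open>[a, b]\<close> with \<open>b \<le> y1\<close>; arguments \<open>x > K b\<close>
    are those whose solution lies to the left of \<open>b\<close>.\<close>
  define b where "b = min y1 (\<delta> / 2)"
  have b: "0 < b" "b \<le> y1" "b < \<delta>" using y1 \<delta> by (auto simp: b_def)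
  have inj: "inj_on (gauge_H h) {0<..<\<delta>}" using mono by (rule strict_mono_on_imp_inj_on)
  have "\<forall>\<^sub>F x in at_top. 0 < gauge_g h \<delta> x \<and> gauge_g h \<delta> x < \<delta> \<and> h (gauge_g h \<delta> x) / gauge_g h \<delta> x = x"
    using eventually_gt_at_top[of "max 1 (K b)"]
  proof eventually_elim
    case (elim x)
    have ev: "\<forall>\<^sub>F y in at_right 0. x < K y" using K_at_top by (simp add: filterlim_at_top_dense)
    have "\<forall>\<^sub>F y in at_right 0. 0 < y \<and> y < b" using eventually_at_right_real[OF b(1)] by eventually_elim auto
    from eventually_happens[OF eventually_conj[OF ev this]] obtain a where a: "x < K a" "0 < a" "a < b"
      by (auto simp: trivial_limit_at_right_real)
    have "continuous_on {0<..y1} h"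
      by (rule DERIV_continuous_on[OF h'])
    then have "continuous_on {a..b} h" using a b by (auto intro: continuous_on_subset)
    moreover have "h y \<noteq> 0" if "y \<in> {a..b}" for y using h_pos[of y] that a b by auto
    ultimately have "continuous_on {a..b} (gauge_H h)"
      unfolding gauge_H_def[abs_def] by (intro continuous_intros) auto
    moreover have "gauge_H h a \<le> 1 / x" "1 / x \<le> gauge_H h b"
      using a b elim h_pos[of a] h_pos[of b] by (auto simp: gauge_H_def K_def field_simps)
    ultimately obtain y where y: "a \<le> y" "y \<le> b" "gauge_H h y = 1 / x"
      using IVT'[of "gauge_H h" a "1 / x" b] a by auto
    then have mem: "1 / x \<in> gauge_H h ` {0<..<\<delta>}" using a b by (intro image_eqI[of _ _ y]) auto
    define G where "G = gauge_g h \<delta> x"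
    have "gauge_H h G = 1 / x" unfolding G_def gauge_g_def by (rule f_the_inv_into_f[OF inj mem])
    moreover have "G \<in> {0<..<\<delta>}" unfolding G_def gauge_g_def by (rule the_inv_into_into[OF inj mem order.refl])
    ultimately show ?case using h_pos[of G] elim unfolding G_def[symmetric] by (auto simp: gauge_H_def field_simps)
  qed
  then show ?thesis by (intro gauge.intro gauge_axioms.intro gauge_function_axioms)
qed

section \<open>Reduction of each assertion to the behaviour of \<open>n / K\<close>\<close>

locale gauged_domain = gauged_string D \<delta> h g l + real_string \<Omega> l \<alpha> \<beta>
  for D \<delta> :: real and h g :: "real \<Rightarrow> real" and l :: "nat \<Rightarrow> real" and \<Omega> :: "real set" and \<alpha> \<beta> :: "nat \<Rightarrow> real"
begin

lemma M_ratio_eq: "\<forall>\<^sub>F r in at_right 0. M_ratio \<Omega> h (frontier \<Omega>) r = ereal (W (2 * r) / h r)"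
  using ev_h_pos eventually_at_right_less[of "0::real"]
  by eventually_elim (simp add: M_ratio_def measure_parallel_set)

text \<open>The mismatch between \<open>W (2 * r)\<close> and \<open>h r\<close> costs only the
  bounded factor \<open>h (2 * r) / h r\<close>.\<close>

lemma M_bounds_iff:
  "0 < lower_M \<Omega> h (frontier \<Omega>) \<and> lower_M \<Omega> h (frontier \<Omega>) \<le> upper_M \<Omega> h (frontier \<Omega>)
    \<and> upper_M \<Omega> h (frontier \<Omega>) < \<infinity> \<longleftrightarrow> asymp_bounds (at_right 0) K n"
proof -
  have h2: "asymp_bounds (at_right 0) h (\<lambda>r. h (2 * r))"
    by (rule asymp_bounds_tendsto[OF h_ratio[of 2] _ ev_h_pos]) auto
  have "asymp_bounds (at_right 0) (\<lambda>_. 1) (\<lambda>r. W (2 * r) / h r) \<longleftrightarrow> asymp_bounds (at_right 0) h (\<lambda>r. W (2 * r))"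
    by (rule asymp_bounds_ratio_iff[OF ev_h_pos])
  also have "\<dots> \<longleftrightarrow> asymp_bounds (at_right 0) (\<lambda>r. h (2 * r)) (\<lambda>r. W (2 * r))"
    using asymp_bounds_trans[OF h2] asymp_bounds_trans[OF asymp_bounds_sym[OF h2]] by blast
  also have "\<dots> \<longleftrightarrow> asymp_bounds (at_right 0) h W" by (rule asymp_bounds_scale_iff) simp
  also have "\<dots> \<longleftrightarrow> asymp_bounds (at_right 0) K n" by (rule asymp_bounds_W_iff_n)
  finally show ?thesis
    unfolding lower_M_def upper_M_def using Liminf_Limsup_bounds_iff[OF _ M_ratio_eq] by simp
qed

text \<open>\<open>1 / (1 - D)\<close> comes from summing \<open>n\<close> to \<open>W\<close>,
  \<open>2 powr (1 - D)\<close> from the limit of \<open>h (2 * r) / h r\<close>.\<close>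

lemma tendsto_M_ratio_of_n:
  assumes "0 < \<kappa>" "((\<lambda>t. n t / K t) \<longlongrightarrow> \<kappa>) (at_right 0)"
  shows "((\<lambda>r. W (2 * r) / h r) \<longlongrightarrow> 2 powr (1 - D) * \<kappa> / (1 - D)) (at_right 0)"
  using h_ratio_W[OF tendsto_W_of_n[OF assms], of 2] by (simp add: mult.commute)

lemma tendsto_n_of_M_ratio:
  assumes M: "0 < M" and lim: "((\<lambda>r. W (2 * r) / h r) \<longlongrightarrow> M) (at_right 0)"
  shows "((\<lambda>t. n t / K t) \<longlongrightarrow> M / 2 powr (1 - D) * (1 - D)) (at_right 0)"
proof (rule tendsto_n_of_W)
  show "0 < M / 2 powr (1 - D)" using M by simp
  have "((\<lambda>r. W (2 * r) / h r / (h (2 * r) / h r)) \<longlongrightarrow> M / 2 powr (1 - D)) (at_right 0)"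
    by (intro tendsto_divide lim h_ratio) auto
  then have "((\<lambda>r. W (2 * r) / h (2 * r)) \<longlongrightarrow> M / 2 powr (1 - D)) (at_right 0)"
  proof (rule Lim_transform_eventually)
    show "\<forall>\<^sub>F r in at_right 0. W (2 * r) / h r / (h (2 * r) / h r) = W (2 * r) / h (2 * r)"
      using ev_h_pos by eventually_elim auto
  qed
  then show "((\<lambda>t. W t / h t) \<longlongrightarrow> M / 2 powr (1 - D)) (at_right 0)"
    using tendsto_scale_iff[of 2 "\<lambda>t. W t / h t"] by simp
qed

lemma minkowski_measurable_iff:
  "minkowski_measurable \<Omega> h (frontier \<Omega>) \<longleftrightarrow> (\<exists>\<kappa>>0. ((\<lambda>t. n t / K t) \<longlongrightarrow> \<kappa>) (at_right 0))"
proof -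
  have "minkowski_measurable \<Omega> h (frontier \<Omega>) \<longleftrightarrow> (\<exists>M>0. ((\<lambda>r. W (2 * r) / h r) \<longlongrightarrow> M) (at_right 0))"
    unfolding minkowski_measurable_def M_content_def lower_M_def upper_M_def
    by (rule Liminf_Limsup_measurable_iff[OF _ M_ratio_eq]) simp
  also have "\<dots> \<longleftrightarrow> (\<exists>\<kappa>>0. ((\<lambda>t. n t / K t) \<longlongrightarrow> \<kappa>) (at_right 0))"
  proof
    assume "\<exists>M>0. ((\<lambda>r. W (2 * r) / h r) \<longlongrightarrow> M) (at_right 0)"
    then obtain M where M: "0 < M" "((\<lambda>r. W (2 * r) / h r) \<longlongrightarrow> M) (at_right 0)" by blast
    have "0 < M / 2 powr (1 - D) * (1 - D)" using M(1) D by simp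
    with tendsto_n_of_M_ratio[OF M] show "\<exists>\<kappa>>0. ((\<lambda>t. n t / K t) \<longlongrightarrow> \<kappa>) (at_right 0)" by blast
  next
    assume "\<exists>\<kappa>>0. ((\<lambda>t. n t / K t) \<longlongrightarrow> \<kappa>) (at_right 0)"
    then obtain \<kappa> where \<kappa>: "0 < \<kappa>" "((\<lambda>t. n t / K t) \<longlongrightarrow> \<kappa>) (at_right 0)" by blast
    have "0 < 2 powr (1 - D) * \<kappa> / (1 - D)" using \<kappa>(1) D by simp
    with tendsto_M_ratio_of_n[OF \<kappa>] show "\<exists>M>0. ((\<lambda>r. W (2 * r) / h r) \<longlongrightarrow> M) (at_right 0)" by blast
  qed
  finally show ?thesis .
qed

lemma M_content_eq:
  assumes "0 < \<kappa>" "((\<lambda>t. n t / K t) \<longlongrightarrow> \<kappa>) (at_right 0)"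
  shows "M_content \<Omega> h (frontier \<Omega>) = ereal (2 powr (1 - D) * \<kappa> / (1 - D))"
  unfolding M_content_def lower_M_def upper_M_def
  by (rule Liminf_Limsup_content(3)[OF _ M_ratio_eq tendsto_M_ratio_of_n[OF assms]]) simp

lemma asymp_equiv_l_iff:
  assumes "0 < L"
  shows "l \<sim>[at_top] (\<lambda>j. L * g (real j)) \<longleftrightarrow> ((\<lambda>t. n t / K t) \<longlongrightarrow> L powr D) (at_right 0)"
proof -
  have "l \<sim>[at_top] (\<lambda>j. L * g (real j)) \<longleftrightarrow> (\<lambda>j. l j / g (real j) / L) \<longlonglongrightarrow> 1"
    unfolding asymp_equiv_def
    by (rule tendsto_cong, rule eventually_mono[OF g_seq]) (use assms in \<open>auto simp: field_simps\<close>)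
  also have "\<dots> \<longleftrightarrow> (\<lambda>j. l j / g (real j)) \<longlonglongrightarrow> L"
  proof
    assume "(\<lambda>j. l j / g (real j) / L) \<longlonglongrightarrow> 1"
    from tendsto_mult[OF this tendsto_const[of L]] show "(\<lambda>j. l j / g (real j)) \<longlonglongrightarrow> L" using assms by simp
  next
    assume "(\<lambda>j. l j / g (real j)) \<longlonglongrightarrow> L"
    from tendsto_divide[OF this tendsto_const[of L]] show "(\<lambda>j. l j / g (real j) / L) \<longlonglongrightarrow> 1" using assms by simp
  qed
  also note tendsto_l_iff_n[OF assms]
  finally show ?thesis .
qed

lemma ex_asymp_equiv_l_iff:
  "(\<exists>L>0. l \<sim>[at_top] (\<lambda>j. L * g (real j))) \<longleftrightarrow> (\<exists>\<kappa>>0. ((\<lambda>t. n t / K t) \<longlongrightarrow> \<kappa>) (at_right 0))"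
proof
  assume "\<exists>L>0. l \<sim>[at_top] (\<lambda>j. L * g (real j))"
  then obtain L where "0 < L" "((\<lambda>t. n t / K t) \<longlongrightarrow> L powr D) (at_right 0)" using asymp_equiv_l_iff by blast
  then show "\<exists>\<kappa>>0. ((\<lambda>t. n t / K t) \<longlongrightarrow> \<kappa>) (at_right 0)" by (intro exI[of _ "L powr D"]) auto
next
  assume "\<exists>\<kappa>>0. ((\<lambda>t. n t / K t) \<longlongrightarrow> \<kappa>) (at_right 0)"
  then obtain \<kappa> where \<kappa>: "0 < \<kappa>" "((\<lambda>t. n t / K t) \<longlongrightarrow> \<kappa>) (at_right 0)" by blast
  have "\<kappa> = (\<kappa> powr (1 / D)) powr D" using \<kappa>(1) D by (simp add: powr_powr)
  then show "\<exists>L>0. l \<sim>[at_top] (\<lambda>j. L * g (real j))"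
    using \<kappa> asymp_equiv_l_iff[of "\<kappa> powr (1 / D)"] by (intro exI[of _ "\<kappa> powr (1 / D)"]) auto
qed

section \<open>Surface contents under smooth variation\<close>

context
  assumes smooth: "smoothly_varying (1 - D) h"
begin

text \<open>Smooth variation read against \<open>K\<close>: the derivative of the gauge is
  asymptotic to \<open>(1 - D) * K\<close>, so normalizing by it is normalizing by
  \<open>K\<close>.\<close>

lemma deriv_h_ratio: "((\<lambda>r. deriv h r / K r) \<longlongrightarrow> 1 - D) (at_right 0)"
proof -
  have "((\<lambda>y. y * deriv h y / h y) \<longlongrightarrow> 1 - D) (at_right 0)" using smooth by (simp add: smoothly_varying_def)
  moreover have "y * deriv h y / h y = deriv h y / K y" for y by (simp add: K_def)
  ultimately show ?thesis by simp
qed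

lemma ev_deriv_h_pos: "\<forall>\<^sub>F r in at_right 0. 0 < deriv h r"
proof -
  have "0 < 1 - D" using D by simp
  from order_tendstoD(1)[OF deriv_h_ratio this] ev_K_pos show ?thesis
    by eventually_elim (simp add: zero_less_divide_iff)
qed

lemma S_ratio_eq: "\<forall>\<^sub>F r in at_right 0. S_ratio \<Omega> (deriv h) (frontier \<Omega>) r = ereal (2 * n (2 * r) / deriv h r)"
  using ev_deriv_h_pos eventually_at_right_less[of "0::real"]
  by eventually_elim (simp add: S_ratio_def emeasure_frontier_parallel_set enn2ereal_ennreal)

lemma S_bounds_iff:
  "0 < lower_S \<Omega> (deriv h) (frontier \<Omega>) \<and> lower_S \<Omega> (deriv h) (frontier \<Omega>) \<le> upper_S \<Omega> (deriv h) (frontier \<Omega>)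
    \<and> upper_S \<Omega> (deriv h) (frontier \<Omega>) < \<infinity> \<longleftrightarrow> asymp_bounds (at_right 0) K n"
proof -
  have K2: "asymp_bounds (at_right 0) K (\<lambda>r. K (2 * r))"
    by (rule asymp_bounds_tendsto[OF K_ratio[of 2] _ ev_K_pos]) auto
  have Kh: "asymp_bounds (at_right 0) K (deriv h)"
    by (rule asymp_bounds_tendsto[OF deriv_h_ratio _ ev_K_pos]) (use D in auto)
  note Kh2 = asymp_bounds_trans[OF asymp_bounds_sym[OF Kh] K2]
  have "asymp_bounds (at_right 0) (\<lambda>_. 1) (\<lambda>r. 2 * n (2 * r) / deriv h r)
      \<longleftrightarrow> asymp_bounds (at_right 0) (deriv h) (\<lambda>r. 2 * real (n (2 * r)))"
    using asymp_bounds_ratio_iff[OF ev_deriv_h_pos, of "\<lambda>r. 2 * real (n (2 * r))"] by simp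
  also have "\<dots> \<longleftrightarrow> asymp_bounds (at_right 0) (deriv h) (\<lambda>r. real (n (2 * r)))"
    by (rule asymp_bounds_const_mult) simp
  also have "\<dots> \<longleftrightarrow> asymp_bounds (at_right 0) (\<lambda>r. K (2 * r)) (\<lambda>r. real (n (2 * r)))"
    using asymp_bounds_trans[OF Kh2] asymp_bounds_trans[OF asymp_bounds_sym[OF Kh2]] by blast
  also have "\<dots> \<longleftrightarrow> asymp_bounds (at_right 0) K n"
    by (rule asymp_bounds_scale_iff[of 2 K "\<lambda>r. real (n r)"]) simp
  finally show ?thesis
    unfolding lower_S_def upper_S_def using Liminf_Limsup_bounds_iff[OF _ S_ratio_eq] by simp
qed

text \<open>Two boundary points per interval and \<open>K (2 * r) / K r\<close> give
  \<open>2 * 2 powr (- D)\<close>, the derivative gives \<open>1 / (1 - D)\<close>; the product is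
  the constant of the Minkowski content, whence the two contents agree.\<close>

lemma tendsto_S_ratio_iff:
  "((\<lambda>r. 2 * n (2 * r) / deriv h r) \<longlongrightarrow> 2 powr (1 - D) * \<kappa> / (1 - D)) (at_right 0)
    \<longleftrightarrow> ((\<lambda>t. n t / K t) \<longlongrightarrow> \<kappa>) (at_right 0)"
proof
  assume "((\<lambda>t. n t / K t) \<longlongrightarrow> \<kappa>) (at_right 0)"
  then have "((\<lambda>r. n (2 * r) / K (2 * r)) \<longlongrightarrow> \<kappa>) (at_right 0)"
    using tendsto_scale_iff[of 2 "\<lambda>t. n t / K t"] by simp
  then have "((\<lambda>r. 2 * (n (2 * r) / K (2 * r)) * (K (2 * r) / K r) / (deriv h r / K r)) \<longlongrightarrow>
      2 * \<kappa> * 2 powr (- D) / (1 - D)) (at_right 0)"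
    by (intro tendsto_intros K_ratio deriv_h_ratio) (use D in auto)
  moreover have "\<forall>\<^sub>F r in at_right 0. 2 * (n (2 * r) / K (2 * r)) * (K (2 * r) / K r) / (deriv h r / K r)
      = 2 * n (2 * r) / deriv h r"
    using ev_K_pos eventually_scale[OF ev_K_pos, of 2, simplified] by eventually_elim auto
  ultimately have "((\<lambda>r. 2 * n (2 * r) / deriv h r) \<longlongrightarrow> 2 * \<kappa> * 2 powr (- D) / (1 - D)) (at_right 0)"
    by (rule Lim_transform_eventually)
  moreover have "2 * \<kappa> * 2 powr (- D) = 2 powr (1 - D) * \<kappa>" by (simp add: powr_diff powr_minus field_simps)
  ultimately show "((\<lambda>r. 2 * n (2 * r) / deriv h r) \<longlongrightarrow> 2 powr (1 - D) * \<kappa> / (1 - D)) (at_right 0)" by simp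
next
  assume lim: "((\<lambda>r. 2 * n (2 * r) / deriv h r) \<longlongrightarrow> 2 powr (1 - D) * \<kappa> / (1 - D)) (at_right 0)"
  have "((\<lambda>r. 2 * n (2 * r) / deriv h r * (deriv h r / K r) / (K (2 * r) / K r) / 2) \<longlongrightarrow>
      2 powr (1 - D) * \<kappa> / (1 - D) * (1 - D) / 2 powr (- D) / 2) (at_right 0)"
    by (rule tendsto_divide[OF tendsto_divide[OF tendsto_mult[OF lim deriv_h_ratio] K_ratio] tendsto_const]) auto
  moreover have "\<forall>\<^sub>F r in at_right 0. 2 * n (2 * r) / deriv h r * (deriv h r / K r) / (K (2 * r) / K r) / 2
      = n (2 * r) / K (2 * r)"
    using ev_K_pos ev_deriv_h_pos by eventually_elim auto
  ultimately have "((\<lambda>r. n (2 * r) / K (2 * r)) \<longlongrightarrow> 2 powr (1 - D) * \<kappa> / (1 - D) * (1 - D) / 2 powr (- D) / 2) (at_right 0)"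
    by (rule Lim_transform_eventually)
  moreover have "2 powr (1 - D) * \<kappa> / (1 - D) * (1 - D) / 2 powr (- D) / 2 = \<kappa>"
    using D by (simp add: powr_diff powr_minus field_simps)
  ultimately show "((\<lambda>t. n t / K t) \<longlongrightarrow> \<kappa>) (at_right 0)"
    using tendsto_scale_iff[of 2 "\<lambda>t. n t / K t"] by simp
qed

lemma S_measurable_iff:
  "S_measurable \<Omega> (deriv h) (frontier \<Omega>) \<longleftrightarrow> (\<exists>\<kappa>>0. ((\<lambda>t. n t / K t) \<longlongrightarrow> \<kappa>) (at_right 0))"
proof -
  have "S_measurable \<Omega> (deriv h) (frontier \<Omega>) \<longleftrightarrow> (\<exists>M>0. ((\<lambda>r. 2 * n (2 * r) / deriv h r) \<longlongrightarrow> M) (at_right 0))"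
    unfolding S_measurable_def S_content_def lower_S_def upper_S_def
    by (rule Liminf_Limsup_measurable_iff[OF _ S_ratio_eq]) simp
  also have "\<dots> \<longleftrightarrow> (\<exists>\<kappa>>0. ((\<lambda>t. n t / K t) \<longlongrightarrow> \<kappa>) (at_right 0))"
  proof
    assume "\<exists>M>0. ((\<lambda>r. 2 * n (2 * r) / deriv h r) \<longlongrightarrow> M) (at_right 0)"
    then obtain M where M: "0 < M" "((\<lambda>r. 2 * n (2 * r) / deriv h r) \<longlongrightarrow> M) (at_right 0)" by blast
    define \<kappa> where "\<kappa> = M * (1 - D) / 2 powr (1 - D)"
    have "M = 2 powr (1 - D) * \<kappa> / (1 - D)" using D by (simp add: \<kappa>_def)
    moreover have "0 < \<kappa>" using M(1) D by (simp add: \<kappa>_def)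
    ultimately show "\<exists>\<kappa>>0. ((\<lambda>t. n t / K t) \<longlongrightarrow> \<kappa>) (at_right 0)" using M(2) tendsto_S_ratio_iff by blast
  next
    assume "\<exists>\<kappa>>0. ((\<lambda>t. n t / K t) \<longlongrightarrow> \<kappa>) (at_right 0)"
    then obtain \<kappa> where \<kappa>: "0 < \<kappa>" "((\<lambda>t. n t / K t) \<longlongrightarrow> \<kappa>) (at_right 0)" by blast
    have "0 < 2 powr (1 - D) * \<kappa> / (1 - D)" using \<kappa>(1) D by simp
    with \<kappa>(2) show "\<exists>M>0. ((\<lambda>r. 2 * n (2 * r) / deriv h r) \<longlongrightarrow> M) (at_right 0)"
      using tendsto_S_ratio_iff by blast
  qed
  finally show ?thesis .
qed

lemma S_content_eq:
  assumes "((\<lambda>t. n t / K t) \<longlongrightarrow> \<kappa>) (at_right 0)"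
  shows "S_content \<Omega> (deriv h) (frontier \<Omega>) = ereal (2 powr (1 - D) * \<kappa> / (1 - D))"
  unfolding S_content_def lower_S_def upper_S_def
  by (rule Liminf_Limsup_content(3)[OF _ S_ratio_eq tendsto_S_ratio_iff[THEN iffD2, OF assms]]) simp

end

lemma gauge_f_inverse: "t \<noteq> 0 \<Longrightarrow> gauge_f h (inverse t) = K t"
  by (simp add: gauge_f_def K_def field_simps)

lemma infsum_frac_eq:
  assumes x: "0 < x"
  shows "(\<Sum>\<^sub>\<infinity>j\<in>{1..}. frac (l j * x)) = G x"
proof -
  have "((\<lambda>j. frac (l (Suc j) * x)) has_sum G x) UNIV"
    by (rule sums_nonneg_imp_has_sum[OF G_sums[OF x]]) simp
  then have "((\<lambda>j. frac (l j * x)) has_sum G x) (range Suc)"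
    by (subst has_sum_reindex) (auto simp: o_def)
  moreover have "range Suc = {1..}" by (auto simp: image_iff Suc_le_eq gr0_conv_Suc)
  ultimately show ?thesis by (simp add: infsumI)
qed

lemma frac_sum_bounds_iff:
  "asymp_bounds at_top (\<lambda>x. \<Sum>\<^sub>\<infinity>j\<in>{1..}. frac (l j * x)) (gauge_f h) \<longleftrightarrow> asymp_bounds (at_right 0) K n"
proof -
  have "asymp_bounds at_top (\<lambda>x. \<Sum>\<^sub>\<infinity>j\<in>{1..}. frac (l j * x)) (gauge_f h) \<longleftrightarrow> asymp_bounds at_top G (gauge_f h)"
    by (rule asymp_bounds_cong, rule eventually_mono[OF eventually_gt_at_top[of 0]], rule infsum_frac_eq) auto
  also have "\<dots> \<longleftrightarrow> asymp_bounds (at_right 0) (\<lambda>t. G (inverse t)) (\<lambda>t. gauge_f h (inverse t))"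
    unfolding asymp_bounds_def eventually_at_top_to_right ..
  also have "\<dots> \<longleftrightarrow> asymp_bounds (at_right 0) (\<lambda>t. G (1 / t)) K"
    by (rule asymp_bounds_cong)
      (auto intro!: eventually_mono[OF eventually_at_right_less[of "0::real"]] simp: gauge_f_inverse,
        simp add: inverse_eq_divide)
  also have "\<dots> \<longleftrightarrow> asymp_bounds (at_right 0) K n"
    using asymp_bounds_commute asymp_bounds_G_iff_W asymp_bounds_W_iff_n by blast
  finally show ?thesis .
qed

lemma gauge_f_sqrt: "0 < x \<Longrightarrow> gauge_f h (sqrt x) = K (1 / pi * (pi / sqrt x))"
  by (simp add: gauge_f_def K_def)

text \<open>The shift by \<open>pi\<close> between the arguments of \<open>G\<close> and of the
  gauge is a fixed scaling of \<open>K\<close>, harmless for two-sided bounds.\<close>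

lemma spectral_bounds_iff:
  assumes "dirichlet_spectrum \<Omega> ev"
  shows "asymp_bounds at_top (\<lambda>x. weyl_term \<Omega> x - counting_function ev x) (\<lambda>x. gauge_f h (sqrt x))
    \<longleftrightarrow> asymp_bounds (at_right 0) K n"
proof -
  have "asymp_bounds at_top (\<lambda>x. weyl_term \<Omega> x - counting_function ev x) (\<lambda>x. gauge_f h (sqrt x))
      \<longleftrightarrow> asymp_bounds at_top (\<lambda>x. G (1 / (pi / sqrt x))) (\<lambda>x. K (1 / pi * (pi / sqrt x)))"
    by (rule asymp_bounds_cong)
      (auto intro!: eventually_mono[OF eventually_gt_at_top[of 0]] simp: weyl_minus_counting[OF assms] gauge_f_sqrt)
  also have "\<dots> \<longleftrightarrow> asymp_bounds (at_right 0) (\<lambda>t. G (1 / t)) (\<lambda>t. K (1 / pi * t))"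
    unfolding asymp_bounds_def
    using at_top_sqrt_iff_at_right[of "\<lambda>t. c * G (1 / t) \<le> K (1 / pi * t) \<and> K (1 / pi * t) \<le> C * G (1 / t)" for c C]
    by simp
  also have "\<dots> \<longleftrightarrow> asymp_bounds (at_right 0) (\<lambda>t. G (1 / t)) K"
  proof -
    have "asymp_bounds (at_right 0) K (\<lambda>t. K (1 / pi * t))"
      by (rule asymp_bounds_tendsto[OF K_ratio[of "1 / pi"] _ ev_K_pos]) auto
    then show ?thesis using asymp_bounds_trans asymp_bounds_sym by blast
  qed
  also have "\<dots> \<longleftrightarrow> asymp_bounds (at_right 0) K n"
    using asymp_bounds_commute asymp_bounds_G_iff_W asymp_bounds_W_iff_n by blast
  finally show ?thesis .
qed

text \<open>With \<open>t = pi / sqrt x\<close> the remainder is \<open>G (1 / t)\<close> measured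
  against \<open>K (t / pi)\<close>, and \<open>K (t / pi) / K t\<close> tends to
  \<open>pi powr D\<close>: this is the power of \<open>pi\<close> in \<open>c1\<close>. The power
  of 2 and the factor \<open>1 - D\<close> in \<open>c1\<close> cancel those in the content, leaving
  \<open>- \<kappa> * \<zeta>\<close>.\<close>

lemma spectral_asymptotics:
  assumes sp: "dirichlet_spectrum \<Omega> ev" and \<kappa>: "0 < \<kappa>" "((\<lambda>t. n t / K t) \<longlongrightarrow> \<kappa>) (at_right 0)"
  shows "(\<lambda>x. counting_function ev x - (weyl_term \<Omega> x - c1 D * (2 powr (1 - D) * \<kappa> / (1 - D)) * gauge_f h (sqrt x)))
    \<in> o[at_top](\<lambda>x. gauge_f h (sqrt x))"
proof (rule smalloI_tendsto)
  define \<zeta> where "\<zeta> = Re (riemann_zeta (complex_of_real D))"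
  define M where "M = 2 powr (1 - D) * \<kappa> / (1 - D)"
  \<comment> \<open>The error term divided by the gauge, written in the variable
    \<open>t\<close>.\<close>
  define \<phi> where "\<phi> t = c1 D * M - G (1 / t) / K (1 / pi * t)" for t
  have pi0: "0 < 1 / pi" by simp
  have c1M: "c1 D * M = - \<kappa> * \<zeta> / (1 / pi) powr (- D)"
  proof -
    have "2 powr (D - 1) * 2 powr (1 - D) = (1::real)" by (simp add: powr_add[symmetric])
    then have "c1 D * M = pi powr (- D) * (- \<zeta>) * \<kappa>"
      using D by (simp add: c1_def M_def \<zeta>_def field_simps)
    also have "\<dots> = - \<kappa> * \<zeta> / (1 / pi) powr (- D)" by (simp add: powr_divide powr_minus field_simps)
    finally show ?thesis .
  qed
  have "((\<lambda>t. c1 D * M - (G (1 / t) / K t) / (K (1 / pi * t) / K t)) \<longlongrightarrow>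
      c1 D * M - (- \<kappa> * \<zeta>) / (1 / pi) powr (- D)) (at_right 0)"
    unfolding \<zeta>_def
    by (intro tendsto_intros tendsto_G[OF \<kappa> riemann_zeta_real_limit[OF D]] K_ratio[OF pi0]) auto
  moreover have "\<forall>\<^sub>F t in at_right 0. c1 D * M - (G (1 / t) / K t) / (K (1 / pi * t) / K t) = \<phi> t"
    using ev_K_pos by eventually_elim (simp add: \<phi>_def)
  ultimately have "(\<phi> \<longlongrightarrow> c1 D * M - (- \<kappa> * \<zeta>) / (1 / pi) powr (- D)) (at_right 0)"
    by (rule Lim_transform_eventually)
  then have "(\<phi> \<longlongrightarrow> 0) (at_right 0)" by (simp add: c1M)
  then have lim: "((\<lambda>x. \<phi> (pi / sqrt x)) \<longlongrightarrow> 0) at_top"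
    unfolding tendsto_def using at_top_sqrt_iff_at_right[of "\<lambda>t. \<phi> t \<in> S" for S] by simp
  have f_pos: "\<forall>\<^sub>F x in at_top. 0 < gauge_f h (sqrt x)"
  proof -
    have "\<forall>\<^sub>F x in at_top. 0 < K (1 / pi * (pi / sqrt x))"
      using eventually_scale[OF ev_K_pos pi0] at_top_sqrt_iff_at_right[of "\<lambda>t. 0 < K (1 / pi * t)"] by simp
    then show ?thesis using eventually_gt_at_top[of 0] by eventually_elim (simp add: gauge_f_sqrt)
  qed
  then show "\<forall>\<^sub>F x in at_top. gauge_f h (sqrt x) \<noteq> 0" by eventually_elim simp
  have "\<forall>\<^sub>F x in at_top. \<phi> (pi / sqrt x) = (counting_function ev x
      - (weyl_term \<Omega> x - c1 D * M * gauge_f h (sqrt x))) / gauge_f h (sqrt x)"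
    using f_pos eventually_gt_at_top[of 0]
  proof eventually_elim
    case (elim x)
    have "counting_function ev x - weyl_term \<Omega> x = - G (1 / (pi / sqrt x))"
      using weyl_minus_counting[OF sp elim(2)] by simp
    then have "counting_function ev x - (weyl_term \<Omega> x - c1 D * M * gauge_f h (sqrt x))
        = c1 D * M * gauge_f h (sqrt x) - G (1 / (pi / sqrt x))" by linarith
    then show ?case using elim(1)
      by (simp only: \<phi>_def gauge_f_sqrt[OF elim(2), symmetric]) (simp add: diff_divide_distrib)
  qed
  from Lim_transform_eventually[OF lim this]
  show "((\<lambda>x. (counting_function ev x - (weyl_term \<Omega> x - c1 D * (2 powr (1 - D) * \<kappa> / (1 - D)) * gauge_f h (sqrt x)))
      / gauge_f h (sqrt x)) \<longlongrightarrow> 0) at_top"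
    unfolding M_def .
qed

end

theorem theorem2p5:
  fixes \<Omega> F :: "real set" and D \<delta> :: real
    and h :: "real \<Rightarrow> real" and l ev :: "nat \<Rightarrow> real"
  assumes "open \<Omega>" and "bounded \<Omega>"
    and "F = frontier \<Omega>"
    and "0 < D" and "D < 1" and "has_minkowski_dim \<Omega> F D"
    and "fractal_string \<Omega> l"
    and "dirichlet_spectrum \<Omega> ev"
    and "h \<in> SR (1 - D)"
    and "0 < \<delta>" and "strict_mono_on {0<..<\<delta>} (gauge_H h)"
  shows
    \<comment> \<open>I: equivalence of (i), (iii), (iv), (v), and of (ii) with (i)\<close>
    "tfae
       [0 < lower_M \<Omega> h F \<and> lower_M \<Omega> h F \<le> upper_M \<Omega> h F \<and> upper_M \<Omega> h F < \<infinity>,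
        asymp_bounds at_top l (\<lambda>j. gauge_g h \<delta> (real j)),
        asymp_bounds at_top (\<lambda>x. \<Sum>\<^sub>\<infinity>j\<in>{1..}. frac (l j * x)) (gauge_f h),
        asymp_bounds at_top (\<lambda>x. weyl_term \<Omega> x - counting_function ev x) (\<lambda>x. gauge_f h (sqrt x))]
     \<and> (smoothly_varying (1 - D) h \<longrightarrow>
         (0 < lower_M \<Omega> h F \<and> lower_M \<Omega> h F \<le> upper_M \<Omega> h F \<and> upper_M \<Omega> h F < \<infinity> \<longleftrightarrow>
          0 < lower_S \<Omega> (deriv h) F \<and> lower_S \<Omega> (deriv h) F \<le> upper_S \<Omega> (deriv h) F \<and>
            upper_S \<Omega> (deriv h) F < \<infinity>))
     \<comment> \<open>II: equivalence of (vi) and (viii), and of (vii) with (vi)\<close>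
     \<and> (minkowski_measurable \<Omega> h F \<longleftrightarrow>
         (\<exists>L>0. l \<sim>[at_top] (\<lambda>j. L * gauge_g h \<delta> (real j))))
     \<and> (smoothly_varying (1 - D) h \<longrightarrow>
         (minkowski_measurable \<Omega> h F \<longleftrightarrow> S_measurable \<Omega> (deriv h) F))
     \<comment> \<open>values of the contents\<close>
     \<and> (\<forall>L>0. l \<sim>[at_top] (\<lambda>j. L * gauge_g h \<delta> (real j)) \<longrightarrow>
          M_content \<Omega> h F = ereal (2 powr (1 - D) * L powr D / (1 - D)) \<and>
          (smoothly_varying (1 - D) h \<longrightarrow>
             S_content \<Omega> (deriv h) F = ereal (2 powr (1 - D) * L powr D / (1 - D))))
     \<comment> \<open>spectral asymptotics\<close>
     \<and> (minkowski_measurable \<Omega> h F \<longrightarrow>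
         (\<lambda>x. counting_function ev x -
            (weyl_term \<Omega> x - c1 D * real_of_ereal (M_content \<Omega> h F) * gauge_f h (sqrt x)))
           \<in> o[at_top](\<lambda>x. gauge_f h (sqrt x)))"
proof -
  obtain \<alpha> \<beta> where "real_string \<Omega> l \<alpha> \<beta>"
    using real_string_of_fractal_string[OF assms(1,2,7)] .
  then interpret real_string \<Omega> l \<alpha> \<beta> .
  interpret gauge D \<delta> h "gauge_g h \<delta>"
    by (rule gauge_of_SR) fact+
  interpret gauged_domain D \<delta> h "gauge_g h \<delta>" l \<Omega> \<alpha> \<beta>
    by unfold_locales
  note F = assms(3) and spectrum = assms(8)
  show ?thesis unfolding F
  proof (intro conjI impI allI)
    show "tfae
       [0 < lower_M \<Omega> h (frontier \<Omega>) \<and> lower_M \<Omega> h (frontier \<Omega>) \<le> upper_M \<Omega> h (frontier \<Omega>) \<and> upper_M \<Omega> h (frontier \<Omega>) < \<infinity>,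
        asymp_bounds at_top l (\<lambda>j. gauge_g h \<delta> (real j)),
        asymp_bounds at_top (\<lambda>x. \<Sum>\<^sub>\<infinity>j\<in>{1..}. frac (l j * x)) (gauge_f h),
        asymp_bounds at_top (\<lambda>x. weyl_term \<Omega> x - counting_function ev x) (\<lambda>x. gauge_f h (sqrt x))]"
      \<comment> \<open>After these rewrites all four entries of the list are the same statement
        about \<open>n\<close> and \<open>K\<close>.\<close>
      unfolding tfae_def M_bounds_iff asymp_bounds_n_iff_l frac_sum_bounds_iff spectral_bounds_iff[OF spectrum] by simp
  next
    assume smooth: "smoothly_varying (1 - D) h"
    show "0 < lower_M \<Omega> h (frontier \<Omega>) \<and> lower_M \<Omega> h (frontier \<Omega>) \<le> upper_M \<Omega> h (frontier \<Omega>) \<and> upper_M \<Omega> h (frontier \<Omega>) < \<infinity> \<longleftrightarrow>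
          0 < lower_S \<Omega> (deriv h) (frontier \<Omega>) \<and> lower_S \<Omega> (deriv h) (frontier \<Omega>) \<le> upper_S \<Omega> (deriv h) (frontier \<Omega>) \<and>
            upper_S \<Omega> (deriv h) (frontier \<Omega>) < \<infinity>"
      unfolding M_bounds_iff S_bounds_iff[OF smooth] ..
    show "minkowski_measurable \<Omega> h (frontier \<Omega>) \<longleftrightarrow> S_measurable \<Omega> (deriv h) (frontier \<Omega>)"
      unfolding minkowski_measurable_iff S_measurable_iff[OF smooth] ..
  next
    show "minkowski_measurable \<Omega> h (frontier \<Omega>) \<longleftrightarrow> (\<exists>L>0. l \<sim>[at_top] (\<lambda>j. L * gauge_g h \<delta> (real j)))"
      unfolding minkowski_measurable_iff ex_asymp_equiv_l_iff ..
  next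
    fix L :: real assume L: "0 < L" "l \<sim>[at_top] (\<lambda>j. L * gauge_g h \<delta> (real j))"
    then have lim: "((\<lambda>t. n t / K t) \<longlongrightarrow> L powr D) (at_right 0)" using asymp_equiv_l_iff by blast
    show "M_content \<Omega> h (frontier \<Omega>) = ereal (2 powr (1 - D) * L powr D / (1 - D))"
      using L lim by (intro M_content_eq) auto
    show "S_content \<Omega> (deriv h) (frontier \<Omega>) = ereal (2 powr (1 - D) * L powr D / (1 - D))"
      if "smoothly_varying (1 - D) h"
      by (rule S_content_eq[OF that lim])
  next
    assume "minkowski_measurable \<Omega> h (frontier \<Omega>)"
    then obtain \<kappa> where \<kappa>: "0 < \<kappa>" "((\<lambda>t. n t / K t) \<longlongrightarrow> \<kappa>) (at_right 0)"
      unfolding minkowski_measurable_iff by blast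
    show "(\<lambda>x. counting_function ev x -
            (weyl_term \<Omega> x - c1 D * real_of_ereal (M_content \<Omega> h (frontier \<Omega>)) * gauge_f h (sqrt x)))
           \<in> o[at_top](\<lambda>x. gauge_f h (sqrt x))"
      using spectral_asymptotics[OF spectrum \<kappa>] by (simp add: M_content_eq[OF \<kappa>])
  qed
qed

end
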